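(* Let $1<p<\infty$, let $\Omega\subset\mathbf{R}^n$ be a nonempty open set, let $Q_1,Q_2\ge 1$, and let $u_i$ be a $Q_i$-quasisuperminimizer in $\Omega$ for $i=1,2$. Then $u=\min\{u_1,u_2\}$ is a $\overline{Q}$-quasisuperminimizer in $\Omega$, where $$\overline{Q}=\begin{cases} 1, & \text{if } Q_1=Q_2=1,\\ \displaystyle (Q_1+Q_2-2)\frac{Q_1Q_2}{Q_1Q_2-1}, & \text{otherwise.}\end{cases}$$ In particular, if $Q_1=Q_2$, then $\overline{Q}=2Q_1^2/(Q_1+1)$.
   Context: Let $1<p<\infty$, let $\Omega\subset\mathbf{R}^n$ be a nonempty open set and $Q\ge1$. A function $u\in W^{1,p}_{\rm loc}(\Omega)$ is a $Q$-quasisuperminimizer in $\Omega$ if $$\int_{\varphi\ne0}|\nabla u|^p\,dx\le Q\int_{\varphi\ne0}|\nabla(u+\varphi)|^p\,dx$$ for all nonnegative $\varphi\in W^{1,p}_0(\Omega)$, where the integrals are over $\{x\in\Omega:\varphi(x)\ne0\}$. *)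

theory Defs
  imports "HOL-Analysis.Analysis"
begin

text \<open>
  Functions on \<open>\<Omega>\<close> are represented by total functions; only their values on \<open>\<Omega>\<close> (up to Lebesgue null
  sets) matter.
\<close>

subsection \<open>Test functions\<close>

definition partial_deriv :: "'a::euclidean_space \<Rightarrow> ('a \<Rightarrow> real) \<Rightarrow> 'a \<Rightarrow> real" where
  "partial_deriv b f x = frechet_derivative f (at x) b"

text \<open>
  All iterated partial derivatives exist and are differentiable (hence continuous), i.e. \<open>C\<^sup>\<infinity>\<close>.
\<close>

definition smooth :: "('a::euclidean_space \<Rightarrow> real) \<Rightarrow> bool" where
  "smooth f \<longleftrightarrow> (\<forall>bs. set bs \<subseteq> Basis \<longrightarrow> (foldr partial_deriv bs f) differentiable_on UNIV)"

definition test_fun :: "'a::euclidean_space set \<Rightarrow> ('a \<Rightarrow> real) set" where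
  "test_fun \<Omega> = {\<psi>. smooth \<psi> \<and> compact (closure {x. \<psi> x \<noteq> 0}) \<and> closure {x. \<psi> x \<noteq> 0} \<subseteq> \<Omega>}"

subsection \<open>Sobolev spaces\<close>

definition Lp :: "real \<Rightarrow> 'a::euclidean_space set \<Rightarrow> ('a \<Rightarrow> 'b::euclidean_space) set" where
  "Lp p \<Omega> = {f. f \<in> borel_measurable (lebesgue_on \<Omega>) \<and>
                 integrable (lebesgue_on \<Omega>) (\<lambda>x. norm (f x) powr p)}"

definition Lp_loc :: "real \<Rightarrow> 'a::euclidean_space set \<Rightarrow> ('a \<Rightarrow> 'b::euclidean_space) set" where
  "Lp_loc p \<Omega> = {f. f \<in> borel_measurable (lebesgue_on \<Omega>) \<and> (\<forall>K. compact K \<and> K \<subseteq> \<Omega> \<longrightarrow> f \<in> Lp p K)}"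

definition has_weak_gradient ::
    "('a::euclidean_space \<Rightarrow> real) \<Rightarrow> ('a \<Rightarrow> 'a) \<Rightarrow> 'a set \<Rightarrow> bool" where
  "has_weak_gradient u g \<Omega> \<longleftrightarrow>
     u \<in> Lp_loc 1 \<Omega> \<and> g \<in> Lp_loc 1 \<Omega> \<and>
     (\<forall>\<psi>\<in>test_fun \<Omega>. \<forall>b\<in>Basis.
        (LINT x|lebesgue_on \<Omega>. u x * partial_deriv b \<psi> x) = - (LINT x|lebesgue_on \<Omega>. (g x \<bullet> b) * \<psi> x))"

text \<open>
  A weak gradient is unique only up to null sets; a representative is chosen. The value is
  meaningful only if a weak gradient exists, which is the case wherever it is used below.
\<close>

definition weak_grad :: "'a::euclidean_space set \<Rightarrow> ('a \<Rightarrow> real) \<Rightarrow> 'a \<Rightarrow> 'a" where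
  "weak_grad \<Omega> u = (SOME g. has_weak_gradient u g \<Omega>)"

definition W1p :: "real \<Rightarrow> 'a::euclidean_space set \<Rightarrow> ('a \<Rightarrow> real) set" where
  "W1p p \<Omega> = {u. u \<in> Lp p \<Omega> \<and> (\<exists>g. has_weak_gradient u g \<Omega> \<and> g \<in> Lp p \<Omega>)}"

definition W1p_loc :: "real \<Rightarrow> 'a::euclidean_space set \<Rightarrow> ('a \<Rightarrow> real) set" where
  "W1p_loc p \<Omega> = {u. u \<in> Lp_loc p \<Omega> \<and> (\<exists>g. has_weak_gradient u g \<Omega> \<and> g \<in> Lp_loc p \<Omega>)}"

definition W1p_norm :: "real \<Rightarrow> 'a::euclidean_space set \<Rightarrow> ('a \<Rightarrow> real) \<Rightarrow> real" where
  "W1p_norm p \<Omega> u =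
     ((LINT x|lebesgue_on \<Omega>. \<bar>u x\<bar> powr p) + (LINT x|lebesgue_on \<Omega>. norm (weak_grad \<Omega> u x) powr p))
       powr (1 / p)"

text \<open>The closure of the test functions in \<open>W\<^sup>1\<^sup>,\<^sup>p\<close>.\<close>

definition W1p_0 :: "real \<Rightarrow> 'a::euclidean_space set \<Rightarrow> ('a \<Rightarrow> real) set" where
  "W1p_0 p \<Omega> = {\<phi>. \<phi> \<in> W1p p \<Omega> \<and>
                   (\<forall>\<epsilon>>0. \<exists>\<psi>\<in>test_fun \<Omega>. W1p_norm p \<Omega> (\<lambda>x. \<phi> x - \<psi> x) < \<epsilon>)}"

subsection \<open>Quasisuperminimizers\<close>

text \<open>
  The integrals are taken in \<open>[0, \<infinity>]\<close>: as \<open>u\<close> is only locally in \<open>W\<^sup>1\<^sup>,\<^sup>p\<close>, both sides may be infinite.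
  Nonnegativity of \<open>\<phi>\<close> is understood almost everywhere, as usual for Sobolev functions.
\<close>

definition quasisuperminimizer ::
    "real \<Rightarrow> real \<Rightarrow> 'a::euclidean_space set \<Rightarrow> ('a \<Rightarrow> real) \<Rightarrow> bool" where
  "quasisuperminimizer p Q \<Omega> u \<longleftrightarrow>
     Q \<ge> 1 \<and> u \<in> W1p_loc p \<Omega> \<and>
     (\<forall>\<phi>\<in>W1p_0 p \<Omega>. (AE x in lebesgue_on \<Omega>. 0 \<le> \<phi> x) \<longrightarrow>
        (\<integral>\<^sup>+x\<in>{x\<in>\<Omega>. \<phi> x \<noteq> 0}. ennreal (norm (weak_grad \<Omega> u x) powr p) \<partial>lebesgue)
        \<le> ennreal Q *
          (\<integral>\<^sup>+x\<in>{x\<in>\<Omega>. \<phi> x \<noteq> 0}. ennreal (norm (weak_grad \<Omega> (\<lambda>y. u y + \<phi> y) x) powr p) \<partial>lebesgue))"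

end

theory Submission
  imports Defs
begin

text \<open>
  Let \<open>u = min u1 u2\<close>, let \<open>\<phi> \<ge> 0\<close> be an admissible test function and put \<open>v = u + \<phi>\<close>. The function
  \<open>u1\<close> has two useful competitors. Raising it to \<open>max u1 v\<close> compares its energy with that of \<open>v\<close> on
  \<open>{u1 < v}\<close>. Raising it only to \<open>max u1 (min u2 v)\<close> changes it exactly where \<open>u1 < u2\<close> and
  \<open>\<phi> > 0\<close>, and there the competitor is \<open>v\<close> if \<open>v \<le> u2\<close> and \<open>u2\<close> otherwise. With the same two tests
  for \<open>u2\<close> there are four inequalities. The first kind is not enough by itself: where both functions
  lie below \<open>v\<close> it also counts the energy of the larger function, which does not matter for \<open>u\<close>,
  and adding the inequalities gives the constant \<open>Q1 + Q2\<close>. The second kind has the energy of the larger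
  function on its right-hand side. So one takes the first kind with weights \<open>\<alpha>1\<close>, \<open>\<alpha>2\<close> and the
  second kind with weights \<open>1 - \<alpha>1\<close>, \<open>1 - \<alpha>2\<close>, and chooses them such that the energies of the larger
  function cancel, i.e. \<open>\<alpha>2 = (1 - \<alpha>1) Q1\<close> and \<open>\<alpha>1 = (1 - \<alpha>2) Q2\<close>. Then \<open>v\<close> enters
  with the factor \<open>\<alpha>1 Q1 + \<alpha>2 Q2\<close>, which is the constant of the theorem, on the set where both
  functions lie below \<open>v\<close>, and elsewhere with the factor \<open>Q1\<close> or \<open>Q2\<close>, which is no larger. Where \<open>u1 = u2\<close>, only
  the first kind contributes, and \<open>\<alpha>1 + \<alpha>2 \<ge> 1\<close> suffices because the two gradients agree almost
  everywhere on this set (\<open>quasi_weights\<close>, \<open>quasi_min_compact_support\<close>).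

  To cancel energies they have to be finite, but those of \<open>u1\<close> and \<open>u2\<close> are only locally finite.
  The argument is therefore carried out for \<open>\<phi>\<close> with compact support. The general
  case follows by applying it to \<open>min \<phi>\<^sup>+ \<psi>\<^sub>n\<^sup>+\<close> with test functions \<open>\<psi>\<^sub>n\<close> that converge to \<open>\<phi>\<close>:
  wherever this truncation is positive its gradient is that of \<open>\<phi>\<close> or that of \<open>\<psi>\<^sub>n\<close>, so that the
  error is controlled by the gradient of \<open>\<psi>\<^sub>n - \<phi>\<close>, and Fatou's lemma takes care of the left-hand
  side (\<open>quasi_min_inequality\<close>).

  The increments of the competitors are \<open>\<phi> - min \<phi> (u1 - u2)\<^sup>+\<close> and \<open>min \<phi> (u2 - u1)\<^sup>+\<close>. That they
  are admissible rests on two facts about Sobolev functions: truncation preserves weak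
  differentiability with the expected gradient (\<open>has_weak_gradient_pos_part\<close>,
  \<open>weak_gradient_eq_0_on_zero_set\<close>), and a function in \<open>W\<^sup>1\<^sup>,\<^sup>p\<close> with compact support is a limit of test
  functions (\<open>compact_support_W1p_0\<close>). Both are obtained by mollification: convolution with a smooth
  bump yields smooth functions (\<open>smooth_convol\<close>), converges in \<open>L\<^sup>p\<close> (\<open>convol_tendsto_Lp\<close>) and
  commutes with weak differentiation (\<open>convol_weak_gradient\<close>).
\<close>

section \<open>Smooth functions, test functions and mollifiers\<close>

lemma partial_deriv_eqI:
  assumes "(f has_derivative D) (at x)"
  shows "partial_deriv b f x = D b"
  using frechet_derivative_at[OF assms] by (simp add: partial_deriv_def)

text \<open>
  A function is smooth as soon as it belongs to some family of differentiable functions that is closed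
  under partial derivatives. This reduces smoothness proofs to a single differentiation.
\<close>

lemma smooth_coinduct:
  assumes "f \<in> C"
    and diff: "\<And>f. f \<in> C \<Longrightarrow> f differentiable_on UNIV"
    and part: "\<And>f b. f \<in> C \<Longrightarrow> b \<in> Basis \<Longrightarrow> partial_deriv b f \<in> C"
  shows "smooth f"
proof -
  have "foldr partial_deriv bs f \<in> C" if "set bs \<subseteq> Basis" for bs
    using that by (induction bs) (auto simp: assms)
  then show ?thesis using diff by (auto simp: smooth_def)
qed

lemma smooth_partial_deriv:
  assumes "smooth f" "b \<in> Basis"
  shows "smooth (partial_deriv b f)"
  unfolding smooth_def
proof (intro allI impI)
  fix bs :: "'a list" assume "set bs \<subseteq> Basis"
  then have "foldr partial_deriv (bs @ [b]) f differentiable_on UNIV"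
    using assms unfolding smooth_def by (metis Un_insert_right empty_set insert_subset list.simps(15) set_append sup_bot.right_neutral)
  then show "foldr partial_deriv bs (partial_deriv b f) differentiable_on UNIV" by simp
qed

lemma smooth_differentiable: "smooth f \<Longrightarrow> f differentiable (at x)"
  unfolding smooth_def using differentiable_on_def[of f UNIV]
  by (metis UNIV_I empty_set empty_subsetI foldr_Nil id_apply)

lemma smooth_has_derivative:
  assumes "smooth f"
  shows "(f has_derivative (\<lambda>h. \<Sum>b\<in>Basis. (h \<bullet> b) * partial_deriv b f x)) (at x)"
proof -
  define D where "D = frechet_derivative f (at x)"
  have D: "(f has_derivative D) (at x)"
    unfolding D_def using smooth_differentiable[OF assms] frechet_derivative_works by blast
  interpret D: linear D using D has_derivative_linear by blast
  have "D h = (\<Sum>b\<in>Basis. (h \<bullet> b) * partial_deriv b f x)" for h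
  proof -
    have "D h = D (\<Sum>b\<in>Basis. (h \<bullet> b) *\<^sub>R b)" by (simp add: euclidean_representation)
    also have "\<dots> = (\<Sum>b\<in>Basis. (h \<bullet> b) * D b)" by (simp add: D.sum D.scale)
    finally show ?thesis by (simp add: partial_deriv_eqI[OF D])
  qed
  then have "D = (\<lambda>h. \<Sum>b\<in>Basis. (h \<bullet> b) * partial_deriv b f x)" by blast
  with D show ?thesis by simp
qed

lemma smooth_continuous_on: "smooth f \<Longrightarrow> continuous_on S f"
  by (meson continuous_at_imp_continuous_on differentiable_imp_continuous_within smooth_differentiable)

lemma smooth_has_field_derivative_line:
  assumes "smooth f" "b \<in> Basis"
  shows "((\<lambda>t. f (x + t *\<^sub>R b)) has_real_derivative partial_deriv b f (x + t *\<^sub>R b)) (at t)"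
proof -
  have 1: "((\<lambda>t. x + t *\<^sub>R b) has_derivative (\<lambda>t. t *\<^sub>R b)) (at t)"
    by (auto intro!: derivative_eq_intros)
  have "((\<lambda>t. f (x + t *\<^sub>R b)) has_derivative
     (\<lambda>s. \<Sum>c\<in>Basis. ((s *\<^sub>R b) \<bullet> c) * partial_deriv c f (x + t *\<^sub>R b))) (at t)"
    by (rule has_derivative_compose[OF 1 smooth_has_derivative[OF assms(1)]])
  moreover have "(\<Sum>c\<in>Basis. ((s *\<^sub>R b) \<bullet> c) * partial_deriv c f (x + t *\<^sub>R b)) =
      partial_deriv b f (x + t *\<^sub>R b) * s" for s
    using assms(2) by (subst sum.remove[of _ b]) (auto simp: inner_Basis intro!: sum.neutral split: if_splits)
  ultimately show ?thesis by (simp add: has_field_derivative_def)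
qed

text \<open>
  The Leibniz rule turns a product into a sum of two products, so the sums of products of smooth
  functions are the smallest family to which coinduction applies.
\<close>

inductive_set product_sums :: "('a::euclidean_space \<Rightarrow> real) set" where
  prod: "smooth f \<Longrightarrow> smooth g \<Longrightarrow> (\<lambda>x. f x * g x) \<in> product_sums"
| add: "f \<in> product_sums \<Longrightarrow> g \<in> product_sums \<Longrightarrow> (\<lambda>x. f x + g x) \<in> product_sums"

lemma product_sums_differentiable:
  "f \<in> product_sums \<Longrightarrow> f differentiable (at x)"
proof (induction rule: product_sums.induct)
  case (prod f g)
  then show ?case by (intro differentiable_mult smooth_differentiable)
next
  case (add f g)
  then show ?case by (intro differentiable_add)
qed

lemma partial_deriv_add:
  assumes "f differentiable (at x)" "g differentiable (at x)"
  shows "partial_deriv b (\<lambda>x. f x + g x) x = partial_deriv b f x + partial_deriv b g x"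
  using partial_deriv_eqI[OF has_derivative_add[OF assms[unfolded frechet_derivative_works]]]
  by (simp add: partial_deriv_def)

lemma partial_deriv_mult:
  fixes f g :: "'a::euclidean_space \<Rightarrow> real"
  assumes "f differentiable (at x)" "g differentiable (at x)"
  shows "partial_deriv b (\<lambda>x. f x * g x) x = f x * partial_deriv b g x + partial_deriv b f x * g x"
  using partial_deriv_eqI[OF has_derivative_mult[OF assms[unfolded frechet_derivative_works]]]
  by (simp add: partial_deriv_def)

lemma product_sums_partial_deriv:
  assumes "f \<in> product_sums" "b \<in> Basis"
  shows "partial_deriv b f \<in> product_sums"
  using assms(1)
proof (induction rule: product_sums.induct)
  case (prod f g)
  have "partial_deriv b (\<lambda>x. f x * g x) = (\<lambda>x. f x * partial_deriv b g x + partial_deriv b f x * g x)"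
    using prod by (intro ext partial_deriv_mult smooth_differentiable)
  also have "\<dots> \<in> product_sums"
    using prod assms(2) by (intro product_sums.intros smooth_partial_deriv)
  finally show ?case .
next
  case (add f g)
  have "partial_deriv b (\<lambda>x. f x + g x) = (\<lambda>x. partial_deriv b f x + partial_deriv b g x)"
    using add by (intro ext partial_deriv_add product_sums_differentiable)
  then show ?case using add by (simp add: product_sums.intros)
qed

lemma smooth_mult: "smooth f \<Longrightarrow> smooth g \<Longrightarrow> smooth (\<lambda>x. f x * g x)"
  by (rule smooth_coinduct[of _ product_sums])
     (auto intro: product_sums.intros product_sums_partial_deriv
       differentiable_at_imp_differentiable_on product_sums_differentiable)

lemma smooth_const [simp]: "smooth (\<lambda>x. c)"
proof (rule smooth_coinduct[of _ "range (\<lambda>c x. c)"])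
  fix f :: "'a \<Rightarrow> real" and b :: 'a assume "f \<in> range (\<lambda>c x. c)"
  then obtain c where "f = (\<lambda>x. c)" by blast
  moreover have "partial_deriv b (\<lambda>x. c) = (\<lambda>x. 0)"
    by (rule ext, rule partial_deriv_eqI) simp
  ultimately show "partial_deriv b f \<in> range (\<lambda>c x. c)" by blast
qed auto

lemma smooth_prod: "finite I \<Longrightarrow> (\<And>i. i \<in> I \<Longrightarrow> smooth (f i)) \<Longrightarrow> smooth (\<lambda>x. \<Prod>i\<in>I. f i x)"
  by (induction I rule: finite_induct) (auto intro: smooth_mult)

lemma partial_deriv_affine:
  fixes f :: "'a::euclidean_space \<Rightarrow> real"
  assumes "smooth f"
  shows "partial_deriv b (\<lambda>y. c * f (s *\<^sub>R y + z)) y = c * s * partial_deriv b f (s *\<^sub>R y + z)"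
proof -
  define D where "D = frechet_derivative f (at (s *\<^sub>R y + z))"
  have D: "(f has_derivative D) (at (s *\<^sub>R y + z))"
    unfolding D_def using smooth_differentiable[OF assms] frechet_derivative_works by blast
  interpret D: linear D using D has_derivative_linear by blast
  have "((\<lambda>y. s *\<^sub>R y + z) has_derivative (\<lambda>h. s *\<^sub>R h)) (at y)"
    by (auto intro!: derivative_eq_intros)
  from has_derivative_compose[OF this D]
  have "((\<lambda>y. c * f (s *\<^sub>R y + z)) has_derivative (\<lambda>h. c * D (s *\<^sub>R h))) (at y)"
    by (rule has_derivative_mult_right)
  from partial_deriv_eqI[OF this] partial_deriv_eqI[OF D]
  show ?thesis by (simp add: D.scale)
qed

lemma smooth_affine:
  fixes f :: "'a::euclidean_space \<Rightarrow> real"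
  assumes "smooth f"
  shows "smooth (\<lambda>y. c * f (s *\<^sub>R y + z))"
proof (rule smooth_coinduct[of _ "{(\<lambda>y. c * g (s *\<^sub>R y + z)) | c g. smooth g}"], goal_cases)
  case (2 h)
  then obtain c g where h: "h = (\<lambda>y. c * g (s *\<^sub>R y + z))" "smooth g" by blast
  have "(\<lambda>y. c * g (s *\<^sub>R y + z)) differentiable (at y)" for y
  proof -
    have "((\<lambda>y. s *\<^sub>R y + z) has_derivative (\<lambda>h. s *\<^sub>R h)) (at y)"
      by (auto intro!: derivative_eq_intros)
    from has_derivative_mult_right[OF has_derivative_compose[OF this smooth_has_derivative[OF h(2)]]]
    show ?thesis by (rule differentiableI)
  qed
  then show ?case using h by (auto intro: differentiable_at_imp_differentiable_on)
next
  case (3 h b)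
  then obtain c g where h: "h = (\<lambda>y. c * g (s *\<^sub>R y + z))" "smooth g" by blast
  have "partial_deriv b h = (\<lambda>y. c * s * partial_deriv b g (s *\<^sub>R y + z))"
    using h by (auto simp: partial_deriv_affine)
  then show ?case using 3 h smooth_partial_deriv by blast
qed (use assms in blast)

text \<open>
  For \<open>P = 1\<close> this is the standard function \<open>exp (- 1 / t)\<close> that vanishes to infinite order at \<open>0\<close>. With
  the polynomial factors in \<open>1 / t\<close> the family is closed under differentiation.
\<close>

definition flat :: "real poly \<Rightarrow> real \<Rightarrow> real" where
  "flat P t = (if t > 0 then poly P (1 / t) * exp (- (1 / t)) else 0)"

lemma poly_times_exp_neg_tendsto_0: "((\<lambda>s. poly P s * exp (- s)) \<longlongrightarrow> 0) (at_top :: real filter)"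
proof -
  have "((\<lambda>s. \<Sum>i\<le>degree P. coeff P i * (s ^ i / exp s)) \<longlongrightarrow> (\<Sum>i\<le>degree P. coeff P i * 0)) at_top"
    by (intro tendsto_intros tendsto_power_div_exp_0)
  then show ?thesis
    by (simp add: poly_altdef sum_distrib_right exp_minus field_simps sum_divide_distrib)
qed

lemma flat_has_derivative:
  "(flat P has_real_derivative flat ((P - pderiv P) * [:0, 0, 1:]) t) (at t)"
proof (cases t "0::real" rule: linorder_cases)
  case less
  have ev: "\<forall>\<^sub>F s in nhds t. 0 = flat P s"
    using eventually_nhds_in_open[of "{..<0}" t] less
    by (auto simp: flat_def elim!: eventually_mono)
  have "((\<lambda>t. 0) has_real_derivative 0) (at t)" by simp
  then have "(flat P has_real_derivative 0) (at t)"
    using DERIV_cong_ev[OF refl ev refl] by blast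
  then show ?thesis using less by (simp add: flat_def)
next
  case greater
  have ev: "\<forall>\<^sub>F s in nhds t. poly P (1 / s) * exp (- (1 / s)) = flat P s"
    using eventually_nhds_in_open[of "{0<..}" t] greater
    by (auto simp: flat_def elim!: eventually_mono)
  have "((\<lambda>s. poly P (1 / s) * exp (- (1 / s))) has_real_derivative
      (poly (pderiv P) (1/t) * (- (1 / t^2)) * exp (- (1 / t)) + poly P (1/t) * (exp (- (1 / t)) * (1 / t^2)))) (at t)"
    using greater
    by (auto intro!: derivative_eq_intros DERIV_chain'[OF _ poly_DERIV] simp: power2_eq_square field_simps)
  then have "(flat P has_real_derivative (poly (pderiv P) (1/t) * (- (1 / t^2)) * exp (- (1 / t)) + poly P (1/t) * (exp (- (1 / t)) * (1 / t^2)))) (at t)"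
    using DERIV_cong_ev[OF refl ev refl] by blast
  moreover have "(poly (pderiv P) (1/t) * (- (1 / t^2)) * exp (- (1 / t)) + poly P (1/t) * (exp (- (1 / t)) * (1 / t^2)))
     = flat ((P - pderiv P) * [:0, 0, 1:]) t"
    using greater by (simp add: flat_def power2_eq_square algebra_simps)
  ultimately show ?thesis by simp
next
  case equal
  \<comment> \<open>With \<open>s = 1 / h\<close> the right difference quotient is \<open>s P(s) exp (- s)\<close>, which tends to \<open>0\<close>.\<close>
  have "((\<lambda>h. flat P h / h) \<longlongrightarrow> 0) (at 0)"
  proof (rule filterlim_split_at)
    show "((\<lambda>h. flat P h / h) \<longlongrightarrow> 0) (at_left 0)"
      by (rule tendsto_eventually) (auto simp: flat_def eventually_at_filter)
    have "((\<lambda>h. poly (pCons 0 P) (inverse h) * exp (- inverse h)) \<longlongrightarrow> 0) (at_right 0)"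
      by (rule filterlim_compose[OF poly_times_exp_neg_tendsto_0 filterlim_inverse_at_top_right])
    then show "((\<lambda>h. flat P h / h) \<longlongrightarrow> 0) (at_right 0)"
      by (rule Lim_transform_eventually) (auto simp: flat_def eventually_at_filter field_simps)
  qed
  then show ?thesis using equal by (simp add: DERIV_def flat_def)
qed

lemma smooth_flat_coordinate:
  fixes v :: "'a::euclidean_space"
  shows "smooth (\<lambda>x. flat P (a + x \<bullet> v))"
proof -
  have *: "((\<lambda>x. c * flat P (a + x \<bullet> v)) has_derivative
     (\<lambda>h. c * (h \<bullet> v) * flat ((P - pderiv P) * [:0, 0, 1:]) (a + x \<bullet> v))) (at x)" for c P x
  proof -
    have "((\<lambda>x. a + x \<bullet> v) has_derivative (\<lambda>h. h \<bullet> v)) (at x)"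
      by (auto intro!: derivative_eq_intros)
    from has_derivative_compose[OF this flat_has_derivative[THEN has_field_derivative_imp_has_derivative]]
    have "((\<lambda>x. c * flat P (a + x \<bullet> v)) has_derivative
     (\<lambda>h. c * (flat ((P - pderiv P) * [:0, 0, 1:]) (a + x \<bullet> v) * (h \<bullet> v)))) (at x)"
      by (rule has_derivative_mult_right)
    then show ?thesis by (simp add: mult_ac)
  qed
  have "smooth (\<lambda>x. 1 * flat P (a + x \<bullet> v))"
  proof (rule smooth_coinduct[of _ "{(\<lambda>x. c * flat P (a + x \<bullet> v)) | c P. True}"], goal_cases)
    case (2 f)
    then show ?case using differentiableI[OF *]
      by (auto intro!: differentiable_at_imp_differentiable_on)
  next
    case (3 f b)
    then obtain c P where f: "f = (\<lambda>x. c * flat P (a + x \<bullet> v))" by blast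
    have "partial_deriv b f = (\<lambda>x. c * (b \<bullet> v) * flat ((P - pderiv P) * [:0, 0, 1:]) (a + x \<bullet> v))"
      unfolding f by (rule ext, rule partial_deriv_eqI[OF *])
    then show ?case by blast
  qed blast
  then show ?thesis by simp
qed

subsection \<open>Test functions\<close>

lemma test_funI:
  assumes "smooth \<psi>" "compact K" "K \<subseteq> \<Omega>" "\<And>x. x \<notin> K \<Longrightarrow> \<psi> x = 0"
  shows "\<psi> \<in> test_fun \<Omega>"
proof -
  have "closure {x. \<psi> x \<noteq> 0} \<subseteq> K"
    using assms by (intro closure_minimal compact_imp_closed) auto
  moreover from this have "compact (closure {x. \<psi> x \<noteq> 0})"
    by (metis assms(2) closed_closure closed_Int_compact inf.absorb1)
  ultimately show ?thesis using assms by (auto simp: test_fun_def)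
qed

lemma test_funE:
  assumes "\<psi> \<in> test_fun \<Omega>"
  obtains K where "smooth \<psi>" "compact K" "K \<subseteq> \<Omega>" "\<And>x. x \<notin> K \<Longrightarrow> \<psi> x = 0"
    "\<And>b x. x \<notin> K \<Longrightarrow> partial_deriv b \<psi> x = 0"
proof -
  define K where "K = closure {x. \<psi> x \<noteq> 0}"
  have K: "compact K" "K \<subseteq> \<Omega>" "smooth \<psi>"
    using assms by (simp_all add: test_fun_def K_def)
  have "{x. \<psi> x \<noteq> 0} \<subseteq> K" unfolding K_def by (rule closure_subset)
  then have 0: "\<psi> x = 0" if "x \<notin> K" for x using that by blast
  have "open (- K)" using K(1) compact_imp_closed by blast
  have "partial_deriv b \<psi> x = 0" if x: "x \<notin> K" for b x
  proof -
    have "(\<psi> has_derivative (\<lambda>h. 0)) (at x)"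
      by (rule has_derivative_transform_within_open[OF has_derivative_const \<open>open (- K)\<close>])
         (use x 0 in simp_all)
    then show ?thesis by (rule partial_deriv_eqI)
  qed
  then show thesis by (intro that[of K] K 0)
qed

lemma test_fun_smooth: "\<psi> \<in> test_fun \<Omega> \<Longrightarrow> smooth \<psi>" by (simp add: test_fun_def)

lemma test_fun_partial_deriv:
  assumes "\<psi> \<in> test_fun \<Omega>" "b \<in> Basis"
  shows "partial_deriv b \<psi> \<in> test_fun \<Omega>"
proof -
  obtain K where "smooth \<psi>" "compact K" "K \<subseteq> \<Omega>" "\<And>b x. x \<notin> K \<Longrightarrow> partial_deriv b \<psi> x = 0"
    using test_funE[OF assms(1)] by metis
  then show ?thesis using assms(2) by (intro test_funI[of _ K] smooth_partial_deriv)
qed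

lemma test_fun_bounded:
  assumes "\<psi> \<in> test_fun \<Omega>"
  obtains B where "B > 0" "\<And>x. \<bar>\<psi> x\<bar> \<le> B"
proof -
  obtain K where K: "smooth \<psi>" "compact K" "\<And>x. x \<notin> K \<Longrightarrow> \<psi> x = 0"
    using test_funE[OF assms] by metis
  have "bounded (\<psi> ` K)"
    using K by (intro compact_imp_bounded compact_continuous_image smooth_continuous_on)
  then obtain B where "B > 0" "\<And>x. x \<in> K \<Longrightarrow> \<bar>\<psi> x\<bar> \<le> B"
    by (auto simp: bounded_pos)
  with K that[of B] show thesis by (metis abs_zero less_imp_le)
qed

lemma smooth_borel_measurable [measurable]:
  "smooth f \<Longrightarrow> f \<in> borel_measurable borel"
  by (intro borel_measurable_continuous_onI smooth_continuous_on)

lemma integrable_continuous_compact_support: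
  fixes f :: "'a::euclidean_space \<Rightarrow> real"
  assumes "continuous_on UNIV f" "compact K" "\<And>x. x \<notin> K \<Longrightarrow> f x = 0"
  shows "integrable lborel f"
proof -
  have "integrable lborel (\<lambda>x. indicator K x *\<^sub>R f x)"
    using assms by (intro borel_integrable_compact) (auto intro: continuous_on_subset)
  moreover have "(\<lambda>x. indicator K x *\<^sub>R f x) = f"
  proof
    show "indicator K x *\<^sub>R f x = f x" for x using assms(3)[of x] by (cases "x \<in> K") auto
  qed
  ultimately show ?thesis by simp
qed

lemma test_fun_integrable:
  assumes "\<psi> \<in> test_fun \<Omega>"
  shows "integrable lborel \<psi>"
proof -
  obtain K where K: "smooth \<psi>" "compact K" "\<And>x. x \<notin> K \<Longrightarrow> \<psi> x = 0"
    using test_funE[OF assms] by metis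
  show ?thesis
    by (rule integrable_continuous_compact_support[OF smooth_continuous_on[OF K(1)] K(2,3)])
qed

definition mollifier :: "real \<Rightarrow> ('a::euclidean_space \<Rightarrow> real) \<Rightarrow> bool" where
  "mollifier d \<eta> \<longleftrightarrow> \<eta> \<in> test_fun UNIV \<and> (\<forall>x. 0 \<le> \<eta> x) \<and> (\<forall>x. norm x \<ge> d \<longrightarrow> \<eta> x = 0)
     \<and> (LINT x|lborel. \<eta> x) = 1"

text \<open>
  In each coordinate, \<open>flat 1 (r + t) flat 1 (r - t)\<close> is positive exactly for \<open>\<bar>t\<bar> < r\<close>. The product over
  the coordinates is thus supported in a cube of half-width \<open>r\<close>, and \<open>r = d / (2 n)\<close> in dimension \<open>n\<close>
  puts this cube inside the ball of radius \<open>d\<close>, as the norm is at most the sum of the absolute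
  coordinates.
\<close>

lemma mollifier_exists:
  assumes "d > 0"
  shows "\<exists>\<eta> :: 'a::euclidean_space \<Rightarrow> real. mollifier d \<eta>"
proof -
  define r where "r = d / (2 * DIM('a))"
  have r: "r > 0" using assms by (simp add: r_def)
  define \<eta>0 :: "'a \<Rightarrow> real" where "\<eta>0 x = (\<Prod>b\<in>Basis. flat 1 (r + x \<bullet> b) * flat 1 (r + x \<bullet> (- b)))" for x
  have sm: "smooth \<eta>0" unfolding \<eta>0_def by (intro smooth_prod smooth_mult smooth_flat_coordinate) auto
  have nn: "\<eta>0 x \<ge> 0" for x unfolding \<eta>0_def by (intro prod_nonneg) (auto simp: flat_def)
  have zero: "\<eta>0 x = 0" if "norm x \<ge> d" for x
  proof -
    have "\<exists>b\<in>Basis. \<bar>x \<bullet> b\<bar> \<ge> r"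
    proof (rule ccontr)
      assume "\<not> ?thesis"
      then have "(\<Sum>b\<in>Basis. \<bar>x \<bullet> b\<bar>) \<le> DIM('a) * r" by (intro sum_bounded_above) auto
      also have "\<dots> = d / 2" by (simp add: r_def)
      finally show False using norm_le_l1[of x] that assms by linarith
    qed
    then obtain b where b: "b \<in> Basis" "\<bar>x \<bullet> b\<bar> \<ge> r" by blast
    then have "flat 1 (r + x \<bullet> b) * flat 1 (r + x \<bullet> (- b)) = 0" by (auto simp: flat_def)
    with b show ?thesis unfolding \<eta>0_def by (intro prod_zero) auto
  qed
  have test: "\<eta>0 \<in> test_fun UNIV"
    by (rule test_funI[OF sm compact_cball[of 0 d]]) (auto intro: zero)
  have int: "integrable lborel \<eta>0" by (rule test_fun_integrable[OF test])
  define m where "m = (LINT x|lborel. \<eta>0 x)"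
  have "m > 0"
  proof -
    have "m \<ge> 0" unfolding m_def using nn by simp
    moreover have "m \<noteq> 0"
    proof
      assume "m = 0"
      then have ae: "AE x in lborel. \<eta>0 x = 0"
        using integral_nonneg_eq_0_iff_AE[OF int] nn by (auto simp: m_def)
      have pos: "\<eta>0 x \<noteq> 0" if "x \<in> box (- r *\<^sub>R One) (r *\<^sub>R One)" for x
        using that unfolding \<eta>0_def
        by (auto simp: flat_def mem_box field_simps)
      have "AE x in lborel. x \<notin> box (- r *\<^sub>R One) (r *\<^sub>R (One::'a))"
        using ae by eventually_elim (use pos in blast)
      then have "emeasure lborel (box (- r *\<^sub>R One) (r *\<^sub>R (One::'a))) = 0"
        by (subst (asm) AE_iff_measurable[OF _ refl]) auto
      then show False using r by (subst (asm) emeasure_lborel_box) (auto simp: inner_simps prod_constant)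
    qed
    ultimately show ?thesis by linarith
  qed
  define \<eta> where "\<eta> x = (1 / m) * \<eta>0 (1 *\<^sub>R x + 0)" for x
  have "smooth \<eta>" unfolding \<eta>_def by (rule smooth_affine[OF sm])
  then have "\<eta> \<in> test_fun UNIV"
    by (rule test_funI[OF _ compact_cball[of 0 d]]) (auto simp: \<eta>_def intro: zero)
  moreover have "(LINT x|lborel. \<eta> x) = 1"
  proof -
    have "(LINT x|lborel. \<eta> x) = (LINT x|lborel. (1 / m) * \<eta>0 x)" by (simp add: \<eta>_def)
    also have "\<dots> = (1 / m) * m" unfolding m_def by (rule integral_mult_right_zero)
    finally show ?thesis using \<open>m > 0\<close> by simp
  qed
  moreover have "0 \<le> \<eta> x" for x using nn[of x] \<open>m > 0\<close> by (simp add: \<eta>_def)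
  moreover have "\<eta> x = 0" if "norm x \<ge> d" for x using zero[OF that] by (simp add: \<eta>_def)
  ultimately have "mollifier d \<eta>"
    unfolding mollifier_def by blast
  then show ?thesis by blast
qed

section \<open>Mollification\<close>

lemma borel_imp_lebesgue_measurable:
  "f \<in> borel_measurable borel \<Longrightarrow> f \<in> borel_measurable lebesgue"
  by (simp add: measurable_completion)

lemma integrable_mult_bounded:
  fixes f \<psi> :: "'a \<Rightarrow> real"
  assumes "integrable M f" "\<psi> \<in> borel_measurable M" "\<And>x. \<bar>\<psi> x\<bar> \<le> B"
  shows "integrable M (\<lambda>x. f x * \<psi> x)"
proof (rule Bochner_Integration.integrable_bound)
  show "integrable M (\<lambda>x. B * \<bar>f x\<bar>)" using assms by auto
  show "(\<lambda>x. f x * \<psi> x) \<in> borel_measurable M"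
    using assms by (intro borel_measurable_times) auto
  have "\<bar>f x * \<psi> x\<bar> \<le> \<bar>B * \<bar>f x\<bar>\<bar>" for x
  proof -
    have "\<bar>f x * \<psi> x\<bar> \<le> \<bar>f x\<bar> * B" by (simp add: abs_mult mult_left_mono assms)
    also have "\<dots> \<le> \<bar>B * \<bar>f x\<bar>\<bar>" by (simp add: abs_mult mult.commute mult_right_mono)
    finally show ?thesis .
  qed
  then show "AE x in M. norm (f x * \<psi> x) \<le> norm (B * \<bar>f x\<bar>)" by simp
qed

lemma smooth_mvt:
  assumes "smooth \<psi>"
  obtains t where "0 < t" "t < 1"
    "\<psi> (z + h) - \<psi> z = (\<Sum>b\<in>Basis. (h \<bullet> b) * partial_deriv b \<psi> (z + t *\<^sub>R h))"
proof -
  have "((\<lambda>t. \<psi> (z + t *\<^sub>R h)) has_derivative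
      (\<lambda>s. \<Sum>b\<in>Basis. ((s *\<^sub>R h) \<bullet> b) * partial_deriv b \<psi> (z + t *\<^sub>R h))) (at t within {0..1})" for t
  proof -
    have "((\<lambda>t. z + t *\<^sub>R h) has_derivative (\<lambda>s. s *\<^sub>R h)) (at t within {0..1})"
      by (auto intro!: derivative_eq_intros)
    from has_derivative_compose[OF this smooth_has_derivative[OF assms]] show ?thesis .
  qed
  from mvt_simple[OF zero_less_one this] that show thesis
    by auto
qed

lemma test_fun_lipschitz:
  assumes "\<psi> \<in> test_fun \<Omega>"
  obtains L where "L > 0" "\<And>z h. \<bar>\<psi> (z + h) - \<psi> z\<bar> \<le> L * norm h"
proof -
  have "\<forall>b\<in>Basis. \<exists>B>0. \<forall>x. \<bar>partial_deriv b \<psi> x\<bar> \<le> B"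
    using test_fun_bounded[OF test_fun_partial_deriv[OF assms]] by metis
  then obtain B where B: "\<And>b. b \<in> Basis \<Longrightarrow> B b > 0" "\<And>b x. b \<in> Basis \<Longrightarrow> \<bar>partial_deriv b \<psi> x\<bar> \<le> B b"
    by metis
  show thesis
  proof (rule that[of "\<Sum>b\<in>Basis. B b"])
    show "0 < sum B Basis" using B by (intro sum_pos) auto
    fix z h
    obtain t where "\<psi> (z + h) - \<psi> z = (\<Sum>b\<in>Basis. (h \<bullet> b) * partial_deriv b \<psi> (z + t *\<^sub>R h))"
      using smooth_mvt[OF test_fun_smooth[OF assms]] by metis
    then have "\<bar>\<psi> (z + h) - \<psi> z\<bar> \<le> (\<Sum>b\<in>Basis. \<bar>(h \<bullet> b) * partial_deriv b \<psi> (z + t *\<^sub>R h)\<bar>)"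
      by simp
    also have "\<dots> \<le> (\<Sum>b\<in>Basis. norm h * B b)"
      unfolding abs_mult using B by (intro sum_mono mult_mono Basis_le_norm) auto
    also have "\<dots> = sum B Basis * norm h" by (simp add: sum_distrib_left mult.commute)
    finally show "\<bar>\<psi> (z + h) - \<psi> z\<bar> \<le> sum B Basis * norm h" .
  qed
qed

text \<open>
  The second-order bound is uniform in the base point because test functions and all their derivatives
  are bounded. Multiplied with an integrable function, it can be integrated, which gives
  differentiation under the integral sign without dominated convergence.
\<close>

lemma test_fun_quadratic_remainder:
  assumes "\<psi> \<in> test_fun \<Omega>"
  obtains C where "C \<ge> 0"
    "\<And>z h. \<bar>\<psi> (z + h) - \<psi> z - (\<Sum>b\<in>Basis. (h \<bullet> b) * partial_deriv b \<psi> z)\<bar> \<le> C * (norm h)\<^sup>2"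
proof -
  have "\<forall>b\<in>Basis. \<exists>L>0. \<forall>z h. \<bar>partial_deriv b \<psi> (z + h) - partial_deriv b \<psi> z\<bar> \<le> L * norm h"
    using test_fun_lipschitz[OF test_fun_partial_deriv[OF assms]] by metis
  then obtain L where L: "\<And>b. b \<in> Basis \<Longrightarrow> L b > 0"
    "\<And>b z h. b \<in> Basis \<Longrightarrow> \<bar>partial_deriv b \<psi> (z + h) - partial_deriv b \<psi> z\<bar> \<le> L b * norm h"
    by metis
  show thesis
  proof (rule that[of "\<Sum>b\<in>Basis. L b"])
    show "0 \<le> sum L Basis" using L by (intro sum_nonneg) (auto intro: less_imp_le)
    fix z h
    obtain t where t: "0 < t" "t < 1"
      and eq: "\<psi> (z + h) - \<psi> z = (\<Sum>b\<in>Basis. (h \<bullet> b) * partial_deriv b \<psi> (z + t *\<^sub>R h))"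
      using smooth_mvt[OF test_fun_smooth[OF assms]] by metis
    have "\<bar>\<psi> (z + h) - \<psi> z - (\<Sum>b\<in>Basis. (h \<bullet> b) * partial_deriv b \<psi> z)\<bar>
      = \<bar>\<Sum>b\<in>Basis. (h \<bullet> b) * (partial_deriv b \<psi> (z + t *\<^sub>R h) - partial_deriv b \<psi> z)\<bar>"
      unfolding eq by (simp add: sum_subtractf algebra_simps)
    also have "\<dots> \<le> (\<Sum>b\<in>Basis. \<bar>(h \<bullet> b) * (partial_deriv b \<psi> (z + t *\<^sub>R h) - partial_deriv b \<psi> z)\<bar>)"
      by (rule sum_abs)
    also have "\<dots> \<le> (\<Sum>b\<in>Basis. norm h * (L b * norm h))"
      unfolding abs_mult
    proof (intro sum_mono mult_mono Basis_le_norm)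
      fix b :: 'a assume b: "b \<in> Basis"
      have "\<bar>partial_deriv b \<psi> (z + t *\<^sub>R h) - partial_deriv b \<psi> z\<bar> \<le> L b * norm (t *\<^sub>R h)"
        by (rule L(2)[OF b])
      also have "\<dots> \<le> L b * norm h" using t L(1)[OF b]
        by (intro mult_left_mono) (auto simp: mult_left_le_one_le)
      finally show "\<bar>partial_deriv b \<psi> (z + t *\<^sub>R h) - partial_deriv b \<psi> z\<bar> \<le> L b * norm h" .
    qed auto
    also have "\<dots> = sum L Basis * (norm h)\<^sup>2"
      by (simp add: sum_distrib_left mult_ac power2_eq_square)
    finally show "\<bar>\<psi> (z + h) - \<psi> z - (\<Sum>b\<in>Basis. (h \<bullet> b) * partial_deriv b \<psi> z)\<bar> \<le> sum L Basis * (norm h)\<^sup>2" .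
  qed
qed

definition convol :: "('a::euclidean_space \<Rightarrow> real) \<Rightarrow> ('a \<Rightarrow> real) \<Rightarrow> 'a \<Rightarrow> real" where
  "convol f \<eta> x = (LINT y|lebesgue. f y * \<eta> (x - y))"

lemma test_fun_reflect_measurable [measurable]:
  assumes "\<eta> \<in> test_fun \<Omega>"
  shows "(\<lambda>y. \<eta> (x - y)) \<in> borel_measurable borel"
proof -
  have [measurable]: "\<eta> \<in> borel_measurable borel"
    using assms by (intro smooth_borel_measurable test_fun_smooth)
  show ?thesis by measurable
qed

lemma convol_integrable:
  assumes "integrable lebesgue f" "\<eta> \<in> test_fun \<Omega>"
  shows "integrable lebesgue (\<lambda>y. f y * \<eta> (x - y))"
proof -
  obtain B where "\<And>x. \<bar>\<eta> x\<bar> \<le> B" using test_fun_bounded[OF assms(2)] by metis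
  then show ?thesis
    using test_fun_reflect_measurable[OF assms(2)]
    by (intro integrable_mult_bounded[OF assms(1)] borel_imp_lebesgue_measurable)
qed

lemma convol_has_derivative:
  assumes f: "integrable lebesgue f" and \<eta>: "\<eta> \<in> test_fun UNIV"
  shows "(convol f \<eta> has_derivative (\<lambda>h. \<Sum>b\<in>Basis. (h \<bullet> b) * convol f (partial_deriv b \<eta>) x)) (at x)"
proof -
  obtain C where C: "C \<ge> 0"
    "\<And>z h. \<bar>\<eta> (z + h) - \<eta> z - (\<Sum>b\<in>Basis. (h \<bullet> b) * partial_deriv b \<eta> z)\<bar> \<le> C * (norm h)\<^sup>2"
    using test_fun_quadratic_remainder[OF \<eta>] by metis
  define M where "M = (LINT y|lebesgue. \<bar>f y\<bar>)"
  have M: "M \<ge> 0" unfolding M_def by simp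
  have int: "integrable lebesgue (\<lambda>y. f y * \<eta> (x - y))" for x
    by (rule convol_integrable[OF f \<eta>])
  have intb: "integrable lebesgue (\<lambda>y. f y * partial_deriv b \<eta> (x - y))" if "b \<in> Basis" for x b
    by (rule convol_integrable[OF f test_fun_partial_deriv[OF \<eta> that]])
  have ints: "integrable lebesgue (\<lambda>y. \<Sum>b\<in>Basis. (h \<bullet> b) * (f y * partial_deriv b \<eta> (x - y)))" for h
    using intb by (intro Bochner_Integration.integrable_sum integrable_mult_right)
  have est: "\<bar>convol f \<eta> (x + h) - convol f \<eta> x - (\<Sum>b\<in>Basis. (h \<bullet> b) * convol f (partial_deriv b \<eta>) x)\<bar>
      \<le> C * M * (norm h)\<^sup>2" for h
  proof -
    have s: "(\<Sum>b\<in>Basis. (h \<bullet> b) * convol f (partial_deriv b \<eta>) x)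
       = (LINT y|lebesgue. (\<Sum>b\<in>Basis. (h \<bullet> b) * (f y * partial_deriv b \<eta> (x - y))))"
      unfolding convol_def
      by (subst Bochner_Integration.integral_sum) (use intb in auto)
    have eq: "convol f \<eta> (x + h) - convol f \<eta> x - (\<Sum>b\<in>Basis. (h \<bullet> b) * convol f (partial_deriv b \<eta>) x)
      = (LINT y|lebesgue. f y * \<eta> (x + h - y) - f y * \<eta> (x - y)
           - (\<Sum>b\<in>Basis. (h \<bullet> b) * (f y * partial_deriv b \<eta> (x - y))))"
      unfolding s unfolding convol_def using int ints
      by (subst Bochner_Integration.integral_diff[symmetric], simp, simp)+ simp
    have "\<bar>convol f \<eta> (x + h) - convol f \<eta> x - (\<Sum>b\<in>Basis. (h \<bullet> b) * convol f (partial_deriv b \<eta>) x)\<bar>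
      \<le> (LINT y|lebesgue. \<bar>f y * \<eta> (x + h - y) - f y * \<eta> (x - y)
           - (\<Sum>b\<in>Basis. (h \<bullet> b) * (f y * partial_deriv b \<eta> (x - y)))\<bar>)"
      unfolding eq by (rule integral_abs_bound)
    also have "\<dots> \<le> (LINT y|lebesgue. (C * (norm h)\<^sup>2) * \<bar>f y\<bar>)"
    proof (rule integral_mono)
      show "integrable lebesgue (\<lambda>y. \<bar>f y * \<eta> (x + h - y) - f y * \<eta> (x - y)
           - (\<Sum>b\<in>Basis. (h \<bullet> b) * (f y * partial_deriv b \<eta> (x - y)))\<bar>)"
        by (intro integrable_abs Bochner_Integration.integrable_diff int ints)
      show "integrable lebesgue (\<lambda>y. C * (norm h)\<^sup>2 * \<bar>f y\<bar>)"
        by (intro integrable_mult_right integrable_abs f)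
      fix y
      have "f y * \<eta> (x + h - y) - f y * \<eta> (x - y) - (\<Sum>b\<in>Basis. (h \<bullet> b) * (f y * partial_deriv b \<eta> (x - y)))
        = f y * (\<eta> ((x - y) + h) - \<eta> (x - y) - (\<Sum>b\<in>Basis. (h \<bullet> b) * partial_deriv b \<eta> (x - y)))"
        by (simp add: algebra_simps sum_distrib_left)
      then show "\<bar>f y * \<eta> (x + h - y) - f y * \<eta> (x - y) - (\<Sum>b\<in>Basis. (h \<bullet> b) * (f y * partial_deriv b \<eta> (x - y)))\<bar>
        \<le> C * (norm h)\<^sup>2 * \<bar>f y\<bar>"
        using mult_left_mono[OF C(2)[of "x - y" h], of "\<bar>f y\<bar>"] by (simp add: abs_mult mult.commute)
    qed
    also have "\<dots> = C * M * (norm h)\<^sup>2" unfolding M_def by simp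
    finally show ?thesis .
  qed
  show ?thesis
  proof (rule has_derivativeI_sandwich[of 1 _ _ _ _ "\<lambda>y. C * M * norm (y - x)"])
    show "bounded_linear (\<lambda>h. \<Sum>b\<in>Basis. h \<bullet> b * convol f (partial_deriv b \<eta>) x)"
      by (intro bounded_linear_sum bounded_linear_mult_const bounded_linear_inner_left)
    show "((\<lambda>y. C * M * norm (y - x)) \<longlongrightarrow> 0) (at x)"
      by (auto intro!: tendsto_eq_intros)
    fix y assume "y \<noteq> x"
    then show "norm (convol f \<eta> y - convol f \<eta> x - (\<Sum>b\<in>Basis. (y - x) \<bullet> b * convol f (partial_deriv b \<eta>) x)) / norm (y - x)
      \<le> C * M * norm (y - x)"
      using est[of "y - x"] by (simp add: divide_le_eq power2_eq_square mult.assoc)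
  qed simp
qed

lemma partial_deriv_convol:
  assumes "integrable lebesgue f" "\<eta> \<in> test_fun UNIV" "b \<in> Basis"
  shows "partial_deriv b (convol f \<eta>) = convol f (partial_deriv b \<eta>)"
proof
  fix x
  have "partial_deriv b (convol f \<eta>) x = (\<Sum>c\<in>Basis. (b \<bullet> c) * convol f (partial_deriv c \<eta>) x)"
    by (rule partial_deriv_eqI[OF convol_has_derivative[OF assms(1,2)]])
  also have "\<dots> = convol f (partial_deriv b \<eta>) x"
    using assms(3) by (subst sum.remove[of _ b]) (auto simp: inner_Basis intro!: sum.neutral split: if_splits)
  finally show "partial_deriv b (convol f \<eta>) x = convol f (partial_deriv b \<eta>) x" .
qed

lemma smooth_convol:
  assumes "integrable lebesgue f" "\<eta> \<in> test_fun UNIV"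
  shows "smooth (convol f \<eta>)"
proof (rule smooth_coinduct[of _ "convol f ` test_fun UNIV"])
  show "convol f \<eta> \<in> convol f ` test_fun UNIV" using assms by blast
  show "g differentiable_on UNIV" if g: "g \<in> convol f ` test_fun UNIV" for g
  proof -
    obtain \<theta> where \<theta>: "\<theta> \<in> test_fun UNIV" "g = convol f \<theta>" using g by (elim imageE)
    show ?thesis unfolding \<theta>(2)
      by (rule differentiable_at_imp_differentiable_on, rule differentiableI)
         (rule convol_has_derivative[OF assms(1) \<theta>(1)])
  qed
  show "partial_deriv b g \<in> convol f ` test_fun UNIV" if "g \<in> convol f ` test_fun UNIV" "b \<in> Basis" for g b
    using that by (auto simp: partial_deriv_convol[OF assms(1)] intro!: test_fun_partial_deriv)
qed

lemma convol_eq_0: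
  assumes "\<And>y. f y \<noteq> 0 \<Longrightarrow> \<eta> (x - y) = 0"
  shows "convol f \<eta> x = 0"
proof -
  have "(\<lambda>y. f y * \<eta> (x - y)) = (\<lambda>y. 0)"
  proof
    show "f y * \<eta> (x - y) = 0" for y using assms[of y] by (cases "f y = 0") simp_all
  qed
  then show ?thesis by (simp add: convol_def)
qed

subsection \<open>Convergence of mollifications in \<open>L\<^sup>p\<close>\<close>

lemma lborel_distr_reflect:
  fixes x :: "'a::euclidean_space"
  shows "distr lborel borel (\<lambda>y. x - y) = lborel"
proof -
  have "lborel = density (distr lborel borel (\<lambda>y. x + (-1) *\<^sub>R y)) (\<lambda>_. \<bar>- 1::real\<bar> ^ DIM('a))"
    by (rule lborel_affine) simp
  then show ?thesis by (simp add: density_1)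
qed

lemma nn_integral_lborel_reflect:
  fixes F :: "'a::euclidean_space \<Rightarrow> ennreal"
  assumes [measurable]: "F \<in> borel_measurable borel"
  shows "(\<integral>\<^sup>+y. F (x - y) \<partial>lborel) = (\<integral>\<^sup>+y. F y \<partial>lborel)"
proof -
  have "(\<integral>\<^sup>+y. F y \<partial>lborel) = (\<integral>\<^sup>+y. F y \<partial>distr lborel borel (\<lambda>y. x - y))"
    by (simp add: lborel_distr_reflect)
  also have "\<dots> = (\<integral>\<^sup>+y. F (x - y) \<partial>lborel)"
    by (rule nn_integral_distr) measurable
  finally show ?thesis ..
qed

lemma nn_integral_lborel_translate:
  fixes F :: "'a::euclidean_space \<Rightarrow> ennreal"
  assumes [measurable]: "F \<in> borel_measurable borel"
  shows "(\<integral>\<^sup>+x. F (x - y) \<partial>lborel) = (\<integral>\<^sup>+x. F x \<partial>lborel)"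
proof -
  have "(\<integral>\<^sup>+x. F x \<partial>lborel) = (\<integral>\<^sup>+x. F x \<partial>distr lborel borel ((+) (- y)))"
    by (simp add: lborel_distr_plus)
  also have "\<dots> = (\<integral>\<^sup>+x. F (- y + x) \<partial>lborel)"
    by (rule nn_integral_distr) measurable
  finally show ?thesis by simp
qed

lemma powr_above_tangent:
  fixes a m p :: real
  assumes "a \<ge> 0" "m \<ge> 0" "p \<ge> 1"
  shows "m powr p + p * m powr (p - 1) * (a - m) \<le> a powr p"
proof (cases "m = 0")
  case True
  then show ?thesis by simp
next
  case False
  with assms have m: "m > 0" by simp
  show ?thesis
  proof (cases "a = 0")
    case True
    have "m powr (p - 1) * m = m powr p" using m powr_mult_base[of m "p - 1"] by (simp add: mult.commute)
    then have "m powr p + p * m powr (p - 1) * (a - m) = m powr p - p * m powr p" using True by (simp add: algebra_simps)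
    also have "\<dots> \<le> 0" using assms(3) mult_right_mono[of 1 p "m powr p"] by simp
    finally show ?thesis using True by simp
  next
    case False
    with assms have a: "a > 0" by simp
    have "a powr p - m powr p \<ge> (p * m powr (p - 1)) * (a - m)"
    proof (rule convex_on_imp_above_tangent[OF powr_convex[OF assms(3)]])
      show "((\<lambda>x. x powr p) has_real_derivative p * m powr (p - 1)) (at m within {0<..})"
        using m by (auto intro!: derivative_eq_intros simp: powr_diff)
    qed (use a m in \<open>auto simp: interior_open\<close>)
    then show ?thesis by simp
  qed
qed

text \<open>
  A pointwise replacement for Minkowski's inequality: the term with \<open>a\<close> keeps a factor that tends to \<open>1\<close>
  as \<open>t\<close> tends to \<open>0\<close>, at the price of a large factor on a term that is going to vanish in the limit.
\<close>

lemma powr_abs_add_le: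
  fixes a b t p :: real
  assumes "t > 0" "p \<ge> 1" "norm c \<le> a + b" "a \<ge> 0" "b \<ge> 0"
  shows "norm c powr p \<le> (1 + t) powr p * a powr p + (1 + 1 / t) powr p * b powr p"
proof (cases "b \<le> t * a")
  case True
  then have "norm c \<le> (1 + t) * a" using assms by (simp add: algebra_simps)
  then have "norm c powr p \<le> ((1 + t) * a) powr p" using assms by (intro powr_mono2) auto
  also have "\<dots> = (1 + t) powr p * a powr p" using assms by (simp add: powr_mult)
  finally show ?thesis using assms by (simp add: add_increasing2)
next
  case False
  then have "a \<le> b / t" using assms by (simp add: field_simps)
  then have "norm c \<le> (1 + 1 / t) * b" using assms by (simp add: algebra_simps)
  then have "norm c powr p \<le> ((1 + 1 / t) * b) powr p" using assms by (intro powr_mono2) auto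
  also have "\<dots> = (1 + 1 / t) powr p * b powr p" using assms by (simp add: powr_mult)
  finally show ?thesis using assms by (simp add: add_increasing)
qed

lemma powr_abs_add2_le:
  fixes a b p :: real
  assumes "p \<ge> 1" "norm c \<le> a + b" "a \<ge> 0" "b \<ge> 0"
  shows "norm c powr p \<le> 2 powr p * (a powr p + b powr p)"
  using powr_abs_add_le[of 1 p c a b] assms by (simp add: algebra_simps)

text \<open>
  Jensen's inequality for \<open>t\<^sup>p\<close> and the probability density \<open>w\<close>: integrate the tangent inequality at
  the mean value. If the right-hand side is infinite there is nothing to show.
\<close>

lemma Jensen_powr:
  fixes h w :: "'a::euclidean_space \<Rightarrow> real"
  assumes p: "p \<ge> 1" and [measurable]: "h \<in> borel_measurable borel" "w \<in> borel_measurable borel"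
    and w: "\<And>y. 0 \<le> w y" "integrable lborel w" "(LINT y|lborel. w y) = 1"
    and hw: "integrable lborel (\<lambda>y. h y * w y)"
  shows "ennreal (\<bar>LINT y|lborel. h y * w y\<bar> powr p) \<le> (\<integral>\<^sup>+y. ennreal (\<bar>h y\<bar> powr p * w y) \<partial>lborel)"
proof (cases "(\<integral>\<^sup>+y. ennreal (\<bar>h y\<bar> powr p * w y) \<partial>lborel) = \<infinity>")
  case False
  have int: "integrable lborel (\<lambda>y. \<bar>h y\<bar> powr p * w y)"
    by (rule integrableI_nonneg) (use False w in \<open>auto simp: top.not_eq_extremum\<close>)
  define m where "m = \<bar>LINT y|lborel. h y * w y\<bar>"
  define A where "A = (LINT y|lborel. \<bar>h y\<bar> * w y)"
  have habs: "integrable lborel (\<lambda>y. \<bar>h y\<bar> * w y)"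
  proof -
    have "integrable lborel (\<lambda>y. \<bar>h y * w y\<bar>)" using hw by (rule integrable_abs)
    then show ?thesis using w by (simp add: abs_mult)
  qed
  have "m \<le> (LINT y|lborel. \<bar>h y * w y\<bar>)" unfolding m_def by (rule integral_abs_bound)
  also have "\<dots> = A" unfolding A_def using w by (simp add: abs_mult)
  finally have mA: "m \<le> A" .
  have m0: "m \<ge> 0" by (simp add: m_def)
  define k where "k = p * m powr (p - 1)"
  have k: "k \<ge> 0" using p by (simp add: k_def)
  have "m powr p \<le> m powr p + k * (A - m)" using mA k by simp
  also have "\<dots> = (LINT y|lborel. (m powr p - k * m) * w y + k * (\<bar>h y\<bar> * w y))"
    using w habs by (simp add: A_def algebra_simps)
  also have "\<dots> \<le> (LINT y|lborel. \<bar>h y\<bar> powr p * w y)"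
  proof (rule integral_mono)
    show "integrable lborel (\<lambda>y. (m powr p - k * m) * w y + k * (\<bar>h y\<bar> * w y))"
      by (intro Bochner_Integration.integrable_add integrable_mult_right w habs)
    fix y
    have "(m powr p + k * (\<bar>h y\<bar> - m)) * w y \<le> \<bar>h y\<bar> powr p * w y"
      unfolding k_def by (intro mult_right_mono powr_above_tangent p m0 w) simp
    then show "(m powr p - k * m) * w y + k * (\<bar>h y\<bar> * w y) \<le> \<bar>h y\<bar> powr p * w y"
      by (simp add: algebra_simps)
  qed (rule int)
  finally have "ennreal (m powr p) \<le> ennreal (LINT y|lborel. \<bar>h y\<bar> powr p * w y)"
    by (rule ennreal_leI)
  also have "\<dots> = (\<integral>\<^sup>+y. ennreal (\<bar>h y\<bar> powr p * w y) \<partial>lborel)"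
    by (rule nn_integral_eq_integral[symmetric, OF int]) (use w in auto)
  finally show ?thesis by (simp add: m_def)
qed simp

lemma tendsto_abs_powr_0:
  fixes f :: "nat \<Rightarrow> real"
  assumes "f \<longlonglongrightarrow> 0" "p > 0"
  shows "(\<lambda>n. ennreal (\<bar>f n\<bar> powr p)) \<longlonglongrightarrow> 0"
proof -
  have "(\<lambda>n. \<bar>f n\<bar> powr p) \<longlonglongrightarrow> 0 powr p"
    using assms by (intro tendsto_powr' tendsto_const) (auto intro: tendsto_rabs_zero)
  then show ?thesis using tendsto_ennrealI assms by fastforce
qed

text \<open>
  Dominated convergence is used twice. First \<open>f\<close> is clipped at a large height \<open>M\<close>. The clipped function
  is an almost everywhere limit of continuous functions; when these are clipped at the same height
  and cut off near the ball of radius \<open>R\<close>, they are dominated by a constant on a bounded set.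
\<close>

lemma Lp_approx_continuous:
  fixes f :: "'a::euclidean_space \<Rightarrow> real"
  assumes p: "p \<ge> 1" and f [measurable]: "f \<in> borel_measurable borel"
    and supp: "\<And>x. norm x > R \<Longrightarrow> f x = 0"
    and fin: "(\<integral>\<^sup>+x. ennreal (\<bar>f x\<bar> powr p) \<partial>lborel) < \<infinity>"
    and e: "e > 0"
  obtains g where "continuous_on UNIV g" "\<And>x. norm x > R + 1 \<Longrightarrow> g x = 0"
    "(\<integral>\<^sup>+x. ennreal (\<bar>f x - g x\<bar> powr p) \<partial>lborel) \<le> ennreal e"
proof -
  define cl :: "real \<Rightarrow> real \<Rightarrow> real" where "cl M t = max (- M) (min M t)" for M t
  have cl_le: "\<bar>t - cl M t\<bar> \<le> \<bar>t\<bar>" if "M \<ge> 0" for M t using that by (auto simp: cl_def)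
  have cl_bd: "\<bar>cl M t\<bar> \<le> M" if "M \<ge> 0" for M t using that by (auto simp: cl_def)
  have cl_cont: "continuous_on UNIV (cl M)" for M unfolding cl_def by (intro continuous_intros)
  have [measurable]: "cl M \<in> borel_measurable borel" for M
    by (rule borel_measurable_continuous_onI[OF cl_cont])
  define c where "c = e / (2 * 2 powr p)"
  have c: "c > 0" using e by (simp add: c_def)
  have "(\<lambda>n. \<integral>\<^sup>+x. ennreal (\<bar>f x - cl (real n) (f x)\<bar> powr p) \<partial>lborel) \<longlonglongrightarrow> (\<integral>\<^sup>+x. 0 \<partial>(lborel::'a measure))"
  proof (rule nn_integral_dominated_convergence[where w = "\<lambda>x. ennreal (\<bar>f x\<bar> powr p)"])
    show "AE x in lborel. ennreal (\<bar>f x - cl (real n) (f x)\<bar> powr p) \<le> ennreal (\<bar>f x\<bar> powr p)" for n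
      using p by (intro AE_I2 ennreal_leI powr_mono2 cl_le) auto
    show "AE x in lborel. (\<lambda>n. ennreal (\<bar>f x - cl (real n) (f x)\<bar> powr p)) \<longlonglongrightarrow> 0"
    proof (rule AE_I2, rule tendsto_abs_powr_0)
      fix x
      have "\<forall>\<^sub>F n in sequentially. f x - cl (real n) (f x) = 0"
        using eventually_ge_at_top[of "nat \<lceil>\<bar>f x\<bar>\<rceil>"]
        by eventually_elim (simp add: cl_def max_def min_def nat_le_iff ceiling_le_iff abs_le_iff)
      then show "(\<lambda>n. f x - cl (real n) (f x)) \<longlonglongrightarrow> 0" by (rule tendsto_eventually)
    qed (use p in simp)
  qed (use fin in \<open>simp_all\<close>)
  from order_tendstoD(2)[OF this, of "ennreal c"] have "\<forall>\<^sub>F n in sequentially. (\<integral>\<^sup>+x. ennreal (\<bar>f x - cl (real n) (f x)\<bar> powr p) \<partial>lborel) < ennreal c"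
    using c by simp
  then obtain n where n: "(\<integral>\<^sup>+x. ennreal (\<bar>f x - cl (real n) (f x)\<bar> powr p) \<partial>lborel) < ennreal c"
    by (meson eventually_sequentially order_refl)
  define M where "M = real n"
  have M: "M \<ge> 0" by (simp add: M_def)
  have "f measurable_on UNIV"
    by (subst measurable_on_iff_borel_measurable) (simp_all add: lebesgue_on_UNIV_eq borel_imp_lebesgue_measurable)
  then obtain N g where N: "negligible N" and g: "\<And>n. continuous_on UNIV (g n)"
    and lim: "\<And>x. x \<notin> N \<Longrightarrow> (\<lambda>n. g n x) \<longlonglongrightarrow> f x"
    unfolding measurable_on_def by auto
  define cut :: "'a \<Rightarrow> real" where "cut x = max 0 (min 1 (R + 1 - norm x))" for x
  have cut_cont: "continuous_on UNIV cut" unfolding cut_def by (intro continuous_intros)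
  have [measurable]: "cball (0::'a) (R + 1) \<in> sets borel" by (rule borel_closed[OF closed_cball])
  define h where "h k x = cut x * cl M (g k x)" for k x
  have h_cont: "continuous_on UNIV (h k)" for k
    unfolding h_def using continuous_on_compose2[OF cl_cont g] by (intro continuous_on_mult cut_cont) auto
  have [measurable]: "h k \<in> borel_measurable borel" for k
    by (rule borel_measurable_continuous_onI[OF h_cont])
  have h0: "h k x = 0" if "norm x > R + 1" for k x using that by (simp add: h_def cut_def)
  have h_bd: "\<bar>h k x\<bar> \<le> M" for k x
  proof -
    have "\<bar>cut x\<bar> \<le> 1" by (simp add: cut_def)
    then show ?thesis unfolding h_def abs_mult using cl_bd[OF M, of "g k x"]
      using mult_mono[of "\<bar>cut x\<bar>" 1 "\<bar>cl M (g k x)\<bar>" M] by simp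
  qed
  have f_bd: "cut x * cl M (f x) = cl M (f x)" for x
  proof (cases "norm x > R")
    case True then show ?thesis using supp M by (simp add: cl_def)
  next
    case False then show ?thesis by (simp add: cut_def)
  qed
  have "(\<lambda>k. \<integral>\<^sup>+x. ennreal (\<bar>cl M (f x) - h k x\<bar> powr p) \<partial>lborel) \<longlonglongrightarrow> (\<integral>\<^sup>+x. 0 \<partial>(lborel::'a measure))"
  proof (rule nn_integral_dominated_convergence[where w = "\<lambda>x. ennreal ((2 * M) powr p) * indicator (cball 0 (R + 1)) x"])
    show "AE x in lborel. ennreal (\<bar>cl M (f x) - h k x\<bar> powr p) \<le> ennreal ((2 * M) powr p) * indicator (cball 0 (R + 1)) x" for k
    proof (rule AE_I2)
      fix x
      show "ennreal (\<bar>cl M (f x) - h k x\<bar> powr p) \<le> ennreal ((2 * M) powr p) * indicator (cball 0 (R + 1)) x"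
      proof (cases "norm x > R + 1")
        case True
        then have "cl M (f x) - h k x = 0" using supp[of x] h0[of x k] M by (simp add: cl_def)
        then show ?thesis using p by simp
      next
        case False
        have "\<bar>cl M (f x) - h k x\<bar> \<le> 2 * M" using cl_bd[OF M, of "f x"] h_bd[of k x] by linarith
        then have "\<bar>cl M (f x) - h k x\<bar> powr p \<le> (2 * M) powr p" using p by (intro powr_mono2) auto
        then show ?thesis using False by (simp add: ennreal_leI)
      qed
    qed
    have "AE x in lborel. x \<notin> N"
      using N by (metis AE_completion_iff AE_not_in negligible_iff_null_sets)
    then show "AE x in lborel. (\<lambda>k. ennreal (\<bar>cl M (f x) - h k x\<bar> powr p)) \<longlonglongrightarrow> 0"
    proof eventually_elim
      case (elim x)
      have "isCont (cl M) (f x)" using cl_cont by (simp add: continuous_on_eq_continuous_at)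
      then have "(\<lambda>k. cl M (g k x)) \<longlonglongrightarrow> cl M (f x)" using lim[OF elim] by (rule isCont_tendsto_compose)
      then have "(\<lambda>k. cut x * cl M (g k x)) \<longlonglongrightarrow> cut x * cl M (f x)" by (intro tendsto_mult tendsto_const)
      then have "(\<lambda>k. h k x) \<longlonglongrightarrow> cl M (f x)" unfolding f_bd h_def .
      then have "(\<lambda>k. cl M (f x) - h k x) \<longlonglongrightarrow> cl M (f x) - cl M (f x)" by (intro tendsto_diff tendsto_const)
      then show ?case using p by (intro tendsto_abs_powr_0) simp_all
    qed
    have "emeasure lborel (cball (0::'a) (R + 1)) < \<infinity>"
      by (rule emeasure_bounded_finite) simp
    then show "(\<integral>\<^sup>+x. ennreal ((2 * M) powr p) * indicator (cball (0::'a) (R + 1)) x \<partial>lborel) < \<infinity>"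
      by (subst nn_integral_cmult_indicator) (auto simp: ennreal_mult_less_top)
  qed measurable
  from order_tendstoD(2)[OF this, of "ennreal c"] have "\<forall>\<^sub>F k in sequentially. (\<integral>\<^sup>+x. ennreal (\<bar>cl M (f x) - h k x\<bar> powr p) \<partial>lborel) < ennreal c"
    using c by simp
  then obtain k where k: "(\<integral>\<^sup>+x. ennreal (\<bar>cl M (f x) - h k x\<bar> powr p) \<partial>lborel) < ennreal c"
    by (meson eventually_sequentially order_refl)
  have "(\<integral>\<^sup>+x. ennreal (\<bar>f x - h k x\<bar> powr p) \<partial>lborel)
    \<le> (\<integral>\<^sup>+x. ennreal (2 powr p) * (ennreal (\<bar>f x - cl M (f x)\<bar> powr p) + ennreal (\<bar>cl M (f x) - h k x\<bar> powr p)) \<partial>lborel)"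
  proof (rule nn_integral_mono)
    fix x
    have "norm (f x - h k x) powr p \<le> 2 powr p * (\<bar>f x - cl M (f x)\<bar> powr p + \<bar>cl M (f x) - h k x\<bar> powr p)"
      by (rule powr_abs_add2_le[OF p]) auto
    then show "ennreal (\<bar>f x - h k x\<bar> powr p) \<le>
       ennreal (2 powr p) * (ennreal (\<bar>f x - cl M (f x)\<bar> powr p) + ennreal (\<bar>cl M (f x) - h k x\<bar> powr p))"
      by (simp add: ennreal_leI flip: ennreal_plus ennreal_mult)
  qed
  also have "\<dots> = ennreal (2 powr p) * ((\<integral>\<^sup>+x. ennreal (\<bar>f x - cl M (f x)\<bar> powr p) \<partial>lborel)
       + (\<integral>\<^sup>+x. ennreal (\<bar>cl M (f x) - h k x\<bar> powr p) \<partial>lborel))"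
    by (subst nn_integral_cmult, measurable, subst nn_integral_add, measurable)
  also have "\<dots> \<le> ennreal (2 powr p) * (ennreal c + ennreal c)"
    using n k by (intro mult_left_mono add_mono) (auto simp: M_def less_imp_le)
  also have "\<dots> = ennreal e"
  proof -
    have "2 powr p * (c + c) = e" by (simp add: c_def)
    then show ?thesis using c by (metis ennreal_mult ennreal_plus add_nonneg_nonneg less_imp_le powr_ge_zero)
  qed
  finally show thesis by (intro that[of "h k"] h_cont h0)
qed

text \<open>
  For a continuous function with bounded support this is uniform continuity. An approximation of \<open>f\<close> by
  such a function has the same error before and after translation.
\<close>

lemma Lp_translation_continuous:
  fixes f :: "'a::euclidean_space \<Rightarrow> real"
  assumes p: "p \<ge> 1" and f [measurable]: "f \<in> borel_measurable borel"
    and supp: "\<And>x. norm x > R \<Longrightarrow> f x = 0"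
    and fin: "(\<integral>\<^sup>+x. ennreal (\<bar>f x\<bar> powr p) \<partial>lborel) < \<infinity>"
    and e: "e > 0"
  obtains d where "d > 0"
    "\<And>y. norm y < d \<Longrightarrow> (\<integral>\<^sup>+x. ennreal (\<bar>f (x - y) - f x\<bar> powr p) \<partial>lborel) \<le> ennreal e"
proof -
  define c where "c = e / (4 * 4 powr p)"
  have c: "c > 0" using e by (simp add: c_def)
  obtain g where g: "continuous_on UNIV g" "\<And>x. norm x > R + 1 \<Longrightarrow> g x = 0"
    and fg: "(\<integral>\<^sup>+x. ennreal (\<bar>f x - g x\<bar> powr p) \<partial>lborel) \<le> ennreal c"
    using Lp_approx_continuous[OF p f supp fin c] by metis
  have [measurable]: "g \<in> borel_measurable borel"
    by (rule borel_measurable_continuous_onI[OF g(1)])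
  define V where "V = measure lborel (cball (0::'a) (R + 2))"
  \<comment> \<open>Two functions that differ by at most \<open>r\<close>, on a set of measure at most \<open>V\<close>, differ by at most \<open>c\<close> in the
      \<open>p\<close>-th power of the norm; the summand \<open>1\<close> avoids dividing by \<open>V = 0\<close>.\<close>
  define r where "r = (c / (V + 1)) powr (1 / p)"
  have V: "V \<ge> 0" by (simp add: V_def)
  have r: "r > 0" unfolding r_def using c V by simp
  have rp: "r powr p * V \<le> c"
  proof -
    have "r powr p = c / (V + 1)" unfolding r_def using c V p by (simp add: powr_powr)
    moreover have "V \<le> V + 1" "0 < V + 1" using V by simp_all
    ultimately show ?thesis using c by (simp add: divide_le_eq mult_left_mono)
  qed
  have "uniformly_continuous_on (cball 0 (R + 3)) g"
    by (rule compact_uniformly_continuous) (auto intro: continuous_on_subset[OF g(1)])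
  then obtain d0 where d0: "d0 > 0" "\<And>x x'. x \<in> cball 0 (R + 3) \<Longrightarrow> x' \<in> cball 0 (R + 3) \<Longrightarrow>
      dist x' x < d0 \<Longrightarrow> dist (g x') (g x) < r"
    unfolding uniformly_continuous_on_def using r by metis
  show thesis
  proof (rule that[of "min 1 d0"])
    show "min 1 d0 > 0" using d0 by simp
    fix y :: 'a assume y: "norm y < min 1 d0"
    have gd: "ennreal (\<bar>g (x - y) - g x\<bar> powr p) \<le> ennreal (r powr p) * indicator (cball 0 (R + 2)) x" for x
    proof (cases "norm x > R + 2")
      case True
      have "norm x \<le> norm (x - y) + norm y" using norm_triangle_ineq[of "x - y" y] by simp
      then have "g (x - y) = 0" "g x = 0" using True y by (intro g(2); simp)+
      then show ?thesis using p by simp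
    next
      case False
      have "norm (x - y) \<le> norm x + norm y" by (rule norm_triangle_ineq4)
      then have "dist (g (x - y)) (g x) < r"
        using False y by (intro d0(2)) (auto simp: dist_norm norm_minus_commute)
      then have "\<bar>g (x - y) - g x\<bar> powr p \<le> r powr p" using p by (intro powr_mono2) (auto simp: dist_real_def)
      then show ?thesis using False by (simp add: ennreal_leI)
    qed
    have "(\<integral>\<^sup>+x. ennreal (\<bar>g (x - y) - g x\<bar> powr p) \<partial>lborel)
       \<le> (\<integral>\<^sup>+x. ennreal (r powr p) * indicator (cball (0::'a) (R + 2)) x \<partial>lborel)"
      by (rule nn_integral_mono) (rule gd)
    also have "\<dots> = ennreal (r powr p) * emeasure lborel (cball (0::'a) (R + 2))"
      by (rule nn_integral_cmult_indicator) simp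
    also have "\<dots> = ennreal (r powr p * V)"
      unfolding V_def by (subst emeasure_eq_ennreal_measure)
        (use emeasure_bounded_finite[OF bounded_cball] in \<open>auto simp: ennreal_mult less_top\<close>)
    also have "\<dots> \<le> ennreal c" using rp by (rule ennreal_leI)
    finally have gg: "(\<integral>\<^sup>+x. ennreal (\<bar>g (x - y) - g x\<bar> powr p) \<partial>lborel) \<le> ennreal c" .
    have fgy: "(\<integral>\<^sup>+x. ennreal (\<bar>f (x - y) - g (x - y)\<bar> powr p) \<partial>lborel) \<le> ennreal c"
      using fg by (subst nn_integral_lborel_translate[of "\<lambda>x. ennreal (\<bar>f x - g x\<bar> powr p)"]) simp_all
    have "(\<integral>\<^sup>+x. ennreal (\<bar>f (x - y) - f x\<bar> powr p) \<partial>lborel) \<le>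
      (\<integral>\<^sup>+x. ennreal (4 powr p) * (ennreal (\<bar>f (x - y) - g (x - y)\<bar> powr p)
          + ennreal (\<bar>g (x - y) - g x\<bar> powr p) + ennreal (\<bar>f x - g x\<bar> powr p)) \<partial>lborel)"
    proof (rule nn_integral_mono)
      fix x
      have "norm (f (x - y) - f x) powr p
         \<le> 2 powr p * (\<bar>f (x - y) - g (x - y)\<bar> powr p + norm (g (x - y) - f x) powr p)"
        by (rule powr_abs_add2_le[OF p]) auto
      also have "\<dots> \<le> 2 powr p * (\<bar>f (x - y) - g (x - y)\<bar> powr p +
          2 powr p * (\<bar>g (x - y) - g x\<bar> powr p + \<bar>f x - g x\<bar> powr p))"
        by (intro mult_left_mono add_left_mono powr_abs_add2_le[OF p]) auto
      also have "\<dots> \<le> 2 powr p * (2 powr p * \<bar>f (x - y) - g (x - y)\<bar> powr p +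
          2 powr p * (\<bar>g (x - y) - g x\<bar> powr p + \<bar>f x - g x\<bar> powr p))"
        using p ge_one_powr_ge_zero[of 2 p]
        by (intro mult_left_mono add_right_mono) (auto simp: mult_le_cancel_right1)
      also have "\<dots> = (2 * 2) powr p * (\<bar>f (x - y) - g (x - y)\<bar> powr p
          + \<bar>g (x - y) - g x\<bar> powr p + \<bar>f x - g x\<bar> powr p)"
        unfolding powr_mult by (simp add: algebra_simps)
      finally have "ennreal (norm (f (x - y) - f x) powr p) \<le> ennreal ((2 * 2) powr p * (\<bar>f (x - y) - g (x - y)\<bar> powr p
          + \<bar>g (x - y) - g x\<bar> powr p + \<bar>f x - g x\<bar> powr p))" by (rule ennreal_leI)
      then show "ennreal (\<bar>f (x - y) - f x\<bar> powr p) \<le> ennreal (4 powr p) * (ennreal (\<bar>f (x - y) - g (x - y)\<bar> powr p)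
          + ennreal (\<bar>g (x - y) - g x\<bar> powr p) + ennreal (\<bar>f x - g x\<bar> powr p))"
        by (simp add: ennreal_mult)
    qed
    also have "\<dots> = ennreal (4 powr p) * ((\<integral>\<^sup>+x. ennreal (\<bar>f (x - y) - g (x - y)\<bar> powr p) \<partial>lborel)
          + (\<integral>\<^sup>+x. ennreal (\<bar>g (x - y) - g x\<bar> powr p) \<partial>lborel) + (\<integral>\<^sup>+x. ennreal (\<bar>f x - g x\<bar> powr p) \<partial>lborel))"
      by (subst nn_integral_cmult, measurable, subst nn_integral_add, measurable, subst nn_integral_add, measurable)
    also have "\<dots> \<le> ennreal (4 powr p) * (ennreal c + ennreal c + ennreal c)"
      using gg fgy fg by (intro mult_left_mono add_mono) auto
    also have "\<dots> = ennreal (4 powr p * (c + c + c))"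
      using c by (metis ennreal_mult ennreal_plus add_nonneg_nonneg less_imp_le powr_ge_zero)
    also have "\<dots> \<le> ennreal e" using e by (intro ennreal_leI) (simp add: c_def field_simps)
    finally show "(\<integral>\<^sup>+x. ennreal (\<bar>f (x - y) - f x\<bar> powr p) \<partial>lborel) \<le> ennreal e" .
  qed
qed

lemma integrable_Lp_compact_support:
  fixes f :: "'a::euclidean_space \<Rightarrow> 'b::euclidean_space"
  assumes p: "p \<ge> 1" and [measurable]: "f \<in> borel_measurable lebesgue"
    and K: "bounded K" "\<And>x. x \<notin> K \<Longrightarrow> f x = 0"
    and int: "integrable lebesgue (\<lambda>x. norm (f x) powr p)"
  shows "integrable lebesgue f"
proof -
  obtain R where R: "\<And>x. x \<in> K \<Longrightarrow> norm x \<le> R" using K(1) by (meson bounded_iff)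
  show ?thesis
  proof (rule Bochner_Integration.integrable_bound)
    have "emeasure lebesgue (cball (0::'a) R) < \<infinity>"
      using emeasure_bounded_finite[OF bounded_cball, of "0::'a" R] by simp
    then show "integrable lebesgue (\<lambda>x. indicator (cball 0 R) x + norm (f x) powr p)"
      by (intro Bochner_Integration.integrable_add int integrable_real_indicator) auto
    have "norm (f x) \<le> indicator (cball 0 R) x + norm (f x) powr p" for x
    proof (cases "x \<in> K")
      case True
      then have "x \<in> cball 0 R" using R by simp
      moreover have "norm (f x) \<le> 1 + norm (f x) powr p"
      proof (cases "norm (f x) \<le> 1")
        case False
        then have "norm (f x) powr 1 \<le> norm (f x) powr p" using p by (intro powr_mono) auto
        then show ?thesis by simp
      qed (simp add: add_increasing2)
      ultimately show ?thesis by simp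
    qed (use K in simp)
    then show "AE x in lebesgue. norm (f x) \<le> norm (indicator (cball 0 R) x + norm (f x) powr p)"
      by (intro AE_I2) (simp add: abs_of_nonneg)
  qed fact
qed

text \<open>
  By Jensen's inequality, \<open>\<bar>convol f \<eta> x - f x\<bar>\<^sup>p\<close> is at most the average of \<open>\<bar>f (x - z) - f x\<bar>\<^sup>p\<close> with
  respect to \<open>\<eta> z dz\<close>. Integrating over \<open>x\<close> and exchanging the integrals leaves an average of translation
  errors with \<open>z\<close> in the support of \<open>\<eta>\<close>, and these are small. Since Tonelli's theorem needs joint
  measurability, \<open>f\<close> is first replaced by a Borel function that agrees with it almost everywhere.
\<close>

theorem convol_tendsto_Lp:
  fixes f :: "'a::euclidean_space \<Rightarrow> real"
  assumes p: "p \<ge> 1" and f [measurable]: "f \<in> borel_measurable lebesgue"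
    and K: "bounded K" "\<And>x. x \<notin> K \<Longrightarrow> f x = 0"
    and int: "integrable lebesgue (\<lambda>x. \<bar>f x\<bar> powr p)"
    and e: "e > 0"
  obtains d where "d > 0"
    "\<And>\<eta>. mollifier d \<eta> \<Longrightarrow> (\<integral>\<^sup>+x. ennreal (\<bar>convol f \<eta> x - f x\<bar> powr p) \<partial>lebesgue) \<le> ennreal e"
proof -
  obtain R where R: "\<And>x. x \<in> K \<Longrightarrow> norm x \<le> R" using K(1) by (meson bounded_iff)
  obtain f0 where f0 [measurable]: "f0 \<in> borel_measurable borel" and ae0: "AE x in lborel. f x = f0 x"
    using completion_ex_borel_measurable_real[OF f] by auto
  define F where "F x = indicator (cball 0 R) x * f0 x" for x
  have F [measurable]: "F \<in> borel_measurable borel" 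
    unfolding F_def
    by (intro borel_measurable_times borel_measurable_indicator f0 borel_closed closed_cball)
  have ae: "AE x in lborel. f x = F x"
    using ae0 by eventually_elim (use K R in \<open>force simp: F_def indicator_def\<close>)
  then have aeL: "AE x in lebesgue. f x = F x" by (rule AE_completion)
  have supp: "F x = 0" if "norm x > R" for x using that by (simp add: F_def)
  have intp: "integrable lebesgue (\<lambda>x. \<bar>F x\<bar> powr p)"
  proof (rule integrable_cong_AE_imp[OF int])
    show "(\<lambda>x. \<bar>F x\<bar> powr p) \<in> borel_measurable lebesgue"
      by (rule borel_imp_lebesgue_measurable) measurable
    show "AE x in lebesgue. \<bar>f x\<bar> powr p = \<bar>F x\<bar> powr p"
      using aeL by eventually_elim simp
  qed
  then have intp': "integrable lborel (\<lambda>x. \<bar>F x\<bar> powr p)"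
    by (subst (asm) integrable_completion) simp_all
  have fin: "(\<integral>\<^sup>+x. ennreal (\<bar>F x\<bar> powr p) \<partial>lborel) < \<infinity>"
    using integrableD(2)[OF intp'] by (simp add: less_top)
  have intF: "integrable lborel F"
  proof -
    have "integrable lebesgue F"
      by (rule integrable_Lp_compact_support[OF p, of _ "cball 0 R"])
         (use intp supp borel_imp_lebesgue_measurable[OF F] in \<open>simp_all add: not_le\<close>)
    then show ?thesis by (subst (asm) integrable_completion) simp_all
  qed
  obtain d where d: "d > 0" "\<And>y. norm y < d \<Longrightarrow>
      (\<integral>\<^sup>+x. ennreal (\<bar>F (x - y) - F x\<bar> powr p) \<partial>lborel) \<le> ennreal e"
    using Lp_translation_continuous[OF p F supp fin e] by metis
  show thesis
  proof (rule that[OF d(1)])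
    fix \<eta> :: "'a \<Rightarrow> real" assume \<eta>: "mollifier d \<eta>"
    then have \<eta>t: "\<eta> \<in> test_fun UNIV" and \<eta>0: "\<And>y. 0 \<le> \<eta> y" and \<eta>d: "\<And>y. norm y \<ge> d \<Longrightarrow> \<eta> y = 0"
      and \<eta>1: "(LINT y|lborel. \<eta> y) = 1" by (simp_all add: mollifier_def)
    have [measurable]: "\<eta> \<in> borel_measurable borel"
      using \<eta>t by (intro smooth_borel_measurable test_fun_smooth)
    have \<eta>int: "integrable lborel \<eta>" by (rule test_fun_integrable[OF \<eta>t])
    have \<eta>nn: "(\<integral>\<^sup>+y. ennreal (\<eta> y) \<partial>lborel) = 1"
      using nn_integral_eq_integral[OF \<eta>int] \<eta>0 \<eta>1 by simp
    have \<eta>nnx: "(\<integral>\<^sup>+y. ennreal (\<eta> (x - y)) \<partial>lborel) = 1" for x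
      using nn_integral_lborel_reflect[of "\<lambda>y. ennreal (\<eta> y)" x] \<eta>nn by simp
    have \<eta>intx: "integrable lborel (\<lambda>y. \<eta> (x - y))" for x
      by (rule integrableI_nonneg) (use \<eta>0 \<eta>nnx in auto)
    have \<eta>1x: "(LINT y|lborel. \<eta> (x - y)) = 1" for x
      using integral_eq_nn_integral[of "\<lambda>y. \<eta> (x - y)" lborel] \<eta>0 \<eta>nnx by simp
    obtain B where B: "\<And>x. \<bar>\<eta> x\<bar> \<le> B" using test_fun_bounded[OF \<eta>t] by metis
    have cF: "convol f \<eta> x = (LINT y|lborel. F y * \<eta> (x - y))" for x
    proof -
      have "convol f \<eta> x = (LINT y|lebesgue. F y * \<eta> (x - y))"
        unfolding convol_def
      proof (rule integral_cong_AE)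
        show "(\<lambda>y. f y * \<eta> (x - y)) \<in> borel_measurable lebesgue"
          by (intro borel_measurable_times f borel_imp_lebesgue_measurable) measurable
        show "(\<lambda>y. F y * \<eta> (x - y)) \<in> borel_measurable lebesgue"
          by (intro borel_imp_lebesgue_measurable) measurable
        show "AE y in lebesgue. f y * \<eta> (x - y) = F y * \<eta> (x - y)"
          using aeL by eventually_elim simp
      qed
      then show ?thesis by (simp add: integral_completion)
    qed
    have FI: "integrable lborel (\<lambda>y. F y * \<eta> (x - y))" for x
      by (rule integrable_mult_bounded[OF intF _ B]) simp
    have hI: "integrable lborel (\<lambda>y. (F y - F x) * \<eta> (x - y))" for x
      using Bochner_Integration.integrable_diff[OF FI[of x] integrable_mult_right[OF \<eta>intx[of x], of "F x"]]
      by (simp add: algebra_simps)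
    have diff: "convol f \<eta> x - F x = (LINT y|lborel. (F y - F x) * \<eta> (x - y))" for x
    proof -
      have "(LINT y|lborel. (F y - F x) * \<eta> (x - y))
         = (LINT y|lborel. F y * \<eta> (x - y) - F x * \<eta> (x - y))" by (simp add: algebra_simps)
      also have "\<dots> = convol f \<eta> x - (LINT y|lborel. F x * \<eta> (x - y))"
        unfolding cF by (rule Bochner_Integration.integral_diff[OF FI integrable_mult_right[OF \<eta>intx]])
      also have "(LINT y|lborel. F x * \<eta> (x - y)) = F x" by (simp add: \<eta>1x)
      finally show ?thesis by simp
    qed
    have "(\<integral>\<^sup>+x. ennreal (\<bar>convol f \<eta> x - f x\<bar> powr p) \<partial>lebesgue)
      = (\<integral>\<^sup>+x. ennreal (\<bar>convol f \<eta> x - F x\<bar> powr p) \<partial>lebesgue)"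
    proof (rule nn_integral_cong_AE)
      show "AE x in lebesgue. ennreal (\<bar>convol f \<eta> x - f x\<bar> powr p) = ennreal (\<bar>convol f \<eta> x - F x\<bar> powr p)"
        using aeL by eventually_elim simp
    qed
    also have "\<dots> = (\<integral>\<^sup>+x. ennreal (\<bar>convol f \<eta> x - F x\<bar> powr p) \<partial>lborel)"
      by (rule nn_integral_completion)
    also have "\<dots> \<le> (\<integral>\<^sup>+x. (\<integral>\<^sup>+y. ennreal (\<bar>F y - F x\<bar> powr p * \<eta> (x - y)) \<partial>lborel) \<partial>lborel)"
    proof (rule nn_integral_mono)
      fix x
      show "ennreal (\<bar>convol f \<eta> x - F x\<bar> powr p) \<le> (\<integral>\<^sup>+y. ennreal (\<bar>F y - F x\<bar> powr p * \<eta> (x - y)) \<partial>lborel)"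
        unfolding diff by (rule Jensen_powr[OF p]) (use \<eta>0 \<eta>intx \<eta>1x hI in auto)
    qed
    also have "\<dots> = (\<integral>\<^sup>+x. (\<integral>\<^sup>+z. ennreal (\<bar>F (x - z) - F x\<bar> powr p * \<eta> z) \<partial>lborel) \<partial>lborel)"
    proof (rule nn_integral_cong)
      fix x
      show "(\<integral>\<^sup>+y. ennreal (\<bar>F y - F x\<bar> powr p * \<eta> (x - y)) \<partial>lborel)
         = (\<integral>\<^sup>+z. ennreal (\<bar>F (x - z) - F x\<bar> powr p * \<eta> z) \<partial>lborel)"
        using nn_integral_lborel_reflect[of "\<lambda>y. ennreal (\<bar>F y - F x\<bar> powr p * \<eta> (x - y))" x] by simp
    qed
    also have "\<dots> = (\<integral>\<^sup>+z. (\<integral>\<^sup>+x. ennreal (\<bar>F (x - z) - F x\<bar> powr p * \<eta> z) \<partial>lborel) \<partial>lborel)"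
      by (rule lborel_pair.Fubini') measurable
    also have "\<dots> \<le> (\<integral>\<^sup>+z. ennreal e * ennreal (\<eta> z) \<partial>lborel)"
    proof (rule nn_integral_mono)
      fix z
      have "(\<integral>\<^sup>+x. ennreal (\<bar>F (x - z) - F x\<bar> powr p * \<eta> z) \<partial>lborel)
        = (\<integral>\<^sup>+x. ennreal (\<bar>F (x - z) - F x\<bar> powr p) \<partial>lborel) * ennreal (\<eta> z)"
        using \<eta>0 by (simp add: ennreal_mult nn_integral_multc)
      also have "\<dots> \<le> ennreal e * ennreal (\<eta> z)"
      proof (cases "norm z < d")
        case True
        then show ?thesis by (intro mult_right_mono d(2)) auto
      next
        case False
        then have "\<eta> z = 0" by (intro \<eta>d) simp
        then show ?thesis by simp
      qed
      finally show "(\<integral>\<^sup>+x. ennreal (\<bar>F (x - z) - F x\<bar> powr p * \<eta> z) \<partial>lborel) \<le> ennreal e * ennreal (\<eta> z)" .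
    qed
    also have "\<dots> = ennreal e" by (simp add: nn_integral_cmult \<eta>nn)
    finally show "(\<integral>\<^sup>+x. ennreal (\<bar>convol f \<eta> x - f x\<bar> powr p) \<partial>lebesgue) \<le> ennreal e" .
  qed
qed

lemma mollifier_sequence_exists:
  assumes "d > 0"
  obtains \<eta> :: "nat \<Rightarrow> 'a::euclidean_space \<Rightarrow> real" where "\<And>n. mollifier (d / Suc n) (\<eta> n)"
proof -
  have "\<exists>\<eta> :: 'a \<Rightarrow> real. mollifier (d / Suc n) \<eta>" for n
    using assms by (intro mollifier_exists) simp
  then show thesis using that by metis
qed

lemma mollifier_mono: "mollifier d \<eta> \<Longrightarrow> d \<le> d' \<Longrightarrow> mollifier d' \<eta>"
  by (auto simp: mollifier_def)

lemma mollifier_test_fun: "mollifier d \<eta> \<Longrightarrow> \<eta> \<in> test_fun UNIV"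
  by (simp add: mollifier_def)

lemma mollifier_eq_0: "mollifier d \<eta> \<Longrightarrow> d \<le> norm x \<Longrightarrow> \<eta> x = 0"
  by (simp add: mollifier_def)

lemma tendsto_0_ennrealI:
  fixes X :: "nat \<Rightarrow> ennreal"
  assumes "\<And>e::real. e > 0 \<Longrightarrow> \<exists>N. \<forall>n\<ge>N. X n \<le> ennreal e"
  shows "X \<longlonglongrightarrow> 0"
proof (rule order_tendstoI)
  fix a :: ennreal assume "0 < a"
  obtain e :: real where e: "0 < ennreal e" "ennreal e < a"
    using dense[OF \<open>0 < a\<close>] by (metis ennreal_cases less_top not_less_iff_gr_or_eq top.extremum_strict)
  then obtain N where "\<forall>n\<ge>N. X n \<le> ennreal e" using assms[of e] by (auto simp: ennreal_less_zero_iff)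
  then show "\<forall>\<^sub>F n in sequentially. X n < a"
    using e by (auto simp: eventually_sequentially intro: le_less_trans)
qed simp

lemma convol_sequence_tendsto_Lp:
  fixes f :: "'a::euclidean_space \<Rightarrow> real"
  assumes "p \<ge> 1" "f \<in> borel_measurable lebesgue"
    "bounded K" "\<And>x. x \<notin> K \<Longrightarrow> f x = 0" "integrable lebesgue (\<lambda>x. \<bar>f x\<bar> powr p)"
    and d: "d > 0" and \<eta>: "\<And>n. mollifier (d / Suc n) (\<eta> n)"
  shows "(\<lambda>n. \<integral>\<^sup>+x. ennreal (\<bar>convol f (\<eta> n) x - f x\<bar> powr p) \<partial>lebesgue) \<longlonglongrightarrow> 0"
proof (rule tendsto_0_ennrealI)
  fix e :: real assume "e > 0"
  then obtain d' where d': "d' > 0" "\<And>\<eta>. mollifier d' \<eta> \<Longrightarrow>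
      (\<integral>\<^sup>+x. ennreal (\<bar>convol f \<eta> x - f x\<bar> powr p) \<partial>lebesgue) \<le> ennreal e"
    using convol_tendsto_Lp[OF assms(1-5)] by metis
  obtain N where N: "d / d' < real N" using reals_Archimedean2 by blast
  have "mollifier d' (\<eta> n)" if "n \<ge> N" for n
  proof (rule mollifier_mono[OF \<eta>])
    have "d / d' < Suc n" using N that by linarith
    then show "d / Suc n \<le> d'" using d d' by (simp add: field_simps)
  qed
  then show "\<exists>N. \<forall>n\<ge>N. (\<integral>\<^sup>+x. ennreal (\<bar>convol f (\<eta> n) x - f x\<bar> powr p) \<partial>lebesgue) \<le> ennreal e"
    using d'(2) by blast
qed

section \<open>Function spaces\<close>

lemma compact_sets_lebesgue: "compact K \<Longrightarrow> K \<in> sets lebesgue"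
  by (simp add: borel_compact sets_completionI_sets)

lemma open_sets_lebesgue: "open S \<Longrightarrow> S \<in> sets lebesgue"
  by (simp add: sets_completionI_sets)

lemma Lp_iff:
  fixes f :: "'a::euclidean_space \<Rightarrow> 'b::euclidean_space"
  assumes "S \<in> sets lebesgue"
  shows "f \<in> Lp p S \<longleftrightarrow> (\<lambda>x. indicator S x *\<^sub>R f x) \<in> borel_measurable lebesgue \<and>
     integrable lebesgue (\<lambda>x. norm (indicator S x *\<^sub>R f x) powr p)"
proof -
  have "(\<lambda>x. indicator S x *\<^sub>R (norm (f x) powr p)) = (\<lambda>x. norm (indicator S x *\<^sub>R f x) powr p)"
    by (auto simp: indicator_def)
  then show ?thesis
    using assms by (simp add: Lp_def borel_measurable_restrict_space_iff integrable_restrict_space)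
qed

lemma borel_measurable_lebesgue_on_subset:
  "f \<in> borel_measurable (lebesgue_on S) \<Longrightarrow> T \<subseteq> S \<Longrightarrow> f \<in> borel_measurable (lebesgue_on T)"
  by (rule measurable_restrict_mono)

text \<open>
  Membership in the function spaces is always established by domination: sums, truncations and
  functions defined by cases are bounded by the sum of the norms of two given members.
\<close>

lemma Lp_bound:
  fixes f :: "'a::euclidean_space \<Rightarrow> 'b::euclidean_space"
    and g :: "'a \<Rightarrow> 'c::euclidean_space" and h :: "'a \<Rightarrow> 'd::euclidean_space"
  assumes p: "p \<ge> 1" and f: "f \<in> borel_measurable (lebesgue_on S)"
    and g: "g \<in> Lp p S" and h: "h \<in> Lp p S"
    and le: "\<And>x. x \<in> S \<Longrightarrow> norm (f x) \<le> norm (g x) + norm (h x)"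
  shows "f \<in> Lp p S"
proof -
  have "integrable (lebesgue_on S) (\<lambda>x. norm (f x) powr p)"
  proof (rule Bochner_Integration.integrable_bound)
    show "integrable (lebesgue_on S) (\<lambda>x. 2 powr p * (norm (g x) powr p + norm (h x) powr p))"
      using g h by (intro integrable_mult_right Bochner_Integration.integrable_add) (simp_all add: Lp_def)
    show "(\<lambda>x. norm (f x) powr p) \<in> borel_measurable (lebesgue_on S)"
      using f by measurable
    have "norm (f x) powr p \<le> 2 powr p * (norm (g x) powr p + norm (h x) powr p)" if "x \<in> S" for x
      by (rule powr_abs_add2_le[OF p le[OF that]]) simp_all
    then show "AE x in lebesgue_on S. norm (norm (f x) powr p) \<le> norm (2 powr p * (norm (g x) powr p + norm (h x) powr p))"
      by (intro AE_I2) (simp add: abs_mult)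
  qed
  with f show ?thesis by (simp add: Lp_def)
qed

lemma Lp_subset:
  fixes f :: "'a::euclidean_space \<Rightarrow> 'b::euclidean_space"
  assumes "f \<in> Lp p S" "T \<subseteq> S" "S \<in> sets lebesgue" "T \<in> sets lebesgue"
  shows "f \<in> Lp p T"
proof -
  have "integrable lebesgue (\<lambda>x. indicator T x *\<^sub>R (indicator S x *\<^sub>R (norm (f x) powr p)))"
    using assms integrable_restrict_space[of S lebesgue "\<lambda>x. norm (f x) powr p"]
    by (intro integrable_mult_indicator[where A = T and f = "\<lambda>x. indicator S x *\<^sub>R (norm (f x) powr p)"])
       (simp_all add: Lp_def)
  moreover have "(\<lambda>x. indicator T x *\<^sub>R (indicator S x *\<^sub>R (norm (f x) powr p))) = (\<lambda>x. indicator T x *\<^sub>R (norm (f x) powr p))"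
    using assms(2) by (intro ext) (auto simp: indicator_def)
  ultimately have "integrable (lebesgue_on T) (\<lambda>x. norm (f x) powr p)"
    using assms(4) by (simp only: integrable_restrict_space sets.Int_space_eq2)
  moreover have "f \<in> borel_measurable (lebesgue_on T)"
    using assms(1,2) by (intro borel_measurable_lebesgue_on_subset[of f S T]) (simp_all add: Lp_def)
  ultimately show ?thesis by (simp add: Lp_def)
qed

lemma Lp_imp_Lp_loc:
  assumes "f \<in> Lp p \<Omega>" "open \<Omega>"
  shows "f \<in> Lp_loc p \<Omega>"
  unfolding Lp_loc_def
proof (intro CollectI conjI allI impI)
  show "f \<in> borel_measurable (lebesgue_on \<Omega>)" using assms(1) by (simp add: Lp_def)
  show "f \<in> Lp p K" if "compact K \<and> K \<subseteq> \<Omega>" for K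
    using that assms by (intro Lp_subset[OF assms(1)] open_sets_lebesgue compact_sets_lebesgue) simp_all
qed

lemma Lp_loc_D: "f \<in> Lp_loc p \<Omega> \<Longrightarrow> compact K \<Longrightarrow> K \<subseteq> \<Omega> \<Longrightarrow> f \<in> Lp p K"
  by (simp add: Lp_loc_def)

lemma Lp_loc_measurable: "f \<in> Lp_loc p \<Omega> \<Longrightarrow> f \<in> borel_measurable (lebesgue_on \<Omega>)"
  by (simp add: Lp_loc_def)

lemma Lp_measurable: "f \<in> Lp p \<Omega> \<Longrightarrow> f \<in> borel_measurable (lebesgue_on \<Omega>)"
  by (simp add: Lp_def)

lemma Lp_loc_bound:
  fixes f :: "'a::euclidean_space \<Rightarrow> 'b::euclidean_space"
    and g :: "'a \<Rightarrow> 'c::euclidean_space" and h :: "'a \<Rightarrow> 'd::euclidean_space"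
  assumes "p \<ge> 1" "f \<in> borel_measurable (lebesgue_on \<Omega>)" "g \<in> Lp_loc p \<Omega>" "h \<in> Lp_loc p \<Omega>"
    "\<And>x. x \<in> \<Omega> \<Longrightarrow> norm (f x) \<le> norm (g x) + norm (h x)"
  shows "f \<in> Lp_loc p \<Omega>"
  unfolding Lp_loc_def
proof (intro CollectI conjI allI impI assms(2))
  fix K assume K: "compact K \<and> K \<subseteq> \<Omega>"
  then show "f \<in> Lp p K"
    using assms borel_measurable_lebesgue_on_subset[OF assms(2), of K]
    by (intro Lp_bound[of p f K g h]) (auto simp: Lp_loc_D)
qed

lemma Lp_loc_add:
  fixes f g :: "'a::euclidean_space \<Rightarrow> 'b::euclidean_space"
  assumes "p \<ge> 1" and f: "f \<in> Lp_loc p \<Omega>" and g: "g \<in> Lp_loc p \<Omega>"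
  shows "(\<lambda>x. f x + g x) \<in> Lp_loc p \<Omega>"
  by (rule Lp_loc_bound[OF assms(1) _ f g])
     (intro borel_measurable_add Lp_loc_measurable[OF f] Lp_loc_measurable[OF g] norm_triangle_ineq)+

lemma Lp_scaleR:
  fixes f :: "'a::euclidean_space \<Rightarrow> 'b::euclidean_space"
  assumes "f \<in> Lp p S"
  shows "(\<lambda>x. c *\<^sub>R f x) \<in> Lp p S"
proof -
  have f: "f \<in> borel_measurable (lebesgue_on S)" "integrable (lebesgue_on S) (\<lambda>x. norm (f x) powr p)"
    using assms by (simp_all add: Lp_def)
  have "(\<lambda>x. norm (c *\<^sub>R f x) powr p) = (\<lambda>x. \<bar>c\<bar> powr p * norm (f x) powr p)"
    by (simp add: powr_mult)
  then have "integrable (lebesgue_on S) (\<lambda>x. norm (c *\<^sub>R f x) powr p)"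
    using integrable_mult_right[OF f(2), of "\<bar>c\<bar> powr p"] by simp
  moreover have "(\<lambda>x. c *\<^sub>R f x) \<in> borel_measurable (lebesgue_on S)" using f(1) by measurable
  ultimately show ?thesis by (simp only: Lp_def mem_Collect_eq)
qed

lemma Lp_loc_scaleR:
  fixes f :: "'a::euclidean_space \<Rightarrow> 'b::euclidean_space"
  assumes "f \<in> Lp_loc p \<Omega>"
  shows "(\<lambda>x. c *\<^sub>R f x) \<in> Lp_loc p \<Omega>"
  unfolding Lp_loc_def
proof (intro CollectI conjI allI impI Lp_scaleR)
  show "(\<lambda>x. c *\<^sub>R f x) \<in> borel_measurable (lebesgue_on \<Omega>)"
    using Lp_loc_measurable[OF assms] by measurable
qed (use assms Lp_loc_D in blast)

lemma Lp_loc_diff: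
  fixes f g :: "'a::euclidean_space \<Rightarrow> 'b::euclidean_space"
  assumes "p \<ge> 1" and f: "f \<in> Lp_loc p \<Omega>" and g: "g \<in> Lp_loc p \<Omega>"
  shows "(\<lambda>x. f x - g x) \<in> Lp_loc p \<Omega>"
  using Lp_loc_add[OF assms(1) f Lp_loc_scaleR[OF g, of "-1"]] by simp

lemma Lp_loc_1_integrable:
  fixes f :: "'a::euclidean_space \<Rightarrow> 'b::euclidean_space"
  assumes "f \<in> Lp_loc 1 \<Omega>" "compact K" "K \<subseteq> \<Omega>"
  shows "integrable lebesgue (\<lambda>x. indicator K x *\<^sub>R f x)"
proof -
  have "f \<in> Lp 1 K" using assms by (rule Lp_loc_D)
  then have meas: "(\<lambda>x. indicator K x *\<^sub>R f x) \<in> borel_measurable lebesgue"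
    and int: "integrable lebesgue (\<lambda>x. norm (indicator K x *\<^sub>R f x) powr 1)"
    using Lp_iff[OF compact_sets_lebesgue[OF assms(2)], of f 1] by simp_all
  have "integrable lebesgue (\<lambda>x. norm (indicator K x *\<^sub>R f x))"
    using int by (simp only: powr_one norm_ge_zero)
  then show ?thesis by (rule integrable_norm_iff[OF meas, THEN iffD1])
qed

lemma Lp_loc_inner:
  fixes f :: "'a::euclidean_space \<Rightarrow> 'b::euclidean_space"
  assumes "p \<ge> 1" "f \<in> Lp_loc p \<Omega>" "b \<in> Basis"
  shows "(\<lambda>x. f x \<bullet> b) \<in> Lp_loc p \<Omega>"
proof (rule Lp_loc_bound[OF assms(1) _ assms(2,2)])
  show "(\<lambda>x. f x \<bullet> b) \<in> borel_measurable (lebesgue_on \<Omega>)"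
    using Lp_loc_measurable[OF assms(2)] by (intro borel_measurable_inner) simp_all
  show "norm (f x \<bullet> b) \<le> norm (f x) + norm (f x)" for x
    using Basis_le_norm[OF assms(3), of "f x"] by (simp add: add_increasing2)
qed

lemma test_product_integral:
  fixes f :: "'a::euclidean_space \<Rightarrow> real"
  assumes f: "f \<in> Lp_loc 1 \<Omega>" and \<Omega>: "open \<Omega>" and K: "compact K" "K \<subseteq> \<Omega>" "\<And>x. x \<notin> K \<Longrightarrow> \<psi> x = 0"
    and \<psi>: "\<psi> \<in> test_fun \<Omega>'"
  shows "integrable (lebesgue_on \<Omega>) (\<lambda>x. f x * \<psi> x)"
    and "(LINT x|lebesgue_on \<Omega>. f x * \<psi> x) = (LINT x|lebesgue. indicator K x * f x * \<psi> x)"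
    and "integrable lebesgue (\<lambda>x. indicator K x * f x * \<psi> x)"
proof -
  have eq: "(\<lambda>x. indicator \<Omega> x *\<^sub>R (f x * \<psi> x)) = (\<lambda>x. indicator K x * f x * \<psi> x)"
  proof
    show "indicator \<Omega> x *\<^sub>R (f x * \<psi> x) = indicator K x * f x * \<psi> x" for x
      using K by (cases "x \<in> K") auto
  qed
  obtain B where B: "\<And>x. \<bar>\<psi> x\<bar> \<le> B" using test_fun_bounded[OF \<psi>] by metis
  have "\<psi> \<in> borel_measurable lebesgue"
    by (intro borel_imp_lebesgue_measurable smooth_borel_measurable test_fun_smooth[OF \<psi>])
  then show int: "integrable lebesgue (\<lambda>x. indicator K x * f x * \<psi> x)"
    using Lp_loc_1_integrable[OF f K(1,2)] B
    by (intro integrable_mult_bounded[where f = "\<lambda>x. indicator K x * f x" and B = B]) simp_all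
  show "integrable (lebesgue_on \<Omega>) (\<lambda>x. f x * \<psi> x)"
    using int \<Omega> by (simp only: integrable_restrict_space open_sets_lebesgue eq sets.Int_space_eq2)
  show "(LINT x|lebesgue_on \<Omega>. f x * \<psi> x) = (LINT x|lebesgue. indicator K x * f x * \<psi> x)"
    using \<Omega> by (simp only: integral_restrict_space open_sets_lebesgue eq sets.Int_space_eq2)
qed

lemma test_product_integrable:
  fixes f :: "'a::euclidean_space \<Rightarrow> real"
  assumes "f \<in> Lp_loc 1 \<Omega>" "open \<Omega>" "\<psi> \<in> test_fun \<Omega>"
  shows "integrable (lebesgue_on \<Omega>) (\<lambda>x. f x * \<psi> x)"
proof -
  obtain K where "compact K" "K \<subseteq> \<Omega>" "\<And>x. x \<notin> K \<Longrightarrow> \<psi> x = 0"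
    using test_funE[OF assms(3)] by metis
  then show ?thesis by (rule test_product_integral(1)[OF assms(1,2) _ _ _ assms(3)])
qed

lemma compact_neighbourhood:
  fixes K :: "'a::euclidean_space set"
  assumes "compact K" "open \<Omega>" "K \<subseteq> \<Omega>"
  obtains d K' where "d > 0" "compact K'" "K' \<subseteq> \<Omega>" "\<And>x. x \<in> K \<Longrightarrow> cball x d \<subseteq> K'"
proof -
  obtain d where "d > 0" "(\<Union>x\<in>K. cball x d) \<subseteq> \<Omega>"
    using compact_subset_open_imp_cball_epsilon_subset[OF assms] by metis
  then show thesis
    by (intro that[of d "\<Union>x\<in>K. cball x d"] compact_minkowski_sum_cball assms) auto
qed

lemma mollifier_reflected_test_fun:
  assumes \<eta>: "mollifier d \<eta>" and sub: "cball x d \<subseteq> \<Omega>"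
  shows "(\<lambda>y. \<eta> (x - y)) \<in> test_fun \<Omega>"
    and "partial_deriv b (\<lambda>y. \<eta> (x - y)) y = - partial_deriv b \<eta> (x - y)"
    and "y \<notin> cball x d \<Longrightarrow> \<eta> (x - y) = 0"
proof -
  have eq: "(\<lambda>y. \<eta> (x - y)) = (\<lambda>y. 1 * \<eta> ((-1) *\<^sub>R y + x))" by simp
  have \<eta>s: "smooth \<eta>" using test_fun_smooth[OF mollifier_test_fun[OF \<eta>]] .
  show 0: "\<eta> (x - y) = 0" if "y \<notin> cball x d" for y
    using mollifier_eq_0[OF \<eta>, of "x - y"] that by (simp add: dist_norm)
  have "smooth (\<lambda>y. \<eta> (x - y))" unfolding eq by (rule smooth_affine[OF \<eta>s])
  then show "(\<lambda>y. \<eta> (x - y)) \<in> test_fun \<Omega>" by (rule test_funI[OF _ compact_cball sub 0])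
  show "partial_deriv b (\<lambda>y. \<eta> (x - y)) y = - partial_deriv b \<eta> (x - y)"
    unfolding eq by (subst partial_deriv_affine[OF \<eta>s]) simp
qed

section \<open>Weak gradients\<close>

lemma AE_lebesgue_on_iff:
  "open \<Omega> \<Longrightarrow> (AE x in lebesgue_on \<Omega>. P x) \<longleftrightarrow> (AE x in lebesgue. x \<in> \<Omega> \<longrightarrow> P x)"
  by (rule AE_restrict_space_iff) (simp add: open_sets_lebesgue)

text \<open>
  The functions \<open>y \<mapsto> \<eta> (x - y)\<close> are admissible test functions for \<open>x\<close> in a compact subset of \<open>\<Omega>\<close>. Hence the
  mollifications of \<open>f\<close> vanish there, and so does their limit in \<open>L\<^sup>1\<close>.
\<close>

theorem fundamental_lemma_calculus_of_variations:
  fixes f :: "'a::euclidean_space \<Rightarrow> real"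
  assumes f: "f \<in> Lp_loc 1 \<Omega>" and \<Omega>: "open \<Omega>"
    and test: "\<And>\<psi>. \<psi> \<in> test_fun \<Omega> \<Longrightarrow> (LINT x|lebesgue_on \<Omega>. f x * \<psi> x) = 0"
  shows "AE x in lebesgue_on \<Omega>. f x = 0"
proof -
  have on_compact: "AE x in lebesgue. x \<in> K \<longrightarrow> f x = 0" if K: "compact K" "K \<subseteq> \<Omega>" for K
  proof -
    obtain d K' where d: "d > 0" and K': "compact K'" "K' \<subseteq> \<Omega>" "\<And>x. x \<in> K \<Longrightarrow> cball x d \<subseteq> K'"
      using compact_neighbourhood[OF K(1) \<Omega> K(2)] by metis
    have KK': "K \<subseteq> K'" using K'(3) d by fastforce
    define F where "F x = indicator K' x * f x" for x
    have F: "integrable lebesgue F"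
      using Lp_loc_1_integrable[OF f K'(1,2)] by (simp add: F_def[abs_def])
    obtain \<eta> :: "nat \<Rightarrow> 'a \<Rightarrow> real" where \<eta>: "\<And>n. mollifier (d / Suc n) (\<eta> n)"
      using mollifier_sequence_exists[OF d] by metis
    have zero: "convol F (\<eta> n) x = 0" if x: "x \<in> K" for n x
    proof -
      have "d / Suc n \<le> d" using d by (simp add: divide_le_eq)
      then have m: "mollifier d (\<eta> n)" by (rule mollifier_mono[OF \<eta>])
      have "cball x d \<subseteq> \<Omega>" using K'(2,3) x by blast
      note refl = mollifier_reflected_test_fun[OF m this]
      have "\<eta> n (x - y) = 0" if "y \<notin> K'" for y using that K'(3)[OF x] by (intro refl(3)) blast
      from test_product_integral(2)[OF f \<Omega> K'(1,2) this refl(1)] test[OF refl(1)]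
      show ?thesis by (simp add: convol_def F_def)
    qed
    have "(\<lambda>n. \<integral>\<^sup>+x. ennreal (\<bar>convol F (\<eta> n) x - F x\<bar> powr 1) \<partial>lebesgue) \<longlonglongrightarrow> 0"
      by (rule convol_sequence_tendsto_Lp[OF _ _ compact_imp_bounded[OF K'(1)] _ _ d \<eta>])
         (use F in \<open>simp_all add: F_def integrable_abs F[unfolded F_def[abs_def]]\<close>)
    moreover have "(\<integral>\<^sup>+x. ennreal \<bar>F x\<bar> * indicator K x \<partial>lebesgue)
        \<le> (\<integral>\<^sup>+x. ennreal (\<bar>convol F (\<eta> n) x - F x\<bar> powr 1) \<partial>lebesgue)" for n
      by (rule nn_integral_mono) (use zero in \<open>auto simp: indicator_def\<close>)
    ultimately have "(\<integral>\<^sup>+x. ennreal \<bar>F x\<bar> * indicator K x \<partial>lebesgue) \<le> 0"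
      by (intro LIMSEQ_le_const) auto
    then have "(\<integral>\<^sup>+x. ennreal \<bar>F x\<bar> * indicator K x \<partial>lebesgue) = 0" by simp
    moreover have "(\<lambda>x. ennreal \<bar>F x\<bar> * indicator K x) \<in> borel_measurable lebesgue"
      using F compact_sets_lebesgue[OF K(1)] by measurable
    ultimately have "AE x in lebesgue. ennreal \<bar>F x\<bar> * indicator K x = 0"
      by (simp add: nn_integral_0_iff_AE)
    then show ?thesis by eventually_elim (use KK' in \<open>auto simp: F_def indicator_def split: if_splits\<close>)
  qed
  obtain C where C: "\<And>n::nat. compact (C n)" "\<And>n. C n \<subseteq> \<Omega>" "\<Union>(range C) = \<Omega>"
    using open_Union_compact_subsets[OF \<Omega>] by metis
  have "AE x in lebesgue. \<forall>n. x \<in> C n \<longrightarrow> f x = 0"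
    using on_compact[OF C(1,2)] by (subst AE_all_countable) blast
  then have "AE x in lebesgue. x \<in> \<Omega> \<longrightarrow> f x = 0"
    by eventually_elim (use C(3) in blast)
  then show ?thesis using \<Omega> by (simp add: AE_lebesgue_on_iff)
qed

lemma has_weak_gradient_Lp_loc:
  assumes "has_weak_gradient u g \<Omega>"
  shows "u \<in> Lp_loc 1 \<Omega>" "g \<in> Lp_loc 1 \<Omega>"
  using assms unfolding has_weak_gradient_def by blast+

lemma has_weak_gradientD:
  assumes "has_weak_gradient u g \<Omega>" "\<psi> \<in> test_fun \<Omega>" "b \<in> Basis"
  shows "(LINT x|lebesgue_on \<Omega>. u x * partial_deriv b \<psi> x) = - (LINT x|lebesgue_on \<Omega>. (g x \<bullet> b) * \<psi> x)"
  using assms unfolding has_weak_gradient_def by blast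

lemma weak_gradient_unique:
  assumes g: "has_weak_gradient u g \<Omega>" and h: "has_weak_gradient u h \<Omega>" and \<Omega>: "open \<Omega>"
  shows "AE x in lebesgue_on \<Omega>. g x = h x"
proof -
  have L: "g \<in> Lp_loc 1 \<Omega>" "h \<in> Lp_loc 1 \<Omega>"
    by (fact has_weak_gradient_Lp_loc[OF g] has_weak_gradient_Lp_loc[OF h])+
  have "AE x in lebesgue_on \<Omega>. g x \<bullet> b - h x \<bullet> b = 0" if b: "b \<in> Basis" for b
  proof (rule fundamental_lemma_calculus_of_variations[OF _ \<Omega>])
    have Lb: "(\<lambda>x. g x \<bullet> b) \<in> Lp_loc 1 \<Omega>" "(\<lambda>x. h x \<bullet> b) \<in> Lp_loc 1 \<Omega>"
      using L b by (intro Lp_loc_inner; simp)+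
    show "(\<lambda>x. g x \<bullet> b - h x \<bullet> b) \<in> Lp_loc 1 \<Omega>"
      by (rule Lp_loc_bound[where p = 1, OF _ borel_measurable_diff[OF Lb[THEN Lp_loc_measurable]] Lb]) auto
    fix \<psi> assume \<psi>: "\<psi> \<in> test_fun \<Omega>"
    have "(LINT x|lebesgue_on \<Omega>. (g x \<bullet> b) * \<psi> x) = (LINT x|lebesgue_on \<Omega>. (h x \<bullet> b) * \<psi> x)"
      using has_weak_gradientD[OF g \<psi> b] has_weak_gradientD[OF h \<psi> b] by simp
    then show "(LINT x|lebesgue_on \<Omega>. (g x \<bullet> b - h x \<bullet> b) * \<psi> x) = 0"
      using test_product_integrable[OF Lb(1) \<Omega> \<psi>] test_product_integrable[OF Lb(2) \<Omega> \<psi>]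
      by (simp add: left_diff_distrib)
  qed
  then have "AE x in lebesgue_on \<Omega>. \<forall>b\<in>Basis. g x \<bullet> b - h x \<bullet> b = 0"
    by (subst AE_ball_countable) (auto simp: countable_finite)
  then show ?thesis
  proof eventually_elim
    case (elim x)
    show "g x = h x" by (rule euclidean_eqI) (use elim in simp)
  qed
qed

lemma has_weak_gradient_weak_grad:
  assumes "has_weak_gradient u g \<Omega>"
  shows "has_weak_gradient u (weak_grad \<Omega> u) \<Omega>"
  using someI[of "\<lambda>g. has_weak_gradient u g \<Omega>", OF assms] unfolding weak_grad_def .

lemma weak_grad_AE_eq:
  assumes "has_weak_gradient u g \<Omega>" "open \<Omega>"
  shows "AE x in lebesgue_on \<Omega>. weak_grad \<Omega> u x = g x"
  by (rule weak_gradient_unique[OF has_weak_gradient_weak_grad[OF assms(1)] assms])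

lemma has_weak_gradient_linear:
  assumes u: "has_weak_gradient u g \<Omega>" and v: "has_weak_gradient v h \<Omega>" and \<Omega>: "open \<Omega>"
  shows "has_weak_gradient (\<lambda>x. a * u x + c * v x) (\<lambda>x. a *\<^sub>R g x + c *\<^sub>R h x) \<Omega>"
proof -
  have L: "u \<in> Lp_loc 1 \<Omega>" "g \<in> Lp_loc 1 \<Omega>" "v \<in> Lp_loc 1 \<Omega>" "h \<in> Lp_loc 1 \<Omega>"
    by (fact has_weak_gradient_Lp_loc[OF u] has_weak_gradient_Lp_loc[OF v])+
  have "(\<lambda>x. a *\<^sub>R u x + c *\<^sub>R v x) \<in> Lp_loc 1 \<Omega>"
    by (intro Lp_loc_add Lp_loc_scaleR L) simp
  moreover have "(\<lambda>x. a *\<^sub>R g x + c *\<^sub>R h x) \<in> Lp_loc 1 \<Omega>"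
    by (intro Lp_loc_add Lp_loc_scaleR L) simp
  moreover have "(LINT x|lebesgue_on \<Omega>. (a * u x + c * v x) * partial_deriv b \<psi> x)
      = - (LINT x|lebesgue_on \<Omega>. ((a *\<^sub>R g x + c *\<^sub>R h x) \<bullet> b) * \<psi> x)"
    if \<psi>: "\<psi> \<in> test_fun \<Omega>" and b: "b \<in> Basis" for \<psi> b
  proof -
    note \<psi>b = test_fun_partial_deriv[OF \<psi> b]
    have "(LINT x|lebesgue_on \<Omega>. (a * u x + c * v x) * partial_deriv b \<psi> x)
      = (LINT x|lebesgue_on \<Omega>. a * (u x * partial_deriv b \<psi> x) + c * (v x * partial_deriv b \<psi> x))"
      by (simp add: algebra_simps)
    also have "\<dots> = a * (LINT x|lebesgue_on \<Omega>. u x * partial_deriv b \<psi> x) + c * (LINT x|lebesgue_on \<Omega>. v x * partial_deriv b \<psi> x)"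
      using test_product_integrable[OF L(1) \<Omega> \<psi>b] test_product_integrable[OF L(3) \<Omega> \<psi>b] by simp
    also have "\<dots> = a * - (LINT x|lebesgue_on \<Omega>. (g x \<bullet> b) * \<psi> x) + c * - (LINT x|lebesgue_on \<Omega>. (h x \<bullet> b) * \<psi> x)"
      by (simp only: has_weak_gradientD[OF u \<psi> b] has_weak_gradientD[OF v \<psi> b])
    also have "\<dots> = - (LINT x|lebesgue_on \<Omega>. a * ((g x \<bullet> b) * \<psi> x) + c * ((h x \<bullet> b) * \<psi> x))"
      using test_product_integrable[OF Lp_loc_inner[OF _ L(2) b] \<Omega> \<psi>] test_product_integrable[OF Lp_loc_inner[OF _ L(4) b] \<Omega> \<psi>] by simp
    also have "\<dots> = - (LINT x|lebesgue_on \<Omega>. ((a *\<^sub>R g x + c *\<^sub>R h x) \<bullet> b) * \<psi> x)"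
      by (simp add: algebra_simps inner_simps)
    finally show ?thesis .
  qed
  ultimately show ?thesis unfolding has_weak_gradient_def by simp
qed

lemma has_weak_gradient_add:
  assumes "has_weak_gradient u g \<Omega>" "has_weak_gradient v h \<Omega>" "open \<Omega>"
  shows "has_weak_gradient (\<lambda>x. u x + v x) (\<lambda>x. g x + h x) \<Omega>"
  using has_weak_gradient_linear[OF assms, of 1 1] by simp

lemma has_weak_gradient_diff:
  assumes "has_weak_gradient u g \<Omega>" "has_weak_gradient v h \<Omega>" "open \<Omega>"
  shows "has_weak_gradient (\<lambda>x. u x - v x) (\<lambda>x. g x - h x) \<Omega>"
  using has_weak_gradient_linear[OF assms, of 1 "-1"] by simp

subsection \<open>Mollification and weak gradients\<close>

lemma partial_deriv_eq_0_outside: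
  assumes "closed K" "\<And>x. x \<notin> K \<Longrightarrow> \<psi> x = 0" "x \<notin> K"
  shows "partial_deriv b \<psi> x = 0"
proof -
  have "open (- K)" using assms(1) by blast
  then have "(\<psi> has_derivative (\<lambda>h. 0)) (at x)"
    by (rule has_derivative_transform_within_open[OF has_derivative_const]) (use assms in simp_all)
  then show ?thesis by (rule partial_deriv_eqI)
qed

text \<open>
  Testing with \<open>y \<mapsto> \<eta> (x - y)\<close> moves the derivative from \<open>\<eta>\<close> to \<open>u\<close>. Functions that are only given on
  \<open>\<Omega>\<close> are cut off outside \<open>K\<close>; the ball around \<open>x\<close> that the convolution sees lies inside \<open>K\<close>.
\<close>

lemma convol_weak_gradient:
  assumes u: "has_weak_gradient u g \<Omega>" and \<Omega>: "open \<Omega>" and K: "compact K" "K \<subseteq> \<Omega>"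
    and x: "cball x d \<subseteq> K" and \<eta>: "mollifier d \<eta>" and b: "b \<in> Basis"
  shows "convol (\<lambda>y. indicator K y * u y) (partial_deriv b \<eta>) x
    = convol (\<lambda>y. indicator K y * (g y \<bullet> b)) \<eta> x"
proof -
  define \<psi> where "\<psi> = (\<lambda>y. \<eta> (x - y))"
  have "cball x d \<subseteq> \<Omega>" using x K(2) by blast
  note refl = mollifier_reflected_test_fun[OF \<eta> this]
  have \<psi>: "\<psi> \<in> test_fun \<Omega>" unfolding \<psi>_def by (rule refl(1))
  have \<psi>0: "\<psi> y = 0" if "y \<notin> K" for y
    unfolding \<psi>_def using that x by (intro refl(3)) blast
  have \<psi>b0: "partial_deriv b \<psi> y = 0" if "y \<notin> K" for y
    using partial_deriv_eq_0_outside[OF compact_imp_closed[OF K(1)] \<psi>0 that] .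
  note L = has_weak_gradient_Lp_loc[OF u]
  have "convol (\<lambda>y. indicator K y * u y) (partial_deriv b \<eta>) x
      = - (LINT y|lebesgue. indicator K y * u y * partial_deriv b \<psi> y)"
    unfolding convol_def \<psi>_def refl(2) by simp
  also have "\<dots> = - (LINT y|lebesgue_on \<Omega>. u y * partial_deriv b \<psi> y)"
    using test_product_integral(2)[OF L(1) \<Omega> K \<psi>b0 test_fun_partial_deriv[OF \<psi> b]] by simp
  also have "\<dots> = (LINT y|lebesgue_on \<Omega>. (g y \<bullet> b) * \<psi> y)"
    using has_weak_gradientD[OF u \<psi> b] by simp
  also have "\<dots> = (LINT y|lebesgue. indicator K y * (g y \<bullet> b) * \<psi> y)"
    by (rule test_product_integral(2)[OF Lp_loc_inner[OF _ L(2) b] \<Omega> K \<psi>0 \<psi>]) simp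
  finally show ?thesis by (simp add: convol_def \<psi>_def)
qed

lemma convol_test_fun:
  assumes f: "integrable lebesgue f" and K: "bounded K" "\<And>x. x \<notin> K \<Longrightarrow> f x = 0"
    and \<eta>: "mollifier d \<eta>"
  shows "convol f \<eta> \<in> test_fun UNIV"
proof -
  obtain R where R: "\<And>x. x \<in> K \<Longrightarrow> norm x \<le> R" using K(1) by (meson bounded_iff)
  have "convol f \<eta> x = 0" if x: "x \<notin> cball 0 (R + d)" for x
  proof (rule convol_eq_0)
    fix y assume "f y \<noteq> 0"
    then have "norm y \<le> R" using K R by blast
    moreover have "norm x \<le> norm (x - y) + norm y" using norm_triangle_ineq[of "x - y" y] by simp
    ultimately have "d \<le> norm (x - y)" using x by simp
    then show "\<eta> (x - y) = 0" by (rule mollifier_eq_0[OF \<eta>])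
  qed
  then show ?thesis
    by (rule test_funI[OF smooth_convol[OF f mollifier_test_fun[OF \<eta>]] compact_cball subset_UNIV])
qed

lemma convol_sequence_tendsto_L1:
  fixes f :: "'a::euclidean_space \<Rightarrow> real"
  assumes f: "integrable lebesgue f" and K: "bounded K" "\<And>x. x \<notin> K \<Longrightarrow> f x = 0"
    and d: "d > 0" and \<eta>: "\<And>n. mollifier (d / Suc n) (\<eta> n)"
  shows "integrable lebesgue (\<lambda>x. convol f (\<eta> n) x - f x)"
    and "(\<lambda>n. LINT x|lebesgue. \<bar>convol f (\<eta> n) x - f x\<bar>) \<longlonglongrightarrow> 0"
proof -
  have int: "integrable lebesgue (\<lambda>x. convol f (\<eta> n) x - f x)" for n
  proof (rule Bochner_Integration.integrable_diff[OF _ f])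
    have t: "convol f (\<eta> n) \<in> test_fun UNIV" by (rule convol_test_fun[OF f K \<eta>])
    show "integrable lebesgue (convol f (\<eta> n))"
      using test_fun_integrable[OF t] smooth_borel_measurable[OF test_fun_smooth[OF t]]
      by (subst integrable_completion) simp_all
  qed
  then show "integrable lebesgue (\<lambda>x. convol f (\<eta> n) x - f x)" .
  have "(\<lambda>n. \<integral>\<^sup>+x. ennreal (\<bar>convol f (\<eta> n) x - f x\<bar> powr 1) \<partial>lebesgue) \<longlonglongrightarrow> 0"
    by (rule convol_sequence_tendsto_Lp[OF _ _ K _ d \<eta>]) (use f in \<open>simp_all add: integrable_abs\<close>)
  moreover have "(\<integral>\<^sup>+x. ennreal (\<bar>convol f (\<eta> n) x - f x\<bar> powr 1) \<partial>lebesgue)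
      = ennreal (LINT x|lebesgue. \<bar>convol f (\<eta> n) x - f x\<bar>)" for n
    using nn_integral_eq_integral[OF integrable_abs[OF int[of n]]] by simp
  ultimately have "(\<lambda>n. ennreal (LINT x|lebesgue. \<bar>convol f (\<eta> n) x - f x\<bar>)) \<longlonglongrightarrow> ennreal 0"
    by simp
  then show "(\<lambda>n. LINT x|lebesgue. \<bar>convol f (\<eta> n) x - f x\<bar>) \<longlonglongrightarrow> 0"
    by (rule tendsto_ennrealD) simp_all
qed

subsection \<open>The chain rule\<close>

text \<open>
  By translation invariance every difference quotient of \<open>h\<close> has integral \<open>0\<close>. The quotients are bounded
  by the mean value theorem and have a common bounded support, so dominated convergence applies. This
  serves as integration by parts.
\<close>

lemma integral_directional_derivative_eq_0:
  fixes h h' :: "'a::euclidean_space \<Rightarrow> real"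
  assumes b: "b \<in> Basis"
    and deriv: "\<And>x t. ((\<lambda>t. h (x + t *\<^sub>R b)) has_real_derivative h' (x + t *\<^sub>R b)) (at t)"
    and cont: "continuous_on UNIV h" "continuous_on UNIV h'"
    and K: "compact K" "\<And>x. x \<notin> K \<Longrightarrow> h x = 0" "\<And>x. x \<notin> K \<Longrightarrow> h' x = 0"
  shows "(LINT x|lborel. h' x) = 0"
proof -
  have [measurable]: "h \<in> borel_measurable borel" "h' \<in> borel_measurable borel"
    using cont by (auto intro: borel_measurable_continuous_onI)
  have hI: "integrable lborel h" by (rule integrable_continuous_compact_support[OF cont(1) K(1,2)])
  obtain R where R: "\<And>x. x \<in> K \<Longrightarrow> norm x \<le> R"
    using compact_imp_bounded[OF K(1)] by (meson bounded_iff)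
  have "bounded (h' ` K)"
    by (intro compact_imp_bounded compact_continuous_image continuous_on_subset[OF cont(2)] K) simp
  then obtain B where "B > 0" "\<And>x. x \<in> K \<Longrightarrow> \<bar>h' x\<bar> \<le> B" by (auto simp: bounded_pos)
  then have B: "\<bar>h' x\<bar> \<le> B" for x using K(3) by (cases "x \<in> K") auto
  define s where "s n = 1 / real (Suc n)" for n
  have s: "0 < s n" "s n \<le> 1" for n by (auto simp: s_def)
  define q where "q n x = (h (x + s n *\<^sub>R b) - h x) / s n" for n x
  have nb: "norm (s n *\<^sub>R b) \<le> 1" for n using b s[of n] by simp
  have q_int: "(LINT x|lborel. q n x) = 0" for n
  proof -
    have eq: "(LINT x|lborel. h (x + s n *\<^sub>R b)) = (LINT x|lborel. h x)"
    proof -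
      have "(LINT x|lborel. h x) = (LINT x|distr lborel borel ((+) (s n *\<^sub>R b)). h x)"
        by (simp add: lborel_distr_plus)
      also have "\<dots> = (LINT x|lborel. h (s n *\<^sub>R b + x))" by (rule integral_distr) measurable
      finally show ?thesis by (simp add: add.commute)
    qed
    have "integrable (distr lborel borel ((+) (s n *\<^sub>R b))) h" using hI by (simp add: lborel_distr_plus)
    then have "integrable lborel (\<lambda>x. h (s n *\<^sub>R b + x))"
      by (subst (asm) integrable_distr_eq) measurable
    then have "integrable lborel (\<lambda>x. h (x + s n *\<^sub>R b))" by (simp add: add.commute)
    then show ?thesis unfolding q_def using hI eq by simp
  qed
  have "(\<lambda>n. LINT x|lborel. q n x) \<longlonglongrightarrow> (LINT x|lborel. h' x)"
  proof (rule integral_dominated_convergence[where w = "\<lambda>x. B * indicator (cball 0 (R + 1)) x"])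
    have "emeasure lborel (cball (0::'a) (R + 1)) < \<infinity>"
      by (rule emeasure_bounded_finite) simp
    then show "integrable lborel (\<lambda>x. B * indicator (cball (0::'a) (R + 1)) x)"
      by (intro integrable_mult_right integrable_real_indicator) simp_all
    show "AE x in lborel. (\<lambda>n. q n x) \<longlonglongrightarrow> h' x"
    proof (rule AE_I2)
      fix x
      have "((\<lambda>t. (h (x + t *\<^sub>R b) - h x) / t) \<longlongrightarrow> h' x) (at 0)"
        using deriv[of x 0] by (simp add: DERIV_def)
      moreover have "filterlim s (at 0) sequentially"
        unfolding filterlim_at s_def using LIMSEQ_inverse_real_of_nat by (simp add: inverse_eq_divide)
      ultimately show "(\<lambda>n. q n x) \<longlonglongrightarrow> h' x"
        unfolding q_def by (rule filterlim_compose)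
    qed
    show "AE x in lborel. norm (q n x) \<le> B * indicator (cball 0 (R + 1)) x" for n
    proof (rule AE_I2)
      fix x
      show "norm (q n x) \<le> B * indicator (cball 0 (R + 1)) x"
      proof (cases "x \<in> cball 0 (R + 1)")
        case True
        obtain t where "h (x + s n *\<^sub>R b) - h (x + 0 *\<^sub>R b) = (s n - 0) * h' (x + t *\<^sub>R b)"
          using MVT2[OF s(1)[of n], of "\<lambda>t. h (x + t *\<^sub>R b)" "\<lambda>t. h' (x + t *\<^sub>R b)"] deriv by metis
        then have "q n x = h' (x + t *\<^sub>R b)" using s(1)[of n] by (simp add: q_def)
        then show ?thesis using True B by simp
      next
        case False
        then have n1: "norm x > R + 1" by simp
        have "norm x \<le> norm (x + s n *\<^sub>R b) + norm (s n *\<^sub>R b)"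
          using norm_triangle_ineq4[of "x + s n *\<^sub>R b" "s n *\<^sub>R b"] by simp
        then have "norm (x + s n *\<^sub>R b) > R" using n1 nb[of n] by linarith
        then have "x \<notin> K" "x + s n *\<^sub>R b \<notin> K" using R[of x] R[of "x + s n *\<^sub>R b"] n1 by linarith+
        then have "q n x = 0" using K(2) by (simp add: q_def)
        then show ?thesis using False by simp
      qed
    qed
  qed (unfold q_def, measurable)
  then show ?thesis unfolding q_int by (simp add: LIMSEQ_const_iff)
qed

lemma tendsto_integral_0_bound:
  fixes w y :: "nat \<Rightarrow> 'a \<Rightarrow> real"
  assumes w: "\<And>n. integrable M (w n)" "(\<lambda>n. LINT x|M. \<bar>w n x\<bar>) \<longlonglongrightarrow> 0"
    and y: "\<And>n. y n \<in> borel_measurable M" "\<And>n x. \<bar>y n x\<bar> \<le> B * \<bar>w n x\<bar>"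
  shows "integrable M (y n)" "(\<lambda>n. LINT x|M. y n x) \<longlonglongrightarrow> 0"
proof -
  have int: "integrable M (y n)" for n
  proof (rule Bochner_Integration.integrable_bound[OF _ y(1)])
    show "integrable M (\<lambda>x. B * \<bar>w n x\<bar>)" by (intro integrable_mult_right integrable_abs w)
    show "AE x in M. norm (y n x) \<le> norm (B * \<bar>w n x\<bar>)"
      by (rule AE_I2) (use y(2) order_trans abs_ge_self in \<open>fastforce\<close>)
  qed
  show "integrable M (y n)" by (rule int)
  show "(\<lambda>n. LINT x|M. y n x) \<longlonglongrightarrow> 0"
  proof (rule Lim_null_comparison)
    show "(\<lambda>n. B * (LINT x|M. \<bar>w n x\<bar>)) \<longlonglongrightarrow> 0"
      using tendsto_mult[OF tendsto_const[of B] w(2)] by simp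
    have "norm (LINT x|M. y n x) \<le> B * (LINT x|M. \<bar>w n x\<bar>)" for n
    proof -
      have "norm (LINT x|M. y n x) \<le> (LINT x|M. \<bar>y n x\<bar>)" by (simp add: integral_abs_bound)
      also have "\<dots> \<le> (LINT x|M. B * \<bar>w n x\<bar>)"
        by (intro integral_mono integrable_abs int integrable_mult_right w y(2))
      finally show ?thesis by simp
    qed
    then show "\<forall>\<^sub>F n in sequentially. norm (LINT x|M. y n x) \<le> B * (LINT x|M. \<bar>w n x\<bar>)" by simp
  qed
qed

lemma Lp_loc_const:
  fixes c :: "'b::euclidean_space"
  shows "(\<lambda>x. c) \<in> Lp_loc p \<Omega>"
proof -
  have "integrable (lebesgue_on K) (\<lambda>x. norm c powr p)" if K: "compact K" for K :: "'a set"
  proof -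
    have "emeasure lebesgue K < \<infinity>"
      using emeasure_compact_finite[OF K] K by (simp add: borel_compact)
    then have "emeasure (lebesgue_on K) (space (lebesgue_on K)) < \<infinity>"
      using K by (simp add: emeasure_restrict_space compact_sets_lebesgue)
    then show ?thesis
      by (intro finite_measure.integrable_const finite_measureI) simp
  qed
  then show ?thesis by (auto simp: Lp_loc_def Lp_def)
qed

text \<open>
  For the mollifications of \<open>u\<close> the identity is the classical chain rule and integration by parts. The
  mollifications and their derivatives converge in \<open>L\<^sup>1\<close> near the support of the test function, and
  almost everywhere along a subsequence. The limit of \<open>F\<close> needs only its Lipschitz continuity;
  for the factor \<open>F'\<close>, bounded and continuous, pointwise convergence is used.
\<close>

theorem has_weak_gradient_chain:
  fixes F F' :: "real \<Rightarrow> real"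
  assumes u: "has_weak_gradient u g \<Omega>" and \<Omega>: "open \<Omega>"
    and F: "\<And>t. (F has_real_derivative F' t) (at t)"
    and F'c: "continuous_on UNIV F'" and F'b: "\<And>t. \<bar>F' t\<bar> \<le> 1"
  shows "has_weak_gradient (\<lambda>x. F (u x)) (\<lambda>x. F' (u x) *\<^sub>R g x) \<Omega>"
proof -
  note L = has_weak_gradient_Lp_loc[OF u]
  have Fc: "continuous_on UNIV F"
    using F by (meson DERIV_isCont continuous_at_imp_continuous_on)
  have [measurable]: "F \<in> borel_measurable borel" "F' \<in> borel_measurable borel"
    using Fc F'c by (auto intro: borel_measurable_continuous_onI)
  have Lip: "\<bar>F s - F t\<bar> \<le> \<bar>s - t\<bar>" for s t
    using field_differentiable_bound[of UNIV F F' 1 s t] F F'b by (auto simp: has_field_derivative_at_within)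
  have um [measurable]: "u \<in> borel_measurable (lebesgue_on \<Omega>)" and gm [measurable]: "g \<in> borel_measurable (lebesgue_on \<Omega>)"
    using L by (simp_all add: Lp_loc_measurable)
  have FuL: "(\<lambda>x. F (u x)) \<in> Lp_loc 1 \<Omega>"
  proof (rule Lp_loc_bound[OF _ _ L(1) Lp_loc_const[of "F 0"]])
    show "norm (F (u x)) \<le> norm (u x) + norm (F 0)" for x
      using Lip[of "u x" 0] by simp
  qed measurable
  have GL: "(\<lambda>x. F' (u x) *\<^sub>R g x) \<in> Lp_loc 1 \<Omega>"
  proof (rule Lp_loc_bound[OF _ _ L(2) L(2)])
    show "norm (F' (u x) *\<^sub>R g x) \<le> norm (g x) + norm (g x)" for x
      using mult_right_mono[OF F'b[of "u x"], of "norm (g x)"] norm_ge_zero[of "g x"]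
      unfolding norm_scaleR by linarith
  qed measurable
  have "(LINT x|lebesgue_on \<Omega>. F (u x) * partial_deriv b \<psi> x)
     = - (LINT x|lebesgue_on \<Omega>. ((F' (u x) *\<^sub>R g x) \<bullet> b) * \<psi> x)"
    if \<psi>: "\<psi> \<in> test_fun \<Omega>" and b: "b \<in> Basis" for \<psi> b
  proof -
    obtain K where \<psi>s: "smooth \<psi>" and K: "compact K" "K \<subseteq> \<Omega>" and \<psi>0: "\<And>x. x \<notin> K \<Longrightarrow> \<psi> x = 0"
      and \<psi>b0: "\<And>b x. x \<notin> K \<Longrightarrow> partial_deriv b \<psi> x = 0"
      using test_funE[OF \<psi>] by metis
    note \<psi>bt = test_fun_partial_deriv[OF \<psi> b]
    obtain B where B: "B > 0" "\<And>x. \<bar>\<psi> x\<bar> \<le> B" using test_fun_bounded[OF \<psi>] by metis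
    obtain B' where B': "B' > 0" "\<And>x. \<bar>partial_deriv b \<psi> x\<bar> \<le> B'" using test_fun_bounded[OF \<psi>bt] by metis
    have \<psi>m [measurable]: "\<psi> \<in> borel_measurable borel" "partial_deriv b \<psi> \<in> borel_measurable borel"
      by (intro smooth_borel_measurable test_fun_smooth[OF \<psi>] test_fun_smooth[OF \<psi>bt])+
    have \<psi>mL [measurable]: "\<psi> \<in> borel_measurable lebesgue" "partial_deriv b \<psi> \<in> borel_measurable lebesgue"
      by (intro borel_imp_lebesgue_measurable \<psi>m)+
    obtain d K' where d: "d > 0" and K': "compact K'" "K' \<subseteq> \<Omega>" "\<And>x. x \<in> K \<Longrightarrow> cball x d \<subseteq> K'"
      using compact_neighbourhood[OF K(1) \<Omega> K(2)] by metis
    have KK': "x \<in> K'" if "x \<in> K" for x using K'(3)[OF that] d by auto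
    obtain \<eta> :: "nat \<Rightarrow> 'a \<Rightarrow> real" where \<eta>: "\<And>n. mollifier (d / Suc n) (\<eta> n)"
      using mollifier_sequence_exists[OF d] by metis
    define U where "U x = indicator K' x * u x" for x
    define V where "V x = indicator K' x * (g x \<bullet> b)" for x
    have UI: "integrable lebesgue U"
      using Lp_loc_1_integrable[OF L(1) K'(1,2)] by (simp add: U_def[abs_def])
    have VI: "integrable lebesgue V"
      using Lp_loc_1_integrable[OF Lp_loc_inner[OF _ L(2) b] K'(1,2)] by (simp add: V_def[abs_def])
    have U0: "U x = 0" if "x \<notin> K'" for x using that by (simp add: U_def)
    have V0: "V x = 0" if "x \<notin> K'" for x using that by (simp add: V_def)
    have [measurable]: "U \<in> borel_measurable lebesgue" "V \<in> borel_measurable lebesgue"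
      using UI VI by auto
    define f where "f n = convol U (\<eta> n)" for n
    define v where "v n = convol V (\<eta> n)" for n
    have fs: "smooth (f n)" for n
      unfolding f_def by (rule smooth_convol[OF UI mollifier_test_fun[OF \<eta>]])
    have vs: "smooth (v n)" for n
      unfolding v_def by (rule smooth_convol[OF VI mollifier_test_fun[OF \<eta>]])
    have fv: "partial_deriv b (f n) x = v n x" if "x \<in> K" for n x
    proof -
      have "d / Suc n \<le> d" using d by (simp add: divide_le_eq)
      then have m: "mollifier d (\<eta> n)" by (rule mollifier_mono[OF \<eta>])
      show ?thesis
        unfolding f_def v_def partial_deriv_convol[OF UI mollifier_test_fun[OF \<eta>] b]
        unfolding U_def[abs_def] V_def[abs_def]
        by (rule convol_weak_gradient[OF u \<Omega> K'(1,2) K'(3)[OF that] m b])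
    qed
    have fm [measurable]: "f n \<in> borel_measurable lebesgue" "v n \<in> borel_measurable lebesgue" for n
      by (intro borel_imp_lebesgue_measurable smooth_borel_measurable fs vs)+
    have fmb [measurable]: "f n \<in> borel_measurable borel" for n
      by (intro smooth_borel_measurable fs)
    note fc = smooth_continuous_on[OF fs]
    have IBP: "(LINT x|lebesgue. F (f n x) * partial_deriv b \<psi> x) = - (LINT x|lebesgue. F' (f n x) * v n x * \<psi> x)" for n
    proof -
      define h1 where "h1 x = F' (f n x) * partial_deriv b (f n) x * \<psi> x" for x
      define h2 where "h2 x = F (f n x) * partial_deriv b \<psi> x" for x
      have c1: "continuous_on UNIV h1" unfolding h1_def
        by (intro continuous_on_mult continuous_on_compose2[OF F'c fc] smooth_continuous_on smooth_partial_deriv fs b \<psi>s) simp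
      have c2: "continuous_on UNIV h2" unfolding h2_def
        by (intro continuous_on_mult continuous_on_compose2[OF Fc fc] smooth_continuous_on smooth_partial_deriv b \<psi>s) simp
      have z1: "h1 x = 0" and z2: "h2 x = 0" if "x \<notin> K" for x
        using that \<psi>0 \<psi>b0 by (simp_all add: h1_def h2_def)
      have "(LINT x|lborel. h1 x + h2 x) = 0"
      proof (rule integral_directional_derivative_eq_0[OF b _ _ _ K(1)])
        show "((\<lambda>t. F (f n (x + t *\<^sub>R b)) * \<psi> (x + t *\<^sub>R b)) has_real_derivative
           h1 (x + t *\<^sub>R b) + h2 (x + t *\<^sub>R b)) (at t)" for x t
        proof -
          note D1 = DERIV_chain2[OF F smooth_has_field_derivative_line[OF fs[of n] b, of x t]]
          note D2 = DERIV_mult[OF D1 smooth_has_field_derivative_line[OF \<psi>s b, of x t]]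
          show ?thesis by (rule DERIV_cong[OF D2]) (simp add: h1_def h2_def)
        qed
        show "continuous_on UNIV (\<lambda>x. F (f n x) * \<psi> x)"
          by (intro continuous_on_mult continuous_on_compose2[OF Fc fc] smooth_continuous_on \<psi>s) simp
        show "continuous_on UNIV (\<lambda>x. h1 x + h2 x)" by (intro continuous_on_add c1 c2)
      qed (use \<psi>0 z1 z2 in simp_all)
      moreover have "(LINT x|lborel. h1 x + h2 x) = (LINT x|lborel. h1 x) + (LINT x|lborel. h2 x)"
        by (rule Bochner_Integration.integral_add;
            rule integrable_continuous_compact_support[OF _ K(1)]; fact c1 c2 z1 z2)
      moreover have "(LINT x|lebesgue. h2 x) = (LINT x|lborel. h2 x)" "(LINT x|lebesgue. h1 x) = (LINT x|lborel. h1 x)"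
        using c1 c2 by (simp_all add: integral_completion borel_measurable_continuous_onI)
      moreover have "(LINT x|lebesgue. h1 x) = (LINT x|lebesgue. F' (f n x) * v n x * \<psi> x)"
      proof (rule Bochner_Integration.integral_cong[OF refl])
        show "h1 x = F' (f n x) * v n x * \<psi> x" for x
          by (cases "x \<in> K") (simp_all add: h1_def fv \<psi>0)
      qed
      ultimately show ?thesis unfolding h2_def by linarith
    qed
    note fU = convol_sequence_tendsto_L1[OF UI compact_imp_bounded[OF K'(1)] U0 d \<eta>, folded f_def]
    note vV = convol_sequence_tendsto_L1[OF VI compact_imp_bounded[OF K'(1)] V0 d \<eta>, folded v_def]
    obtain r :: "nat \<Rightarrow> nat" where r: "strict_mono r" and ae: "AE x in lebesgue. (\<lambda>n. f (r n) x - U x) \<longlonglongrightarrow> 0"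
      using tendsto_L1_AE_subseq[of lebesgue "\<lambda>n x. f n x - U x"] fU by (auto simp: real_norm_def)
    have UpI: "integrable lebesgue (\<lambda>x. F (U x) * partial_deriv b \<psi> x)"
    proof -
      have "integrable lebesgue (\<lambda>x. U x * partial_deriv b \<psi> x)" "integrable lebesgue (partial_deriv b \<psi>)"
        using integrable_mult_bounded[OF UI \<psi>mL(2) B'(2)] test_fun_integrable[OF \<psi>bt]
        by (simp_all add: integrable_completion)
      then have "integrable lebesgue (\<lambda>x. \<bar>U x * partial_deriv b \<psi> x\<bar> + \<bar>F 0\<bar> * \<bar>partial_deriv b \<psi> x\<bar>)"
        by (intro Bochner_Integration.integrable_add integrable_abs integrable_mult_right)
      then show ?thesis
      proof (rule Bochner_Integration.integrable_bound)
        have "\<bar>F (U x) * partial_deriv b \<psi> x\<bar> \<le> \<bar>U x * partial_deriv b \<psi> x\<bar> + \<bar>F 0\<bar> * \<bar>partial_deriv b \<psi> x\<bar>" for x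
        proof -
          have "\<bar>F (U x)\<bar> \<le> \<bar>U x\<bar> + \<bar>F 0\<bar>" using Lip[of "U x" 0] by simp
          from mult_right_mono[OF this, of "\<bar>partial_deriv b \<psi> x\<bar>"] show ?thesis by (simp add: abs_mult algebra_simps)
        qed
        then show "AE x in lebesgue. norm (F (U x) * partial_deriv b \<psi> x) \<le> norm (\<bar>U x * partial_deriv b \<psi> x\<bar> + \<bar>F 0\<bar> * \<bar>partial_deriv b \<psi> x\<bar>)"
          by (intro AE_I2) simp
      qed measurable
    qed
    have VpI: "integrable lebesgue (\<lambda>x. F' (U x) * V x * \<psi> x)"
    proof -
      have "integrable lebesgue (\<lambda>x. V x * (F' (U x) * \<psi> x))"
      proof (rule integrable_mult_bounded[OF VI])
        show "\<bar>F' (U x) * \<psi> x\<bar> \<le> 1 * B" for x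
          unfolding abs_mult using F'b B by (intro mult_mono) auto
      qed measurable
      then show ?thesis by (simp add: mult_ac)
    qed
    \<comment> \<open>The remaining convergences: \<open>y1\<close> for the left-hand side, and the splitting
        \<open>F'(f) v = F'(f) (v - V) + F'(f) V\<close>, treated in \<open>y2\<close> and \<open>y3\<close>, for the right-hand side.\<close>
    have y1: "integrable lebesgue (\<lambda>x. (F (f n x) - F (U x)) * partial_deriv b \<psi> x)"
      "(\<lambda>n. LINT x|lebesgue. (F (f n x) - F (U x)) * partial_deriv b \<psi> x) \<longlonglongrightarrow> 0" for n
    proof -
      have bd: "\<bar>(F (f n x) - F (U x)) * partial_deriv b \<psi> x\<bar> \<le> B' * \<bar>f n x - U x\<bar>" for n x
        unfolding abs_mult using mult_mono[OF Lip B'(2)] B'(1) by (simp add: mult.commute)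
      show "integrable lebesgue (\<lambda>x. (F (f n x) - F (U x)) * partial_deriv b \<psi> x)"
        "(\<lambda>n. LINT x|lebesgue. (F (f n x) - F (U x)) * partial_deriv b \<psi> x) \<longlonglongrightarrow> 0"
        by (rule tendsto_integral_0_bound[OF fU _ bd]; measurable)+
    qed
    have y2: "integrable lebesgue (\<lambda>x. F' (f n x) * (v n x - V x) * \<psi> x)"
      "(\<lambda>n. LINT x|lebesgue. F' (f n x) * (v n x - V x) * \<psi> x) \<longlonglongrightarrow> 0" for n
    proof -
      have bd: "\<bar>F' (f n x) * (v n x - V x) * \<psi> x\<bar> \<le> B * \<bar>v n x - V x\<bar>" for n x
      proof -
        have "\<bar>F' (f n x)\<bar> * \<bar>v n x - V x\<bar> * \<bar>\<psi> x\<bar> \<le> 1 * \<bar>v n x - V x\<bar> * B"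
          using F'b B by (intro mult_mono) auto
        then show ?thesis by (simp add: abs_mult mult.commute)
      qed
      show "integrable lebesgue (\<lambda>x. F' (f n x) * (v n x - V x) * \<psi> x)"
        "(\<lambda>n. LINT x|lebesgue. F' (f n x) * (v n x - V x) * \<psi> x) \<longlonglongrightarrow> 0"
        by (rule tendsto_integral_0_bound[OF vV _ bd]; measurable)+
    qed
    have y3: "(\<lambda>n. LINT x|lebesgue. F' (f (r n) x) * V x * \<psi> x) \<longlonglongrightarrow> (LINT x|lebesgue. F' (U x) * V x * \<psi> x)"
    proof (rule integral_dominated_convergence[where w = "\<lambda>x. \<bar>V x\<bar> * B"])
      show "integrable lebesgue (\<lambda>x. \<bar>V x\<bar> * B)" by (intro integrable_mult_left integrable_abs VI)
      show "AE x in lebesgue. (\<lambda>n. F' (f (r n) x) * V x * \<psi> x) \<longlonglongrightarrow> F' (U x) * V x * \<psi> x"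
        using ae
      proof eventually_elim
        case (elim x)
        have "isCont F' (U x)" using F'c by (simp add: continuous_on_eq_continuous_at)
        then have "(\<lambda>n. F' (f (r n) x)) \<longlonglongrightarrow> F' (U x)"
          by (rule isCont_tendsto_compose) (use elim LIM_zero_iff in blast)
        then show ?case by (intro tendsto_mult tendsto_const)
      qed
      show "AE x in lebesgue. norm (F' (f (r n) x) * V x * \<psi> x) \<le> \<bar>V x\<bar> * B" for n
      proof (rule AE_I2)
        fix x
        have "\<bar>F' (f (r n) x)\<bar> * \<bar>V x\<bar> * \<bar>\<psi> x\<bar> \<le> 1 * \<bar>V x\<bar> * B"
          using F'b B by (intro mult_mono) auto
        then show "norm (F' (f (r n) x) * V x * \<psi> x) \<le> \<bar>V x\<bar> * B" by (simp add: abs_mult)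
      qed
    qed measurable
    have y3I: "integrable lebesgue (\<lambda>x. F' (f n x) * V x * \<psi> x)" for n
    proof -
      have "integrable lebesgue (\<lambda>x. V x * (F' (f n x) * \<psi> x))"
      proof (rule integrable_mult_bounded[OF VI])
        show "\<bar>F' (f n x) * \<psi> x\<bar> \<le> 1 * B" for x
          unfolding abs_mult using F'b B by (intro mult_mono) auto
      qed measurable
      then show ?thesis by (simp add: mult_ac)
    qed
    have "(\<lambda>n. (LINT x|lebesgue. (F (f (r n) x) - F (U x)) * partial_deriv b \<psi> x)
        + (LINT x|lebesgue. F (U x) * partial_deriv b \<psi> x)) \<longlonglongrightarrow> 0 + (LINT x|lebesgue. F (U x) * partial_deriv b \<psi> x)"
      by (intro tendsto_add tendsto_const LIMSEQ_subseq_LIMSEQ[OF y1(2) r, unfolded comp_def])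
    moreover have "(LINT x|lebesgue. (F (f n x) - F (U x)) * partial_deriv b \<psi> x)
        + (LINT x|lebesgue. F (U x) * partial_deriv b \<psi> x) = (LINT x|lebesgue. F (f n x) * partial_deriv b \<psi> x)" for n
      by (subst Bochner_Integration.integral_add[OF y1(1) UpI, symmetric]) (simp add: algebra_simps)
    ultimately have lim1: "(\<lambda>n. LINT x|lebesgue. F (f (r n) x) * partial_deriv b \<psi> x) \<longlonglongrightarrow> (LINT x|lebesgue. F (U x) * partial_deriv b \<psi> x)"
      by simp
    have "(\<lambda>n. - ((LINT x|lebesgue. F' (f (r n) x) * (v (r n) x - V x) * \<psi> x)
        + (LINT x|lebesgue. F' (f (r n) x) * V x * \<psi> x))) \<longlonglongrightarrow> - (0 + (LINT x|lebesgue. F' (U x) * V x * \<psi> x))"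
      by (intro tendsto_minus tendsto_add y3 LIMSEQ_subseq_LIMSEQ[OF y2(2) r, unfolded comp_def])
    moreover have "(LINT x|lebesgue. F' (f n x) * (v n x - V x) * \<psi> x) + (LINT x|lebesgue. F' (f n x) * V x * \<psi> x)
        = (LINT x|lebesgue. F' (f n x) * v n x * \<psi> x)" for n
      by (subst Bochner_Integration.integral_add[OF y2(1) y3I, symmetric]) (simp add: algebra_simps)
    ultimately have lim2: "(\<lambda>n. LINT x|lebesgue. F (f (r n) x) * partial_deriv b \<psi> x) \<longlonglongrightarrow> - (LINT x|lebesgue. F' (U x) * V x * \<psi> x)"
      unfolding IBP by simp
    have eq: "(LINT x|lebesgue. F (U x) * partial_deriv b \<psi> x) = - (LINT x|lebesgue. F' (U x) * V x * \<psi> x)"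
      by (rule LIMSEQ_unique[OF lim1 lim2])
    have "(LINT x|lebesgue_on \<Omega>. F (u x) * partial_deriv b \<psi> x) = (LINT x|lebesgue. F (U x) * partial_deriv b \<psi> x)"
    proof (rule trans[OF test_product_integral(2)[OF FuL \<Omega> K \<psi>b0 \<psi>bt]],
        assumption, rule Bochner_Integration.integral_cong[OF refl])
      show "indicator K x * F (u x) * partial_deriv b \<psi> x = F (U x) * partial_deriv b \<psi> x" for x
        by (cases "x \<in> K") (simp_all add: \<psi>b0 U_def KK')
    qed
    moreover have "(LINT x|lebesgue_on \<Omega>. ((F' (u x) *\<^sub>R g x) \<bullet> b) * \<psi> x) = (LINT x|lebesgue. F' (U x) * V x * \<psi> x)"
    proof (rule trans[OF test_product_integral(2)[OF Lp_loc_inner[OF order_refl GL b] \<Omega> K \<psi>0 \<psi>]],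
        assumption, rule Bochner_Integration.integral_cong[OF refl])
      show "indicator K x * ((F' (u x) *\<^sub>R g x) \<bullet> b) * \<psi> x = F' (U x) * V x * \<psi> x" for x
        by (cases "x \<in> K") (simp_all add: \<psi>0 U_def V_def KK')
    qed
    ultimately show ?thesis using eq by simp
  qed
  with FuL GL show ?thesis unfolding has_weak_gradient_def by blast
qed

subsection \<open>Truncation\<close>

text \<open>
  A passage to the limit that reaches functions \<open>G\<close> that are not differentiable, and derivatives \<open>G'\<close> that
  are not continuous. The constant \<open>2\<close> leaves room for the approximations used below.
\<close>

lemma has_weak_gradient_chain_limit:
  fixes F F' :: "nat \<Rightarrow> real \<Rightarrow> real"
  assumes u: "has_weak_gradient u g \<Omega>" and \<Omega>: "open \<Omega>"
    and k: "\<And>k. has_weak_gradient (\<lambda>x. F k (u x)) (\<lambda>x. F' k (u x) *\<^sub>R g x) \<Omega>"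
    and bd: "\<And>k t. \<bar>F k t\<bar> \<le> \<bar>t\<bar> + 2" "\<And>k t. \<bar>F' k t\<bar> \<le> 1"
    and lim: "\<And>t. (\<lambda>k. F k t) \<longlonglongrightarrow> G t" "\<And>t. (\<lambda>k. F' k t) \<longlonglongrightarrow> G' t"
  shows "has_weak_gradient (\<lambda>x. G (u x)) (\<lambda>x. G' (u x) *\<^sub>R g x) \<Omega>"
proof -
  note L = has_weak_gradient_Lp_loc[OF u]
  note Lk = has_weak_gradient_Lp_loc[OF k]
  have Gb: "\<bar>G t\<bar> \<le> \<bar>t\<bar> + 2" for t
    by (rule LIMSEQ_le_const2[OF tendsto_rabs[OF lim(1)]]) (use bd in auto)
  have G'b: "\<bar>G' t\<bar> \<le> 1" for t
    by (rule LIMSEQ_le_const2[OF tendsto_rabs[OF lim(2)]]) (use bd in auto)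
  have GL: "(\<lambda>x. G (u x)) \<in> Lp_loc 1 \<Omega>"
  proof (rule Lp_loc_bound[OF order_refl _ L(1) Lp_loc_const[of "2::real"]])
    show "(\<lambda>x. G (u x)) \<in> borel_measurable (lebesgue_on \<Omega>)"
      by (rule borel_measurable_LIMSEQ_metric[OF Lp_loc_measurable[OF Lk(1)]]) (rule lim)
    show "norm (G (u x)) \<le> norm (u x) + norm (2::real)" for x using Gb by simp
  qed
  have G'L: "(\<lambda>x. G' (u x) *\<^sub>R g x) \<in> Lp_loc 1 \<Omega>"
  proof (rule Lp_loc_bound[OF order_refl _ L(2) L(2)])
    show "(\<lambda>x. G' (u x) *\<^sub>R g x) \<in> borel_measurable (lebesgue_on \<Omega>)"
      by (rule borel_measurable_LIMSEQ_metric[OF Lp_loc_measurable[OF Lk(2)]])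
         (rule tendsto_scaleR[OF lim(2) tendsto_const])
    show "norm (G' (u x) *\<^sub>R g x) \<le> norm (g x) + norm (g x)" for x
      using mult_right_mono[OF G'b[of "u x"], of "norm (g x)"] norm_ge_zero[of "g x"]
      unfolding norm_scaleR by linarith
  qed
  have "(LINT x|lebesgue_on \<Omega>. G (u x) * partial_deriv b \<psi> x)
      = - (LINT x|lebesgue_on \<Omega>. ((G' (u x) *\<^sub>R g x) \<bullet> b) * \<psi> x)"
    if \<psi>: "\<psi> \<in> test_fun \<Omega>" and b: "b \<in> Basis" for \<psi> b
  proof -
    note \<psi>b = test_fun_partial_deriv[OF \<psi> b]
    have gb: "(\<lambda>x. g x \<bullet> b) \<in> Lp_loc 1 \<Omega>" by (rule Lp_loc_inner[OF _ L(2) b]) simp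
    have 1: "(\<lambda>k. LINT x|lebesgue_on \<Omega>. F k (u x) * partial_deriv b \<psi> x) \<longlonglongrightarrow> (LINT x|lebesgue_on \<Omega>. G (u x) * partial_deriv b \<psi> x)"
    proof (rule integral_dominated_convergence[where w = "\<lambda>x. \<bar>u x * partial_deriv b \<psi> x\<bar> + 2 * \<bar>1 * partial_deriv b \<psi> x\<bar>"])
      show "(\<lambda>x. G (u x) * partial_deriv b \<psi> x) \<in> borel_measurable (lebesgue_on \<Omega>)"
        by (rule borel_measurable_integrable[OF test_product_integrable[OF GL \<Omega> \<psi>b]])
      show "(\<lambda>x. F k (u x) * partial_deriv b \<psi> x) \<in> borel_measurable (lebesgue_on \<Omega>)" for k
        by (rule borel_measurable_integrable[OF test_product_integrable[OF Lk(1) \<Omega> \<psi>b]])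
      show "integrable (lebesgue_on \<Omega>) (\<lambda>x. \<bar>u x * partial_deriv b \<psi> x\<bar> + 2 * \<bar>1 * partial_deriv b \<psi> x\<bar>)"
        by (intro Bochner_Integration.integrable_add integrable_mult_right integrable_abs
              test_product_integrable[OF _ \<Omega> \<psi>b] L(1) Lp_loc_const)
      show "AE x in lebesgue_on \<Omega>. (\<lambda>k. F k (u x) * partial_deriv b \<psi> x) \<longlonglongrightarrow> G (u x) * partial_deriv b \<psi> x"
        by (intro AE_I2 tendsto_mult tendsto_const lim)
      show "AE x in lebesgue_on \<Omega>. norm (F k (u x) * partial_deriv b \<psi> x) \<le> \<bar>u x * partial_deriv b \<psi> x\<bar> + 2 * \<bar>1 * partial_deriv b \<psi> x\<bar>" for k
      proof (rule AE_I2)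
        fix x
        show "norm (F k (u x) * partial_deriv b \<psi> x) \<le> \<bar>u x * partial_deriv b \<psi> x\<bar> + 2 * \<bar>1 * partial_deriv b \<psi> x\<bar>"
          using mult_right_mono[OF bd(1)[of k "u x"], of "\<bar>partial_deriv b \<psi> x\<bar>"]
          by (simp add: abs_mult algebra_simps)
      qed
    qed
    have 2: "(\<lambda>k. LINT x|lebesgue_on \<Omega>. ((F' k (u x) *\<^sub>R g x) \<bullet> b) * \<psi> x) \<longlonglongrightarrow> (LINT x|lebesgue_on \<Omega>. ((G' (u x) *\<^sub>R g x) \<bullet> b) * \<psi> x)"
    proof (rule integral_dominated_convergence[where w = "\<lambda>x. \<bar>(g x \<bullet> b) * \<psi> x\<bar>"])
      show "(\<lambda>x. ((G' (u x) *\<^sub>R g x) \<bullet> b) * \<psi> x) \<in> borel_measurable (lebesgue_on \<Omega>)"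
        by (rule borel_measurable_integrable[OF test_product_integrable[OF Lp_loc_inner[OF order_refl G'L b] \<Omega> \<psi>]])
      show "(\<lambda>x. ((F' k (u x) *\<^sub>R g x) \<bullet> b) * \<psi> x) \<in> borel_measurable (lebesgue_on \<Omega>)" for k
        by (rule borel_measurable_integrable[OF test_product_integrable[OF Lp_loc_inner[OF order_refl Lk(2) b] \<Omega> \<psi>]])
      show "integrable (lebesgue_on \<Omega>) (\<lambda>x. \<bar>(g x \<bullet> b) * \<psi> x\<bar>)"
        by (intro integrable_abs test_product_integrable[OF gb \<Omega> \<psi>])
      show "AE x in lebesgue_on \<Omega>. (\<lambda>k. ((F' k (u x) *\<^sub>R g x) \<bullet> b) * \<psi> x) \<longlonglongrightarrow> ((G' (u x) *\<^sub>R g x) \<bullet> b) * \<psi> x"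
        by (intro AE_I2 tendsto_intros lim)
      show "AE x in lebesgue_on \<Omega>. norm (((F' k (u x) *\<^sub>R g x) \<bullet> b) * \<psi> x) \<le> \<bar>(g x \<bullet> b) * \<psi> x\<bar>" for k
      proof (rule AE_I2)
        fix x
        show "norm (((F' k (u x) *\<^sub>R g x) \<bullet> b) * \<psi> x) \<le> \<bar>(g x \<bullet> b) * \<psi> x\<bar>"
          using mult_right_mono[OF bd(2)[of k "u x"], of "\<bar>(g x \<bullet> b) * \<psi> x\<bar>"]
          by (simp add: abs_mult mult.assoc)
      qed
    qed
    have "(LINT x|lebesgue_on \<Omega>. F k (u x) * partial_deriv b \<psi> x)
      = - (LINT x|lebesgue_on \<Omega>. ((F' k (u x) *\<^sub>R g x) \<bullet> b) * \<psi> x)" for k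
      by (rule has_weak_gradientD[OF k \<psi> b])
    then have "(\<lambda>k. LINT x|lebesgue_on \<Omega>. F k (u x) * partial_deriv b \<psi> x)
       \<longlonglongrightarrow> - (LINT x|lebesgue_on \<Omega>. ((G' (u x) *\<^sub>R g x) \<bullet> b) * \<psi> x)"
      using tendsto_minus[OF 2] by simp
    then show ?thesis by (rule LIMSEQ_unique[OF 1])
  qed
  with GL G'L show ?thesis unfolding has_weak_gradient_def by blast
qed

text \<open>
  These functions tend to \<open>0\<close> uniformly, but their derivatives converge to the indicator function of the
  point \<open>0\<close>. They detect the gradient on a zero set.
\<close>

definition arctan_scaled :: "nat \<Rightarrow> real \<Rightarrow> real" where
  "arctan_scaled k t = arctan (real (Suc k) * t) / real (Suc k)"

definition arctan_scaled_deriv :: "nat \<Rightarrow> real \<Rightarrow> real" where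
  "arctan_scaled_deriv k t = 1 / (1 + (real (Suc k) * t)\<^sup>2)"

text \<open>
  Smooth approximations of the absolute value.
\<close>

definition sqrt_smooth :: "nat \<Rightarrow> real \<Rightarrow> real" where
  "sqrt_smooth k t = sqrt (t\<^sup>2 + (1 / Suc k)\<^sup>2)"

definition sqrt_smooth_deriv :: "nat \<Rightarrow> real \<Rightarrow> real" where
  "sqrt_smooth_deriv k t = t / sqrt (t\<^sup>2 + (1 / Suc k)\<^sup>2)"

lemma LIMSEQ_1_over_Suc: "(\<lambda>k. 1 / real (Suc k)) \<longlonglongrightarrow> 0"
  using LIMSEQ_inverse_real_of_nat by (simp add: inverse_eq_divide)

lemma arctan_scaled:
  "(arctan_scaled k has_real_derivative arctan_scaled_deriv k t) (at t)"
  "continuous_on UNIV (arctan_scaled_deriv k)"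
  "0 \<le> arctan_scaled_deriv k t" "arctan_scaled_deriv k t \<le> 1"
  "\<bar>arctan_scaled k t\<bar> \<le> 2"
  "(\<lambda>k. arctan_scaled k t) \<longlonglongrightarrow> 0"
  "(\<lambda>k. arctan_scaled_deriv k t) \<longlonglongrightarrow> (if t = 0 then 1 else 0)"
proof -
  have pos: "1 + (real (Suc k) * t)\<^sup>2 > 0" for k t by (smt (verit) zero_le_power2)
  show "(arctan_scaled k has_real_derivative arctan_scaled_deriv k t) (at t)"
    unfolding arctan_scaled_def[abs_def] arctan_scaled_deriv_def
    by (auto intro!: derivative_eq_intros simp: inverse_eq_divide)
  show "continuous_on UNIV (arctan_scaled_deriv k)"
    unfolding arctan_scaled_deriv_def[abs_def] using pos[of k]
    by (intro continuous_intros) (metis less_irrefl)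
  show "0 \<le> arctan_scaled_deriv k t" "arctan_scaled_deriv k t \<le> 1"
    using pos[of k t] by (simp_all add: arctan_scaled_deriv_def divide_le_eq)
  have ab: "\<bar>arctan s\<bar> \<le> 2" for s
    using arctan_bounded[of s] pi_less_4 by linarith
  have b: "\<bar>arctan_scaled k t\<bar> \<le> 2 * (1 / Suc k)" for k
    using divide_right_mono[OF ab[of "real (Suc k) * t"], of "real (Suc k)"] by (simp add: arctan_scaled_def abs_divide)
  have "2 * (1 / real (Suc k)) \<le> 2" by (simp add: divide_le_eq)
  with b[of k] show "\<bar>arctan_scaled k t\<bar> \<le> 2" by linarith
  show "(\<lambda>k. arctan_scaled k t) \<longlonglongrightarrow> 0"
  proof (rule Lim_null_comparison)
    show "\<forall>\<^sub>F k in sequentially. norm (arctan_scaled k t) \<le> 2 * (1 / real (Suc k))" using b by simp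
    show "(\<lambda>k. 2 * (1 / real (Suc k))) \<longlonglongrightarrow> 0"
      by (rule tendsto_mult_right_zero[OF LIMSEQ_1_over_Suc])
  qed
  show "(\<lambda>k. arctan_scaled_deriv k t) \<longlonglongrightarrow> (if t = 0 then 1 else 0)"
  proof (cases "t = 0")
    case False
    have "(\<lambda>k. (1 / Suc k)\<^sup>2 / t\<^sup>2) \<longlonglongrightarrow> 0\<^sup>2 / t\<^sup>2"
      using False by (intro tendsto_intros LIMSEQ_1_over_Suc) simp
    then have "(\<lambda>k. (1 / Suc k)\<^sup>2 / t\<^sup>2) \<longlonglongrightarrow> 0" by simp
    moreover have "norm (arctan_scaled_deriv k t) \<le> (1 / Suc k)\<^sup>2 / t\<^sup>2" for k
    proof -
      have "1 / (1 + (real (Suc k) * t)\<^sup>2) \<le> 1 / (real (Suc k) * t)\<^sup>2"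
        using False by (intro divide_left_mono mult_pos_pos pos) auto
      then show ?thesis using pos[of k t] by (simp add: arctan_scaled_deriv_def power_mult_distrib power_divide)
    qed
    ultimately show ?thesis
      using False Lim_null_comparison[of "\<lambda>k. arctan_scaled_deriv k t" "\<lambda>k. (1 / Suc k)\<^sup>2 / t\<^sup>2" sequentially]
      by simp
  qed (simp add: arctan_scaled_deriv_def)
qed

lemma sqrt_smooth:
  "(sqrt_smooth k has_real_derivative sqrt_smooth_deriv k t) (at t)"
  "continuous_on UNIV (sqrt_smooth_deriv k)"
  "\<bar>sqrt_smooth_deriv k t\<bar> \<le> 1"
  "0 \<le> sqrt_smooth k t" "sqrt_smooth k t \<le> \<bar>t\<bar> + 1"
  "(\<lambda>k. sqrt_smooth k t) \<longlonglongrightarrow> \<bar>t\<bar>"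
  "(\<lambda>k. sqrt_smooth_deriv k t) \<longlonglongrightarrow> sgn t"
proof -
  have pos: "t\<^sup>2 + (1 / Suc k)\<^sup>2 > 0" for k t
    by (intro add_nonneg_pos) auto
  show "(sqrt_smooth k has_real_derivative sqrt_smooth_deriv k t) (at t)"
    unfolding sqrt_smooth_def[abs_def] sqrt_smooth_deriv_def
    using pos[of t k] by (auto intro!: derivative_eq_intros simp: field_simps)
  show "continuous_on UNIV (sqrt_smooth_deriv k)"
    unfolding sqrt_smooth_deriv_def[abs_def] using pos[of _ k]
    by (intro continuous_intros) (metis less_irrefl real_sqrt_eq_zero_cancel_iff)
  have "\<bar>t\<bar> = sqrt (t\<^sup>2)" by simp
  also have "\<dots> \<le> sqrt (t\<^sup>2 + (1 / Suc k)\<^sup>2)" by (rule real_sqrt_le_mono) simp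
  finally show "\<bar>sqrt_smooth_deriv k t\<bar> \<le> 1"
    using pos[of t k] by (simp add: sqrt_smooth_deriv_def abs_divide divide_le_eq)
  show "0 \<le> sqrt_smooth k t" by (simp add: sqrt_smooth_def)
  have "sqrt_smooth k t \<le> \<bar>t\<bar> + 1 / Suc k"
    unfolding sqrt_smooth_def by (rule real_le_lsqrt) (auto simp: power2_sum)
  also have "\<dots> \<le> \<bar>t\<bar> + 1" by simp
  finally show "sqrt_smooth k t \<le> \<bar>t\<bar> + 1" .
  have lim: "(\<lambda>k. sqrt (t\<^sup>2 + (1 / Suc k)\<^sup>2)) \<longlonglongrightarrow> sqrt (t\<^sup>2 + 0\<^sup>2)"
    by (intro tendsto_intros LIMSEQ_1_over_Suc)
  then show "(\<lambda>k. sqrt_smooth k t) \<longlonglongrightarrow> \<bar>t\<bar>" by (simp add: sqrt_smooth_def)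
  show "(\<lambda>k. sqrt_smooth_deriv k t) \<longlonglongrightarrow> sgn t"
  proof (cases "t = 0")
    case False
    have "(\<lambda>k. t / sqrt (t\<^sup>2 + (1 / Suc k)\<^sup>2)) \<longlonglongrightarrow> t / sqrt (t\<^sup>2 + 0\<^sup>2)"
      by (intro tendsto_divide tendsto_const lim) (use False in simp)
    moreover have "t / sqrt (t\<^sup>2 + 0\<^sup>2) = sgn t" by (simp add: real_sgn_eq)
    ultimately show ?thesis by (simp add: sqrt_smooth_deriv_def)
  qed (simp add: sqrt_smooth_deriv_def)
qed

lemma has_weak_gradient_zero:
  assumes "has_weak_gradient u g \<Omega>" "open \<Omega>"
  shows "has_weak_gradient (\<lambda>x. 0) (\<lambda>x. 0) \<Omega>"
  using has_weak_gradient_linear[OF assms(1,1,2), of 0 0] by simp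

text \<open>
  The functions \<open>arctan (k u) / k\<close> converge to \<open>0\<close>, while their gradients converge to the gradient of \<open>u\<close> on
  the zero set of \<open>u\<close> and to \<open>0\<close> elsewhere. So this limit is a weak gradient of the zero function, and
  it vanishes by uniqueness.
\<close>

theorem weak_gradient_eq_0_on_zero_set:
  assumes u: "has_weak_gradient u g \<Omega>" and \<Omega>: "open \<Omega>"
  shows "AE x in lebesgue_on \<Omega>. u x = 0 \<longrightarrow> g x = 0"
proof -
  have "has_weak_gradient (\<lambda>x. 0) (\<lambda>x. (if u x = 0 then 1 else 0) *\<^sub>R g x) \<Omega>"
  proof (rule has_weak_gradient_chain_limit[OF u \<Omega>,
        where F = arctan_scaled and F' = arctan_scaled_deriv and G = "\<lambda>t. 0" and G' = "\<lambda>t. if t = 0 then 1 else 0"])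
    show "\<bar>arctan_scaled_deriv k t\<bar> \<le> 1" for k t
      using arctan_scaled(3,4)[of k t] by simp
    then show "has_weak_gradient (\<lambda>x. arctan_scaled k (u x)) (\<lambda>x. arctan_scaled_deriv k (u x) *\<^sub>R g x) \<Omega>" for k
      by (intro has_weak_gradient_chain[OF u \<Omega>] arctan_scaled)
    show "\<bar>arctan_scaled k t\<bar> \<le> \<bar>t\<bar> + 2" for k t
      using arctan_scaled(5)[of k t] by simp
  qed (rule arctan_scaled)+
  from weak_gradient_unique[OF this has_weak_gradient_zero[OF u \<Omega>] \<Omega>]
  show ?thesis by eventually_elim auto
qed

text \<open>
  The approximation is \<open>(t + sqrt (t\<^sup>2 + \<delta>\<^sup>2) - \<delta> arctan (t / \<delta>)) / 2\<close> with \<open>\<delta> = 1 / (k + 1)\<close>. Without the last term the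
  derivatives would tend to \<open>1/2\<close> at \<open>t = 0\<close>; with it they tend to the indicator function of
  \<open>t > 0\<close> everywhere.
\<close>

theorem has_weak_gradient_pos_part:
  assumes u: "has_weak_gradient u g \<Omega>" and \<Omega>: "open \<Omega>"
  shows "has_weak_gradient (\<lambda>x. max (u x) 0) (\<lambda>x. if 0 < u x then g x else 0) \<Omega>"
proof -
  define F where "F k t = (t + sqrt_smooth k t - arctan_scaled k t) / 2" for k t
  define F' where "F' k t = (1 + sqrt_smooth_deriv k t - arctan_scaled_deriv k t) / 2" for k t
  have F'b: "\<bar>F' k t\<bar> \<le> 1" for k t
    using sqrt_smooth(3)[of k t] arctan_scaled(3,4)[of k t] unfolding F'_def abs_le_iff
    by (simp add: divide_le_eq le_divide_eq)
  have "has_weak_gradient (\<lambda>x. max (u x) 0) (\<lambda>x. (if 0 < u x then 1 else 0) *\<^sub>R g x) \<Omega>"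
  proof (rule has_weak_gradient_chain_limit[OF u \<Omega>,
        where F = F and F' = F' and G = "\<lambda>t. max t 0" and G' = "\<lambda>t. if 0 < t then 1 else 0"])
    show "has_weak_gradient (\<lambda>x. F k (u x)) (\<lambda>x. F' k (u x) *\<^sub>R g x) \<Omega>" for k
    proof (rule has_weak_gradient_chain[OF u \<Omega> _ _ F'b])
      show "(F k has_real_derivative F' k t) (at t)" for t
        unfolding F_def[abs_def] F'_def
        by (intro DERIV_cdivide DERIV_diff DERIV_add DERIV_ident sqrt_smooth arctan_scaled)
      show "continuous_on UNIV (F' k)"
        unfolding F'_def[abs_def]
        by (intro continuous_on_divide continuous_on_diff continuous_on_add continuous_on_const sqrt_smooth arctan_scaled) simp
    qed
    show "\<bar>F k t\<bar> \<le> \<bar>t\<bar> + 2" for k t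
    proof -
      have "\<bar>t + sqrt_smooth k t - arctan_scaled k t\<bar> \<le> \<bar>t\<bar> + \<bar>sqrt_smooth k t\<bar> + \<bar>arctan_scaled k t\<bar>"
        by linarith
      also have "\<dots> \<le> \<bar>t\<bar> + (\<bar>t\<bar> + 1) + 2"
        using sqrt_smooth(4,5)[of k t] arctan_scaled(5)[of k t] by (intro add_mono) simp_all
      finally show ?thesis by (simp add: F_def)
    qed
    show "\<bar>F' k t\<bar> \<le> 1" for k t by (rule F'b)
    show "(\<lambda>k. F k t) \<longlonglongrightarrow> max t 0" for t
    proof -
      have "(\<lambda>k. F k t) \<longlonglongrightarrow> (t + \<bar>t\<bar> - 0) / 2"
        unfolding F_def by (intro tendsto_intros sqrt_smooth arctan_scaled) simp
      moreover have "(t + \<bar>t\<bar> - 0) / 2 = max t 0" by (simp add: max_def)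
      ultimately show ?thesis by simp
    qed
    show "(\<lambda>k. F' k t) \<longlonglongrightarrow> (if 0 < t then 1 else 0)" for t
    proof -
      have "(\<lambda>k. F' k t) \<longlonglongrightarrow> (1 + sgn t - (if t = 0 then 1 else 0)) / 2"
        unfolding F'_def by (intro tendsto_intros sqrt_smooth arctan_scaled) simp
      moreover have "(1 + sgn t - (if t = 0 then 1 else 0)) / 2 = (if 0 < t then 1 else 0)"
        by (simp add: sgn_if)
      ultimately show ?thesis by simp
    qed
  qed
  moreover have "(\<lambda>x. (if 0 < u x then 1 else 0) *\<^sub>R g x) = (\<lambda>x. if 0 < u x then g x else 0)" by auto
  ultimately show ?thesis by simp
qed

corollary has_weak_gradient_min:
  assumes u: "has_weak_gradient u g \<Omega>" and v: "has_weak_gradient v h \<Omega>" and \<Omega>: "open \<Omega>"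
  shows "has_weak_gradient (\<lambda>x. min (u x) (v x)) (\<lambda>x. if u x \<le> v x then g x else h x) \<Omega>"
proof -
  have "has_weak_gradient (\<lambda>x. u x - max (u x - v x) 0)
      (\<lambda>x. g x - (if 0 < u x - v x then g x - h x else 0)) \<Omega>"
    by (intro has_weak_gradient_diff has_weak_gradient_pos_part assms)
  moreover have "(\<lambda>x. u x - max (u x - v x) 0) = (\<lambda>x. min (u x) (v x))" by (auto simp: min_def max_def)
  moreover have "(\<lambda>x. g x - (if 0 < u x - v x then g x - h x else 0)) = (\<lambda>x. if u x \<le> v x then g x else h x)"
    by auto
  ultimately show ?thesis by simp
qed

subsection \<open>Gradients of test functions\<close>

definition gradient :: "('a::euclidean_space \<Rightarrow> real) \<Rightarrow> 'a \<Rightarrow> 'a" where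
  "gradient \<psi> x = (\<Sum>b\<in>Basis. partial_deriv b \<psi> x *\<^sub>R b)"

lemma gradient_inner: "b \<in> Basis \<Longrightarrow> gradient \<psi> x \<bullet> b = partial_deriv b \<psi> x"
  by (simp add: gradient_def)

lemma continuous_compact_support_Lp:
  fixes f :: "'a::euclidean_space \<Rightarrow> 'b::euclidean_space"
  assumes "p > 0" and f: "continuous_on UNIV f" and K: "compact K" "\<And>x. x \<notin> K \<Longrightarrow> f x = 0"
    and S: "S \<in> sets lebesgue"
  shows "f \<in> Lp p S"
proof -
  have c: "continuous_on UNIV (\<lambda>x. norm (f x) powr p)"
    using assms(1) by (intro continuous_on_powr' continuous_on_norm f continuous_on_const) auto
  have "integrable lborel (\<lambda>x. norm (f x) powr p)"
    by (rule integrable_continuous_compact_support[OF c K(1)]) (simp add: K(2))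
  then have "integrable lebesgue (\<lambda>x. norm (f x) powr p)"
    by (simp add: integrable_completion borel_measurable_continuous_onI[OF c])
  then have "integrable lebesgue (\<lambda>x. indicator S x *\<^sub>R norm (f x) powr p)"
    by (rule integrable_mult_indicator[OF S])
  then have "integrable (lebesgue_on S) (\<lambda>x. norm (f x) powr p)"
    using S by (simp only: integrable_restrict_space sets.Int_space_eq2)
  moreover have "f \<in> borel_measurable (lebesgue_on S)"
    by (intro measurable_restrict_space1 borel_imp_lebesgue_measurable borel_measurable_continuous_onI f)
  ultimately show ?thesis by (simp add: Lp_def)
qed

lemma test_fun_Lp:
  assumes "p > 0" "\<psi> \<in> test_fun \<Omega>" "S \<in> sets lebesgue"
  shows "\<psi> \<in> Lp p S" "gradient \<psi> \<in> Lp p S"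
proof -
  obtain K where K: "smooth \<psi>" "compact K" "\<And>x. x \<notin> K \<Longrightarrow> \<psi> x = 0"
    "\<And>b x. x \<notin> K \<Longrightarrow> partial_deriv b \<psi> x = 0"
    using test_funE[OF assms(2)] by metis
  show "\<psi> \<in> Lp p S"
    by (rule continuous_compact_support_Lp[OF assms(1) smooth_continuous_on[OF K(1)] K(2,3) assms(3)])
  have "continuous_on UNIV (gradient \<psi>)"
    unfolding gradient_def[abs_def]
    by (intro continuous_on_sum continuous_on_scaleR smooth_continuous_on smooth_partial_deriv K(1) continuous_on_const)
  then show "gradient \<psi> \<in> Lp p S"
    by (rule continuous_compact_support_Lp[OF assms(1) _ K(2) _ assms(3)]) (simp add: gradient_def K(4))
qed

lemma test_fun_has_weak_gradient:
  assumes \<psi>: "\<psi> \<in> test_fun \<Omega>" and \<Omega>: "open \<Omega>"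
  shows "has_weak_gradient \<psi> (gradient \<psi>) \<Omega>"
proof -
  have "\<psi> \<in> Lp_loc 1 \<Omega>" "gradient \<psi> \<in> Lp_loc 1 \<Omega>"
    using test_fun_Lp[OF zero_less_one \<psi> open_sets_lebesgue[OF \<Omega>]] by (intro Lp_imp_Lp_loc \<Omega>; simp)+
  moreover have "(LINT x|lebesgue_on \<Omega>. \<psi> x * partial_deriv b \<theta> x) = - (LINT x|lebesgue_on \<Omega>. (gradient \<psi> x \<bullet> b) * \<theta> x)"
    if \<theta>: "\<theta> \<in> test_fun \<Omega>" and b: "b \<in> Basis" for \<theta> b
  proof -
    obtain K where K: "smooth \<theta>" "compact K" "K \<subseteq> \<Omega>" "\<And>x. x \<notin> K \<Longrightarrow> \<theta> x = 0"
      "\<And>b x. x \<notin> K \<Longrightarrow> partial_deriv b \<theta> x = 0"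
      using test_funE[OF \<theta>] by metis
    note sm = test_fun_smooth[OF \<psi>] K(1)
    note sb = smooth_partial_deriv[OF sm(1) b] smooth_partial_deriv[OF sm(2) b]
    define h1 where "h1 x = \<psi> x * partial_deriv b \<theta> x" for x
    define h2 where "h2 x = partial_deriv b \<psi> x * \<theta> x" for x
    have c: "continuous_on UNIV h1" "continuous_on UNIV h2"
      unfolding h1_def[abs_def] h2_def[abs_def]
      by (intro continuous_on_mult smooth_continuous_on sm sb)+
    have z: "h1 x = 0" "h2 x = 0" if "x \<notin> K" for x using that K(4,5) by (simp_all add: h1_def h2_def)
    have "(LINT x|lborel. h2 x + h1 x) = 0"
    proof (rule integral_directional_derivative_eq_0[OF b _ _ _ K(2)])
      show "((\<lambda>t. \<psi> (x + t *\<^sub>R b) * \<theta> (x + t *\<^sub>R b)) has_real_derivative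
           h2 (x + t *\<^sub>R b) + h1 (x + t *\<^sub>R b)) (at t)" for x t
        by (rule DERIV_cong[OF DERIV_mult[OF smooth_has_field_derivative_line[OF sm(1) b, of x t]
              smooth_has_field_derivative_line[OF sm(2) b, of x t]]])
           (simp add: h1_def h2_def)
      show "continuous_on UNIV (\<lambda>x. \<psi> x * \<theta> x)" by (intro continuous_on_mult smooth_continuous_on sm)
      show "continuous_on UNIV (\<lambda>x. h2 x + h1 x)" by (intro continuous_on_add c)
    qed (use K(4) z in simp_all)
    moreover have I: "integrable lborel h1" "integrable lborel h2"
      by (rule integrable_continuous_compact_support[OF c(1) K(2) z(1)], assumption)
         (rule integrable_continuous_compact_support[OF c(2) K(2) z(2)], assumption)
    ultimately have "(LINT x|lborel. h1 x) = - (LINT x|lborel. h2 x)"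
      by (simp add: Bochner_Integration.integral_add[OF I(2,1)])
    moreover have on: "(LINT x|lebesgue_on \<Omega>. h x) = (LINT x|lborel. h x)"
      if "continuous_on UNIV h" "\<And>x. x \<notin> K \<Longrightarrow> h x = 0" for h :: "'a \<Rightarrow> real"
    proof -
      have "(LINT x|lebesgue_on \<Omega>. h x) = (LINT x|lebesgue. indicator \<Omega> x *\<^sub>R h x)"
        using \<Omega> by (simp only: integral_restrict_space open_sets_lebesgue sets.Int_space_eq2)
      also have "(\<lambda>x. indicator \<Omega> x *\<^sub>R h x) = h"
      proof
        show "indicator \<Omega> x *\<^sub>R h x = h x" for x using that(2)[of x] K(3) by (cases "x \<in> K") auto
      qed
      also have "(LINT x|lebesgue. h x) = (LINT x|lborel. h x)"
        by (simp add: integral_completion borel_measurable_continuous_onI[OF that(1)])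
      finally show ?thesis .
    qed
    ultimately have "(LINT x|lebesgue_on \<Omega>. h1 x) = - (LINT x|lebesgue_on \<Omega>. h2 x)"
      using c z by simp
    then show ?thesis by (simp add: h1_def h2_def gradient_inner[OF b])
  qed
  ultimately show ?thesis unfolding has_weak_gradient_def by blast
qed

subsection \<open>Compactly supported Sobolev functions\<close>

lemma Lp_of_Lp_loc_compact_support:
  fixes h :: "'a::euclidean_space \<Rightarrow> 'b::euclidean_space"
  assumes h: "h \<in> Lp_loc p \<Omega>" and \<Omega>: "open \<Omega>" and K: "compact K" "K \<subseteq> \<Omega>"
    and ae: "AE x in lebesgue_on \<Omega>. x \<notin> K \<longrightarrow> h x = 0"
  shows "h \<in> Lp p \<Omega>"
proof -
  have "integrable lebesgue (\<lambda>x. indicator \<Omega> x *\<^sub>R (norm (h x) powr p))"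
  proof (rule integrable_cong_AE_imp)
    have "h \<in> Lp p K" by (rule Lp_loc_D[OF h K])
    then have "integrable (lebesgue_on K) (\<lambda>x. norm (h x) powr p)" by (simp add: Lp_def)
    then show "integrable lebesgue (\<lambda>x. indicator K x *\<^sub>R (norm (h x) powr p))"
      by (simp only: integrable_restrict_space compact_sets_lebesgue[OF K(1)] sets.Int_space_eq2)
    have "(\<lambda>x. norm (h x) powr p) \<in> borel_measurable (lebesgue_on \<Omega>)"
      using Lp_loc_measurable[OF h] by measurable
    then show "(\<lambda>x. indicator \<Omega> x *\<^sub>R (norm (h x) powr p)) \<in> borel_measurable lebesgue"
      by (simp only: borel_measurable_restrict_space_iff open_sets_lebesgue[OF \<Omega>] sets.Int_space_eq2)
    have "AE x in lebesgue. x \<in> \<Omega> \<longrightarrow> x \<notin> K \<longrightarrow> h x = 0"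
      using ae by (simp add: AE_lebesgue_on_iff[OF \<Omega>])
    then show "AE x in lebesgue. indicator K x *\<^sub>R (norm (h x) powr p) = indicator \<Omega> x *\<^sub>R (norm (h x) powr p)"
    proof eventually_elim
      case (elim x)
      then show ?case using K(2) by (cases "x \<in> K") (auto simp: indicator_def)
    qed
  qed
  then have "integrable (lebesgue_on \<Omega>) (\<lambda>x. norm (h x) powr p)"
    by (simp only: integrable_restrict_space open_sets_lebesgue[OF \<Omega>] sets.Int_space_eq2)
  with Lp_loc_measurable[OF h] show ?thesis by (simp add: Lp_def)
qed

lemma integral_le_of_nn_integral_le:
  fixes h :: "'a \<Rightarrow> real"
  assumes "\<And>x. 0 \<le> h x" "(\<integral>\<^sup>+x. ennreal (h x) \<partial>M) \<le> ennreal e" "e \<ge> 0"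
  shows "(LINT x|M. h x) \<le> e"
proof (cases "integrable M h")
  case True
  then have "ennreal (LINT x|M. h x) \<le> ennreal e"
    using assms(1,2) nn_integral_eq_integral[OF True] by simp
  then show ?thesis using assms(3) by (simp add: ennreal_le_iff)
next
  case False
  then show ?thesis using assms(3) by (simp add: not_integrable_integral_eq)
qed

lemma nn_integral_lebesgue_on_le:
  assumes "S \<in> sets lebesgue"
  shows "(\<integral>\<^sup>+x. f x \<partial>lebesgue_on S) \<le> (\<integral>\<^sup>+x. f x \<partial>lebesgue)"
proof -
  have "(\<integral>\<^sup>+x. f x \<partial>lebesgue_on S) = (\<integral>\<^sup>+x. f x * indicator S x \<partial>lebesgue)"
    using assms by (simp add: nn_integral_restrict_space)
  also have "\<dots> \<le> (\<integral>\<^sup>+x. f x \<partial>lebesgue)"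
    by (rule nn_integral_mono) (simp add: indicator_def)
  finally show ?thesis .
qed

lemma norm_powr_le_sum_coordinates:
  fixes v :: "'a::euclidean_space"
  assumes "p \<ge> 0"
  shows "norm v powr p \<le> real DIM('a) powr p * (\<Sum>b\<in>Basis. \<bar>v \<bullet> b\<bar> powr p)"
proof -
  define m where "m = Max ((\<lambda>b. \<bar>v \<bullet> b\<bar>) ` (Basis :: 'a set))"
  have "m \<in> (\<lambda>b. \<bar>v \<bullet> b\<bar>) ` (Basis :: 'a set)"
    unfolding m_def by (rule Max_in) auto
  then obtain c where c: "c \<in> Basis" "m = \<bar>v \<bullet> c\<bar>" by blast
  have "norm v \<le> (\<Sum>b\<in>Basis. \<bar>v \<bullet> b\<bar>)" by (rule norm_le_l1)
  also have "\<dots> \<le> (\<Sum>b\<in>(Basis::'a set). m)"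
    by (intro sum_mono) (simp add: m_def)
  finally have "norm v \<le> real DIM('a) * m" by simp
  then have "norm v powr p \<le> (real DIM('a) * m) powr p" using assms by (intro powr_mono2) auto
  also have "\<dots> = real DIM('a) powr p * \<bar>v \<bullet> c\<bar> powr p" using c by (simp add: powr_mult)
  also have "\<dots> \<le> real DIM('a) powr p * (\<Sum>b\<in>Basis. \<bar>v \<bullet> b\<bar> powr p)"
    using c by (intro mult_left_mono member_le_sum[where f = "\<lambda>b. \<bar>v \<bullet> b\<bar> powr p"]) auto
  finally show ?thesis .
qed

text \<open>
  As long as the mollification radius is small compared with the distance from \<open>K\<close> to the complement of \<open>\<Omega>\<close>, the
  mollifications of \<open>f\<close> are test functions, and their partial derivatives are the mollifications of the
  components of \<open>g\<close>; outside \<open>K\<close> the gradient vanishes almost everywhere together with \<open>f\<close>. Both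
  converge in \<open>L\<^sup>p\<close>.
\<close>

theorem compact_support_W1p_0:
  fixes f :: "'a::euclidean_space \<Rightarrow> real"
  assumes p: "p \<ge> 1" and \<Omega>: "open \<Omega>" and f: "f \<in> Lp_loc p \<Omega>"
    and fg: "has_weak_gradient f g \<Omega>" and g: "g \<in> Lp_loc p \<Omega>"
    and K: "compact K" "K \<subseteq> \<Omega>" and f0: "\<And>x. x \<notin> K \<Longrightarrow> f x = 0"
  shows "f \<in> W1p_0 p \<Omega>"
proof -
  have ae: "AE x in lebesgue_on \<Omega>. x \<notin> K \<longrightarrow> g x = 0"
    using weak_gradient_eq_0_on_zero_set[OF fg \<Omega>] by eventually_elim (use f0 in blast)
  have fLp: "f \<in> Lp p \<Omega>" by (rule Lp_of_Lp_loc_compact_support[OF f \<Omega> K]) (simp add: f0)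
  have gLp: "g \<in> Lp p \<Omega>" by (rule Lp_of_Lp_loc_compact_support[OF g \<Omega> K ae])
  have W: "f \<in> W1p p \<Omega>" unfolding W1p_def using fLp fg gLp by blast
  obtain d K' where d: "d > 0" and K': "compact K'" "K' \<subseteq> \<Omega>" "\<And>x. x \<in> K \<Longrightarrow> cball x d \<subseteq> K'"
    using compact_neighbourhood[OF K(1) \<Omega> K(2)] by metis
  \<comment> \<open>Half the radius, so that points within \<open>d2\<close> of \<open>K\<close> still have a ball of radius \<open>d2\<close> inside \<open>K'\<close>.
      Farther away from \<open>K\<close> everything vanishes.\<close>
  define d2 where "d2 = d / 2"
  have d2: "d2 > 0" using d by (simp add: d2_def)
  define K1 where "K1 = (\<Union>x\<in>K. cball x d2)"
  have K1c: "compact K1" unfolding K1_def by (rule compact_minkowski_sum_cball[OF K(1)])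
  have K1_ball: "cball x d2 \<subseteq> K'" if x: "x \<in> K1" for x
  proof
    fix y assume y: "y \<in> cball x d2"
    obtain z where z: "z \<in> K" "x \<in> cball z d2" using x by (auto simp: K1_def)
    have "dist z y \<le> d"
      using y z dist_triangle[of z y x] by (simp add: d2_def)
    then show "y \<in> K'" using K'(3)[OF z(1)] by auto
  qed
  have K1K': "K1 \<subseteq> K'" using K1_ball d2 by fastforce
  have KK': "x \<in> K'" if "x \<in> K" for x using K'(3)[OF that] d by auto
  obtain \<eta> :: "nat \<Rightarrow> 'a \<Rightarrow> real" where \<eta>: "\<And>n. mollifier (d2 / Suc n) (\<eta> n)"
    using mollifier_sequence_exists[OF d2] by metis
  have \<eta>d: "mollifier d2 (\<eta> n)" for n
    using mollifier_mono[OF \<eta>[of n], of d2] d2 by (simp add: divide_le_eq)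
  define V where "V b x = indicator K x * (g x \<bullet> b)" for b x
  have fm: "f \<in> borel_measurable lebesgue"
  proof -
    have "(\<lambda>x. indicator \<Omega> x *\<^sub>R f x) \<in> borel_measurable lebesgue"
      using Lp_measurable[OF fLp]
      by (simp only: borel_measurable_restrict_space_iff open_sets_lebesgue[OF \<Omega>] sets.Int_space_eq2)
    moreover have "(\<lambda>x. indicator \<Omega> x *\<^sub>R f x) = f"
    proof
      show "indicator \<Omega> x *\<^sub>R f x = f x" for x using K(2) f0[of x] by (cases "x \<in> K") auto
    qed
    ultimately show ?thesis by simp
  qed
  have fKeq: "indicator K x *\<^sub>R f x = f x" for x
    using f0[of x] by (cases "x \<in> K") auto
  have fp: "integrable lebesgue (\<lambda>x. \<bar>f x\<bar> powr p)"
    using Lp_loc_D[OF f K] Lp_iff[OF compact_sets_lebesgue[OF K(1)], of f p]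
    by (simp only: fKeq real_norm_def)
  have fI: "integrable lebesgue f"
    by (rule integrable_Lp_compact_support[OF p fm compact_imp_bounded[OF K(1)] f0]) (use fp in simp_all)
  have VLp: "V b \<in> borel_measurable lebesgue \<and> integrable lebesgue (\<lambda>x. \<bar>V b x\<bar> powr p)" if b: "b \<in> Basis" for b
    using Lp_loc_D[OF Lp_loc_inner[OF p g b] K] Lp_iff[OF compact_sets_lebesgue[OF K(1)], of "\<lambda>x. g x \<bullet> b" p]
    unfolding V_def[abs_def] real_norm_def real_scaleR_def by blast
  have V0: "V b x = 0" if "x \<notin> K" for b x using that by (simp add: V_def)
  define \<psi> where "\<psi> n = convol f (\<eta> n)" for n
  have far: "convol h (\<eta> n) x = 0" if x: "x \<notin> K1" and h: "\<And>y. y \<notin> K \<Longrightarrow> h y = 0" for h :: "'a \<Rightarrow> real" and n x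
  proof (rule convol_eq_0)
    fix y assume "h y \<noteq> 0"
    then have "y \<in> K" using h by blast
    then have "x \<notin> cball y d2" using x by (auto simp: K1_def)
    then show "\<eta> n (x - y) = 0"
      by (intro mollifier_eq_0[OF \<eta>d]) (simp add: dist_norm norm_minus_commute)
  qed
  have \<psi>t: "\<psi> n \<in> test_fun \<Omega>" for n
    unfolding \<psi>_def
    by (rule test_funI[OF smooth_convol[OF fI mollifier_test_fun[OF \<eta>]] K1c]) (use K1K' K'(2) far f0 in blast)+
  have \<psi>b: "partial_deriv b (\<psi> n) x = convol (V b) (\<eta> n) x" if b: "b \<in> Basis" for b n x
  proof (cases "x \<in> K1")
    case False
    have "partial_deriv b (\<psi> n) x = 0"
      by (rule partial_deriv_eq_0_outside[OF compact_imp_closed[OF K1c] _ False]) (simp add: \<psi>_def far f0)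
    then show ?thesis using far[OF False V0] by simp
  next
    case True
    have eqf: "(\<lambda>y. indicator K' y * f y) = f"
    proof
      show "indicator K' y * f y = f y" for y using f0[of y] KK' by (cases "y \<in> K") auto
    qed
    have "partial_deriv b (\<psi> n) x = convol (\<lambda>y. indicator K' y * f y) (partial_deriv b (\<eta> n)) x"
      unfolding \<psi>_def partial_deriv_convol[OF fI mollifier_test_fun[OF \<eta>] b] eqf ..
    also have "\<dots> = convol (\<lambda>y. indicator K' y * (g y \<bullet> b)) (\<eta> n) x"
      by (rule convol_weak_gradient[OF fg \<Omega> K'(1,2) K1_ball[OF True] \<eta>d b])
    also have "\<dots> = convol (V b) (\<eta> n) x"
      unfolding convol_def
    proof (rule integral_cong_AE)
      note refm = borel_imp_lebesgue_measurable[OF test_fun_reflect_measurable[OF mollifier_test_fun[OF \<eta>]]]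
      have "(\<lambda>y. indicator K' y * (g y \<bullet> b)) \<in> borel_measurable lebesgue"
        using borel_measurable_integrable[OF Lp_loc_1_integrable[OF Lp_loc_inner[OF order_refl has_weak_gradient_Lp_loc(2)[OF fg] b] K'(1,2)]]
        by simp
      then show "(\<lambda>y. indicator K' y * (g y \<bullet> b) * \<eta> n (x - y)) \<in> borel_measurable lebesgue"
        by (rule borel_measurable_times[OF _ refm])
      show "(\<lambda>y. V b y * \<eta> n (x - y)) \<in> borel_measurable lebesgue"
        using VLp[OF b] by (intro borel_measurable_times refm) blast
      have "AE y in lebesgue. y \<in> \<Omega> \<longrightarrow> y \<notin> K \<longrightarrow> g y = 0"
        using ae by (simp add: AE_lebesgue_on_iff[OF \<Omega>])
      then show "AE y in lebesgue. indicator K' y * (g y \<bullet> b) * \<eta> n (x - y) = V b y * \<eta> n (x - y)"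
      proof eventually_elim
        case (elim y)
        then show ?case using KK' K'(2) by (cases "y \<in> K"; cases "y \<in> K'") (auto simp: V_def)
      qed
    qed
    finally show ?thesis .
  qed
  have conv_f: "(\<lambda>n. \<integral>\<^sup>+x. ennreal (\<bar>\<psi> n x - f x\<bar> powr p) \<partial>lebesgue) \<longlonglongrightarrow> 0"
    unfolding \<psi>_def
    by (rule convol_sequence_tendsto_Lp[OF p fm compact_imp_bounded[OF K(1)] f0 fp d2 \<eta>])
  have conv_V: "(\<lambda>n. \<integral>\<^sup>+x. ennreal (\<bar>convol (V b) (\<eta> n) x - V b x\<bar> powr p) \<partial>lebesgue) \<longlonglongrightarrow> 0" if "b \<in> Basis" for b
    using VLp[OF that]
    by (intro convol_sequence_tendsto_Lp[OF p _ compact_imp_bounded[OF K(1)] V0 _ d2 \<eta>]) blast+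
  have "\<exists>\<psi>\<in>test_fun \<Omega>. W1p_norm p \<Omega> (\<lambda>x. f x - \<psi> x) < \<epsilon>" if \<epsilon>: "\<epsilon> > 0" for \<epsilon>
  proof -
    define D where "D = real DIM('a)"
    have D: "D > 0" by (simp add: D_def)
    define c where "c = \<epsilon> powr p / 3"
    define c1 where "c1 = c / (D powr p * D)"
    have c: "c > 0" "c1 > 0" using \<epsilon> D by (simp_all add: c_def c1_def)
    have "\<forall>\<^sub>F n in sequentially. (\<integral>\<^sup>+x. ennreal (\<bar>\<psi> n x - f x\<bar> powr p) \<partial>lebesgue) < ennreal c"
      using order_tendstoD(2)[OF conv_f, of "ennreal c"] c by simp
    moreover have "\<forall>\<^sub>F n in sequentially. \<forall>b\<in>Basis. (\<integral>\<^sup>+x. ennreal (\<bar>convol (V b) (\<eta> n) x - V b x\<bar> powr p) \<partial>lebesgue) < ennreal c1"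
      using order_tendstoD(2)[OF conv_V, of _ "ennreal c1"] c by (intro eventually_ball_finite) auto
    ultimately have "\<forall>\<^sub>F n in sequentially. (\<integral>\<^sup>+x. ennreal (\<bar>\<psi> n x - f x\<bar> powr p) \<partial>lebesgue) < ennreal c
       \<and> (\<forall>b\<in>Basis. (\<integral>\<^sup>+x. ennreal (\<bar>convol (V b) (\<eta> n) x - V b x\<bar> powr p) \<partial>lebesgue) < ennreal c1)"
      by (rule eventually_conj)
    then obtain n where "(\<integral>\<^sup>+x. ennreal (\<bar>\<psi> n x - f x\<bar> powr p) \<partial>lebesgue) < ennreal c
       \<and> (\<forall>b\<in>Basis. (\<integral>\<^sup>+x. ennreal (\<bar>convol (V b) (\<eta> n) x - V b x\<bar> powr p) \<partial>lebesgue) < ennreal c1)"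
      unfolding eventually_sequentially by blast
    then have n: "(\<integral>\<^sup>+x. ennreal (\<bar>\<psi> n x - f x\<bar> powr p) \<partial>lebesgue) < ennreal c"
      "\<And>b. b \<in> Basis \<Longrightarrow> (\<integral>\<^sup>+x. ennreal (\<bar>convol (V b) (\<eta> n) x - V b x\<bar> powr p) \<partial>lebesgue) < ennreal c1"
      by blast+
    have I1: "(LINT x|lebesgue_on \<Omega>. \<bar>f x - \<psi> n x\<bar> powr p) \<le> c"
    proof (rule integral_le_of_nn_integral_le)
      have "(\<integral>\<^sup>+x. ennreal (\<bar>f x - \<psi> n x\<bar> powr p) \<partial>lebesgue_on \<Omega>) \<le> (\<integral>\<^sup>+x. ennreal (\<bar>f x - \<psi> n x\<bar> powr p) \<partial>lebesgue)"
        by (rule nn_integral_lebesgue_on_le[OF open_sets_lebesgue[OF \<Omega>]])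
      also have "\<dots> \<le> ennreal c" using n(1) by (simp add: abs_minus_commute less_imp_le)
      finally show "(\<integral>\<^sup>+x. ennreal (\<bar>f x - \<psi> n x\<bar> powr p) \<partial>lebesgue_on \<Omega>) \<le> ennreal c" .
    qed (use c in simp_all)
    have "has_weak_gradient (\<lambda>x. f x - \<psi> n x) (\<lambda>x. g x - gradient (\<psi> n) x) \<Omega>"
      by (intro has_weak_gradient_diff fg test_fun_has_weak_gradient \<psi>t \<Omega>)
    note wg = weak_grad_AE_eq[OF this \<Omega>]
    have I2: "(LINT x|lebesgue_on \<Omega>. norm (weak_grad \<Omega> (\<lambda>x. f x - \<psi> n x) x) powr p) \<le> c"
    proof (rule integral_le_of_nn_integral_le)
      have "(\<integral>\<^sup>+x. ennreal (norm (weak_grad \<Omega> (\<lambda>x. f x - \<psi> n x) x) powr p) \<partial>lebesgue_on \<Omega>)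
        \<le> (\<integral>\<^sup>+x. ennreal (D powr p * (\<Sum>b\<in>Basis. \<bar>convol (V b) (\<eta> n) x - V b x\<bar> powr p)) \<partial>lebesgue_on \<Omega>)"
      proof (rule nn_integral_mono_AE)
        show "AE x in lebesgue_on \<Omega>. ennreal (norm (weak_grad \<Omega> (\<lambda>x. f x - \<psi> n x) x) powr p)
           \<le> ennreal (D powr p * (\<Sum>b\<in>Basis. \<bar>convol (V b) (\<eta> n) x - V b x\<bar> powr p))"
          using wg ae
        proof eventually_elim
          case (elim x)
          have "norm (weak_grad \<Omega> (\<lambda>x. f x - \<psi> n x) x) powr p
             \<le> D powr p * (\<Sum>b\<in>Basis. \<bar>(g x - gradient (\<psi> n) x) \<bullet> b\<bar> powr p)"
            unfolding elim(1) D_def using p by (intro norm_powr_le_sum_coordinates) simp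
          also have "(\<Sum>b\<in>Basis. \<bar>(g x - gradient (\<psi> n) x) \<bullet> b\<bar> powr p) = (\<Sum>b\<in>Basis. \<bar>convol (V b) (\<eta> n) x - V b x\<bar> powr p)"
          proof (rule sum.cong[OF refl])
            fix b :: 'a assume b: "b \<in> Basis"
            have "g x \<bullet> b = V b x" using elim(2) by (cases "x \<in> K") (simp_all add: V_def)
            then show "\<bar>(g x - gradient (\<psi> n) x) \<bullet> b\<bar> powr p = \<bar>convol (V b) (\<eta> n) x - V b x\<bar> powr p"
              by (simp add: inner_diff_left gradient_inner[OF b] \<psi>b[OF b] abs_minus_commute)
          qed
          finally show ?case by (rule ennreal_leI)
        qed
      qed
      also have "\<dots> \<le> (\<integral>\<^sup>+x. ennreal (D powr p * (\<Sum>b\<in>Basis. \<bar>convol (V b) (\<eta> n) x - V b x\<bar> powr p)) \<partial>lebesgue)"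
        by (rule nn_integral_lebesgue_on_le[OF open_sets_lebesgue[OF \<Omega>]])
      also have "\<dots> = (\<integral>\<^sup>+x. ennreal (D powr p) * (\<Sum>b\<in>Basis. ennreal (\<bar>convol (V b) (\<eta> n) x - V b x\<bar> powr p)) \<partial>lebesgue)"
        by (intro nn_integral_cong) (simp add: ennreal_mult sum_nonneg)
      also have "\<dots> = ennreal (D powr p) * (\<Sum>b\<in>Basis. \<integral>\<^sup>+x. ennreal (\<bar>convol (V b) (\<eta> n) x - V b x\<bar> powr p) \<partial>lebesgue)"
      proof -
        have VIb: "integrable lebesgue (V b)" if b: "b \<in> Basis" for b
          by (rule integrable_Lp_compact_support[OF p _ compact_imp_bounded[OF K(1)] V0]) (use VLp[OF b] in simp_all)
        have m: "(\<lambda>x. ennreal (\<bar>convol (V b) (\<eta> n) x - V b x\<bar> powr p)) \<in> borel_measurable lebesgue" if b: "b \<in> Basis" for b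
        proof -
          have [measurable]: "convol (V b) (\<eta> n) \<in> borel_measurable lebesgue"
            by (intro borel_imp_lebesgue_measurable smooth_borel_measurable smooth_convol[OF VIb[OF b] mollifier_test_fun[OF \<eta>]])
          have [measurable]: "V b \<in> borel_measurable lebesgue" using VLp[OF b] by blast
          show ?thesis by measurable
        qed
        then have ms: "(\<lambda>x. \<Sum>b\<in>Basis. ennreal (\<bar>convol (V b) (\<eta> n) x - V b x\<bar> powr p)) \<in> borel_measurable lebesgue"
          by (intro borel_measurable_sum)
        show ?thesis
          unfolding nn_integral_cmult[OF ms] by (subst nn_integral_sum) (simp_all only: m)
      qed
      also have "\<dots> \<le> ennreal (D powr p) * (\<Sum>b\<in>(Basis::'a set). ennreal c1)"
        by (intro mult_left_mono sum_mono less_imp_le[OF n(2)]) simp_all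
      also have "\<dots> = ennreal (D powr p * (D * c1))"
      proof -
        have "(\<Sum>b\<in>(Basis::'a set). ennreal c1) = ennreal (\<Sum>b\<in>(Basis::'a set). c1)"
          using c by (intro sum_ennreal) simp
        also have "(\<Sum>b\<in>(Basis::'a set). c1) = D * c1" by (simp add: D_def)
        finally show ?thesis using c D by (simp add: ennreal_mult)
      qed
      also have "D powr p * (D * c1) = c" using D by (simp add: c1_def)
      finally show "(\<integral>\<^sup>+x. ennreal (norm (weak_grad \<Omega> (\<lambda>x. f x - \<psi> n x) x) powr p) \<partial>lebesgue_on \<Omega>) \<le> ennreal c" .
    qed (use c in simp_all)
    have "(LINT x|lebesgue_on \<Omega>. \<bar>f x - \<psi> n x\<bar> powr p) + (LINT x|lebesgue_on \<Omega>. norm (weak_grad \<Omega> (\<lambda>x. f x - \<psi> n x) x) powr p) \<le> c + c"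
      using I1 I2 by (rule add_mono)
    also have "\<dots> < \<epsilon> powr p" using \<epsilon> by (simp add: c_def)
    finally have "W1p_norm p \<Omega> (\<lambda>x. f x - \<psi> n x) < (\<epsilon> powr p) powr (1 / p)"
      unfolding W1p_norm_def using p by (intro powr_less_mono2 add_nonneg_nonneg) simp_all
    also have "\<dots> = \<epsilon>" using \<epsilon> p by (simp add: powr_powr)
    finally show ?thesis using \<psi>t by blast
  qed
  with W show ?thesis unfolding W1p_0_def by blast
qed

section \<open>Minima of quasisuperminimizers\<close>

lemma sets_lebesgue_nonzero:
  fixes \<phi> :: "'a::euclidean_space \<Rightarrow> real"
  assumes "\<phi> \<in> borel_measurable (lebesgue_on \<Omega>)" "open \<Omega>"
  shows "{x \<in> \<Omega>. \<phi> x \<noteq> 0} \<in> sets lebesgue"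
proof -
  have "{x \<in> space (lebesgue_on \<Omega>). \<phi> x \<noteq> 0} \<in> sets (lebesgue_on \<Omega>)"
    using assms(1) by measurable
  moreover have "space (lebesgue_on \<Omega>) = \<Omega>" by (simp add: space_restrict_space)
  ultimately have "{x \<in> \<Omega>. \<phi> x \<noteq> 0} \<in> sets (lebesgue_on \<Omega>)" by (simp only:)
  moreover have "\<Omega> \<inter> space lebesgue \<in> sets lebesgue" using open_sets_lebesgue[OF assms(2)] by simp
  ultimately show ?thesis using sets_restrict_space_iff by blast
qed

lemma set_nn_integral_weak_grad:
  assumes "has_weak_gradient w k \<Omega>" and \<Omega>: "open \<Omega>"
  shows "(\<integral>\<^sup>+x\<in>{x\<in>\<Omega>. P x}. ennreal (norm (weak_grad \<Omega> w x) powr p) \<partial>lebesgue)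
      = (\<integral>\<^sup>+x\<in>{x\<in>\<Omega>. P x}. ennreal (norm (k x) powr p) \<partial>lebesgue)"
proof (rule nn_integral_cong_AE)
  have "AE x in lebesgue. x \<in> \<Omega> \<longrightarrow> weak_grad \<Omega> w x = k x"
    using weak_grad_AE_eq[OF assms] by (simp add: AE_lebesgue_on_iff[OF \<Omega>])
  then show "AE x in lebesgue. ennreal (norm (weak_grad \<Omega> w x) powr p) * indicator {x \<in> \<Omega>. P x} x
     = ennreal (norm (k x) powr p) * indicator {x \<in> \<Omega>. P x} x"
    by eventually_elim (auto simp: indicator_def)
qed

lemma quasisuperminimizer_test:
  assumes q: "quasisuperminimizer p Q \<Omega> u" and \<Omega>: "open \<Omega>"
    and \<phi>: "\<phi> \<in> W1p_0 p \<Omega>" "\<And>x. 0 \<le> \<phi> x"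
    and g: "has_weak_gradient u g \<Omega>" and h: "has_weak_gradient (\<lambda>x. u x + \<phi> x) h \<Omega>"
  shows "(\<integral>\<^sup>+x\<in>{x\<in>\<Omega>. \<phi> x \<noteq> 0}. ennreal (norm (g x) powr p) \<partial>lebesgue)
     \<le> ennreal Q * (\<integral>\<^sup>+x\<in>{x\<in>\<Omega>. \<phi> x \<noteq> 0}. ennreal (norm (h x) powr p) \<partial>lebesgue)"
proof -
  have "AE x in lebesgue_on \<Omega>. 0 \<le> \<phi> x" using \<phi>(2) by simp
  with q \<phi>(1) have "(\<integral>\<^sup>+x\<in>{x\<in>\<Omega>. \<phi> x \<noteq> 0}. ennreal (norm (weak_grad \<Omega> u x) powr p) \<partial>lebesgue)
        \<le> ennreal Q * (\<integral>\<^sup>+x\<in>{x\<in>\<Omega>. \<phi> x \<noteq> 0}. ennreal (norm (weak_grad \<Omega> (\<lambda>y. u y + \<phi> y) x) powr p) \<partial>lebesgue)"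
    unfolding quasisuperminimizer_def by blast
  then show ?thesis unfolding set_nn_integral_weak_grad[OF g \<Omega>] set_nn_integral_weak_grad[OF h \<Omega>] .
qed

lemma Lp_loc_integrable_subset:
  fixes g :: "'a::euclidean_space \<Rightarrow> 'b::euclidean_space"
  assumes g: "g \<in> Lp_loc p \<Omega>" and K: "compact K" "K \<subseteq> \<Omega>" and E: "E \<in> sets lebesgue" "E \<subseteq> K"
  shows "integrable lebesgue (\<lambda>x. indicator E x * norm (g x) powr p)"
proof -
  have "g \<in> Lp p E"
    by (rule Lp_subset[OF Lp_loc_D[OF g K] E(2) compact_sets_lebesgue[OF K(1)] E(1)])
  then have "integrable (lebesgue_on E) (\<lambda>x. norm (g x) powr p)" by (simp add: Lp_def)
  then show ?thesis
    by (simp only: integrable_restrict_space E(1) sets.Int_space_eq2 real_scaleR_def)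
qed

lemma set_nn_integral_eq_ennreal_integral:
  fixes h :: "'a \<Rightarrow> real"
  assumes "integrable M (\<lambda>x. indicator E x * h x)" "\<And>x. 0 \<le> h x"
  shows "(\<integral>\<^sup>+x\<in>E. ennreal (h x) \<partial>M) = ennreal (LINT x|M. indicator E x * h x)"
proof -
  have "(\<integral>\<^sup>+x\<in>E. ennreal (h x) \<partial>M) = (\<integral>\<^sup>+x. ennreal (indicator E x * h x) \<partial>M)"
    by (rule nn_integral_cong) (simp add: indicator_def)
  also have "\<dots> = ennreal (LINT x|M. indicator E x * h x)"
    by (rule nn_integral_eq_integral[OF assms(1)]) (use assms(2) in simp)
  finally show ?thesis .
qed

text \<open>
  For compactly supported \<open>\<phi>\<close> all energies are finite. The quasiminimizing property then becomes an
  inequality between real integrals, which can be combined linearly with others. The function \<open>h\<close> allows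
  the gradient of the competitor to be given in a simpler form on the set where it matters.
\<close>

lemma quasisuperminimizer_test_integral:
  fixes u :: "'a::euclidean_space \<Rightarrow> real"
  assumes q: "quasisuperminimizer p Q \<Omega> u" and p: "p \<ge> 1" and \<Omega>: "open \<Omega>"
    and g: "has_weak_gradient u g \<Omega>" "g \<in> Lp_loc p \<Omega>"
    and \<phi>: "has_weak_gradient \<phi> G \<Omega>" "\<phi> \<in> Lp_loc p \<Omega>" "G \<in> Lp_loc p \<Omega>" "\<And>x. 0 \<le> \<phi> x"
    and K: "compact K" "K \<subseteq> \<Omega>" "\<And>x. x \<notin> K \<Longrightarrow> \<phi> x = 0"
    and E: "E = {x \<in> \<Omega>. \<phi> x \<noteq> 0}"
    and h: "\<And>x. x \<in> E \<Longrightarrow> h x = g x + G x"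
  shows "integrable lebesgue (\<lambda>x. indicator E x * (norm (g x) powr p - Q * norm (h x) powr p))"
    and "(LINT x|lebesgue. indicator E x * (norm (g x) powr p - Q * norm (h x) powr p)) \<le> 0"
proof -
  have Q: "Q \<ge> 1" using q unfolding quasisuperminimizer_def by blast
  have Es: "E \<in> sets lebesgue"
    unfolding E by (rule sets_lebesgue_nonzero[OF Lp_loc_measurable[OF \<phi>(2)] \<Omega>])
  have EK: "E \<subseteq> K" unfolding E using K(3) by blast
  have I1: "integrable lebesgue (\<lambda>x. indicator E x * norm (g x) powr p)"
    by (rule Lp_loc_integrable_subset[OF g(2) K(1,2) Es EK])
  have I2: "integrable lebesgue (\<lambda>x. indicator E x * norm (g x + G x) powr p)"
    by (rule Lp_loc_integrable_subset[OF Lp_loc_add[OF p g(2) \<phi>(3)] K(1,2) Es EK])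
  have eq: "(\<lambda>x. indicator E x * (norm (g x) powr p - Q * norm (h x) powr p))
    = (\<lambda>x. indicator E x * norm (g x) powr p - Q * (indicator E x * norm (g x + G x) powr p))"
  proof
    show "indicator E x * (norm (g x) powr p - Q * norm (h x) powr p)
      = indicator E x * norm (g x) powr p - Q * (indicator E x * norm (g x + G x) powr p)" for x
      by (cases "x \<in> E") (simp_all add: h)
  qed
  show "integrable lebesgue (\<lambda>x. indicator E x * (norm (g x) powr p - Q * norm (h x) powr p))"
    unfolding eq by (intro Bochner_Integration.integrable_diff integrable_mult_right I1 I2)
  have "\<phi> \<in> W1p_0 p \<Omega>"
    by (rule compact_support_W1p_0[OF p \<Omega> \<phi>(2,1,3) K])
  from quasisuperminimizer_test[OF q \<Omega> this \<phi>(4) g(1) has_weak_gradient_add[OF g(1) \<phi>(1) \<Omega>], folded E]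
  have "ennreal (LINT x|lebesgue. indicator E x * norm (g x) powr p)
    \<le> ennreal Q * ennreal (LINT x|lebesgue. indicator E x * norm (g x + G x) powr p)"
    unfolding set_nn_integral_eq_ennreal_integral[OF I1 powr_ge_zero] set_nn_integral_eq_ennreal_integral[OF I2 powr_ge_zero] .
  also have "\<dots> = ennreal (Q * (LINT x|lebesgue. indicator E x * norm (g x + G x) powr p))"
    using Q by (simp add: ennreal_mult')
  finally have "(LINT x|lebesgue. indicator E x * norm (g x) powr p)
     \<le> Q * (LINT x|lebesgue. indicator E x * norm (g x + G x) powr p)"
    using Q by (subst (asm) ennreal_le_iff) auto
  then show "(LINT x|lebesgue. indicator E x * (norm (g x) powr p - Q * norm (h x) powr p)) \<le> 0"
    unfolding eq using I1 I2 by simp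
qed

lemma truncation_Lp_loc:
  fixes \<phi> w :: "'a::euclidean_space \<Rightarrow> real"
  assumes p: "p \<ge> 1" and \<Omega>: "open \<Omega>"
    and \<phi>: "has_weak_gradient \<phi> G \<Omega>" "\<phi> \<in> Lp_loc p \<Omega>" "G \<in> Lp_loc p \<Omega>" "\<And>x. 0 \<le> \<phi> x"
    and w: "has_weak_gradient w gw \<Omega>" "gw \<in> Lp_loc p \<Omega>"
  shows "has_weak_gradient (\<lambda>x. min (\<phi> x) (max (w x) 0))
      (\<lambda>x. if \<phi> x \<le> max (w x) 0 then G x else if 0 < w x then gw x else 0) \<Omega>"
    and "(\<lambda>x. min (\<phi> x) (max (w x) 0)) \<in> Lp_loc p \<Omega>"
    and "(\<lambda>x. if \<phi> x \<le> max (w x) 0 then G x else if 0 < w x then gw x else 0) \<in> Lp_loc p \<Omega>"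
proof -
  note 1 = has_weak_gradient_min[OF \<phi>(1) has_weak_gradient_pos_part[OF w(1) \<Omega>] \<Omega>]
  note L = has_weak_gradient_Lp_loc[OF 1, THEN Lp_loc_measurable]
  show "has_weak_gradient (\<lambda>x. min (\<phi> x) (max (w x) 0))
      (\<lambda>x. if \<phi> x \<le> max (w x) 0 then G x else if 0 < w x then gw x else 0) \<Omega>"
    by (rule 1)
  show "(\<lambda>x. min (\<phi> x) (max (w x) 0)) \<in> Lp_loc p \<Omega>"
  proof (rule Lp_loc_bound[OF p L(1) \<phi>(2,2)])
    show "norm (min (\<phi> x) (max (w x) 0)) \<le> norm (\<phi> x) + norm (\<phi> x)" for x
      using \<phi>(4)[of x] by (simp add: min_def max_def)
  qed
  show "(\<lambda>x. if \<phi> x \<le> max (w x) 0 then G x else if 0 < w x then gw x else 0) \<in> Lp_loc p \<Omega>"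
    by (rule Lp_loc_bound[OF p L(2) \<phi>(3) w(2)]) simp
qed

text \<open>
  The two competitors for \<open>a\<close>. With \<open>v = min a b + \<phi>\<close> one has
  \<open>a + (\<phi> - min \<phi> (a - b)\<^sup>+) = max a v\<close> and \<open>a + min \<phi> (b - a)\<^sup>+ = max a (min b v)\<close>. The sets
  \<open>E1\<close> and \<open>E2\<close> are those where the competitors differ from \<open>a\<close>, and \<open>h1\<close>, \<open>h2\<close> are the gradients
  of the competitors there.
\<close>

lemma quasisuperminimizer_pair_tests:
  fixes a b :: "'a::euclidean_space \<Rightarrow> real"
  assumes q: "quasisuperminimizer p Q \<Omega> a" and p: "p \<ge> 1" and \<Omega>: "open \<Omega>"
    and a: "has_weak_gradient a ga \<Omega>" "ga \<in> Lp_loc p \<Omega>"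
    and b: "has_weak_gradient b gb \<Omega>" "gb \<in> Lp_loc p \<Omega>"
    and \<phi>: "has_weak_gradient \<phi> G \<Omega>" "\<phi> \<in> Lp_loc p \<Omega>" "G \<in> Lp_loc p \<Omega>" "\<And>x. 0 \<le> \<phi> x"
    and K: "compact K" "K \<subseteq> \<Omega>" "\<And>x. x \<notin> K \<Longrightarrow> \<phi> x = 0"
  defines "E1 \<equiv> {x \<in> \<Omega>. max (a x - b x) 0 < \<phi> x}"
    and "h1 \<equiv> (\<lambda>x. (if a x \<le> b x then ga x else gb x) + G x)"
    and "E2 \<equiv> {x \<in> \<Omega>. 0 < \<phi> x \<and> a x < b x}"
    and "h2 \<equiv> (\<lambda>x. if \<phi> x \<le> b x - a x then ga x + G x else gb x)"
  shows "integrable lebesgue (\<lambda>x. indicator E1 x * (norm (ga x) powr p - Q * norm (h1 x) powr p))"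
    and "(LINT x|lebesgue. indicator E1 x * (norm (ga x) powr p - Q * norm (h1 x) powr p)) \<le> 0"
    and "integrable lebesgue (\<lambda>x. indicator E2 x * (norm (ga x) powr p - Q * norm (h2 x) powr p))"
    and "(LINT x|lebesgue. indicator E2 x * (norm (ga x) powr p - Q * norm (h2 x) powr p)) \<le> 0"
proof -
  have ab: "has_weak_gradient (\<lambda>x. a x - b x) (\<lambda>x. ga x - gb x) \<Omega>" "(\<lambda>x. ga x - gb x) \<in> Lp_loc p \<Omega>"
    and ba: "has_weak_gradient (\<lambda>x. b x - a x) (\<lambda>x. gb x - ga x) \<Omega>" "(\<lambda>x. gb x - ga x) \<in> Lp_loc p \<Omega>"
    by (intro has_weak_gradient_diff Lp_loc_diff a b p \<Omega>)+
  note t1 = truncation_Lp_loc[OF p \<Omega> \<phi> ab] and t2 = truncation_Lp_loc[OF p \<Omega> \<phi> ba]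
  define \<phi>1 where "\<phi>1 = (\<lambda>x. \<phi> x - min (\<phi> x) (max (a x - b x) 0))"
  define G1 where "G1 = (\<lambda>x. G x - (if \<phi> x \<le> max (a x - b x) 0 then G x else if 0 < a x - b x then ga x - gb x else 0))"
  have f1: "has_weak_gradient \<phi>1 G1 \<Omega>" "\<phi>1 \<in> Lp_loc p \<Omega>" "G1 \<in> Lp_loc p \<Omega>"
    unfolding \<phi>1_def G1_def by (intro has_weak_gradient_diff Lp_loc_diff \<phi> t1 p \<Omega>)+
  have f4: "0 \<le> \<phi>1 x" for x by (simp add: \<phi>1_def)
  have f5: "\<phi>1 x = 0" if "x \<notin> K" for x using K(3)[OF that] by (simp add: \<phi>1_def)
  have f6: "E1 = {x \<in> \<Omega>. \<phi>1 x \<noteq> 0}" unfolding E1_def \<phi>1_def by (auto simp: min_def)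
  have f7: "h1 x = ga x + G1 x" if "x \<in> E1" for x
    using that by (simp add: E1_def h1_def G1_def)
  note f = quasisuperminimizer_test_integral[OF q p \<Omega> a f1 f4 K(1,2) f5 f6 f7]
  show "integrable lebesgue (\<lambda>x. indicator E1 x * (norm (ga x) powr p - Q * norm (h1 x) powr p))"
    by (rule f(1))
  show "(LINT x|lebesgue. indicator E1 x * (norm (ga x) powr p - Q * norm (h1 x) powr p)) \<le> 0"
    by (rule f(2))
  define \<phi>2 where "\<phi>2 = (\<lambda>x. min (\<phi> x) (max (b x - a x) 0))"
  define G2 where "G2 = (\<lambda>x. if \<phi> x \<le> max (b x - a x) 0 then G x else if 0 < b x - a x then gb x - ga x else 0)"
  have f1: "has_weak_gradient \<phi>2 G2 \<Omega>" "\<phi>2 \<in> Lp_loc p \<Omega>" "G2 \<in> Lp_loc p \<Omega>"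
    unfolding \<phi>2_def G2_def by (rule t2)+
  have f4: "0 \<le> \<phi>2 x" for x using \<phi>(4)[of x] by (simp add: \<phi>2_def)
  have f5: "\<phi>2 x = 0" if "x \<notin> K" for x using K(3)[OF that] by (simp add: \<phi>2_def)
  have f6: "E2 = {x \<in> \<Omega>. \<phi>2 x \<noteq> 0}"
  proof -
    have "(0 < \<phi> x \<and> a x < b x) \<longleftrightarrow> \<phi>2 x \<noteq> 0" for x
      using \<phi>(4)[of x] unfolding \<phi>2_def min_def max_def by (simp split: if_split) linarith
    then show ?thesis unfolding E2_def by blast
  qed
  have f7: "h2 x = ga x + G2 x" if "x \<in> E2" for x
    using that by (simp add: E2_def h2_def G2_def max_def)
  note f = quasisuperminimizer_test_integral[OF q p \<Omega> a f1 f4 K(1,2) f5 f6 f7]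
  show "integrable lebesgue (\<lambda>x. indicator E2 x * (norm (ga x) powr p - Q * norm (h2 x) powr p))"
    by (rule f(1))
  show "(LINT x|lebesgue. indicator E2 x * (norm (ga x) powr p - Q * norm (h2 x) powr p)) \<le> 0"
    by (rule f(2))
qed

text \<open>
  The two equations for the weights express the cancellation of energies; they form a linear system with
  solution \<open>\<alpha>1 = Q2 (Q1 - 1) / (Q1 Q2 - 1)\<close> and \<open>\<alpha>2 = Q1 (Q2 - 1) / (Q1 Q2 - 1)\<close>. The bound
  \<open>\<alpha>1 + \<alpha>2 \<ge> 1\<close> amounts to \<open>(Q1 - 1) (Q2 - 1) \<ge> 0\<close>, and \<open>Q1 \<le> Qbar\<close> to \<open>Q1 (Q2 - 1)\<^sup>2 \<ge> 0\<close>. For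
  \<open>Q1 = Q2 = 1\<close> the system degenerates to \<open>\<alpha>1 + \<alpha>2 = 1\<close>.
\<close>

lemma quasi_weights:
  fixes Q1 Q2 Qbar :: real
  assumes Q: "Q1 \<ge> 1" "Q2 \<ge> 1"
    and Qbar: "Qbar = (if Q1 = 1 \<and> Q2 = 1 then 1 else (Q1 + Q2 - 2) * (Q1 * Q2 / (Q1 * Q2 - 1)))"
  obtains \<alpha>1 \<alpha>2 where "0 \<le> \<alpha>1" "\<alpha>1 \<le> 1" "0 \<le> \<alpha>2" "\<alpha>2 \<le> 1" "1 \<le> \<alpha>1 + \<alpha>2"
    "\<alpha>2 = (1 - \<alpha>1) * Q1" "\<alpha>1 = (1 - \<alpha>2) * Q2" "Qbar = \<alpha>1 * Q1 + \<alpha>2 * Q2"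
    "Q1 \<le> Qbar" "Q2 \<le> Qbar"
proof (cases "Q1 = 1 \<and> Q2 = 1")
  case True
  then show thesis using Qbar by (intro that[of "1/2" "1/2"]) auto
next
  case False
  define D where "D = Q1 * Q2 - 1"
  have "D = (Q1 - 1) * Q2 + (Q2 - 1)" by (simp add: D_def algebra_simps)
  moreover have "0 \<le> (Q1 - 1) * Q2" "Q1 \<noteq> 1 \<Longrightarrow> 0 < (Q1 - 1) * Q2" using Q by simp_all
  ultimately have D: "D > 0" using False Q by (cases "Q1 = 1") (auto intro: add_pos_nonneg)
  define \<alpha>1 where "\<alpha>1 = Q2 * (Q1 - 1) / D"
  define \<alpha>2 where "\<alpha>2 = Q1 * (Q2 - 1) / D"
  have Qb: "Qbar = (Q1 + Q2 - 2) * (Q1 * Q2) / D" using False by (simp add: Qbar D_def)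
  have "D * (1 - \<alpha>1) = Q2 - 1" "D * (1 - \<alpha>2) = Q1 - 1"
    using D unfolding \<alpha>1_def \<alpha>2_def by (simp_all add: field_simps) (simp_all add: D_def algebra_simps)
  then have e: "1 - \<alpha>1 = (Q2 - 1) / D" "1 - \<alpha>2 = (Q1 - 1) / D"
    using D by (simp_all add: field_simps)
  show thesis
  proof (rule that[of \<alpha>1 \<alpha>2])
    show "0 \<le> \<alpha>1" "0 \<le> \<alpha>2" using Q D by (simp_all add: \<alpha>1_def \<alpha>2_def)
    have "0 \<le> 1 - \<alpha>1" "0 \<le> 1 - \<alpha>2" using Q D by (simp_all add: e)
    then show "\<alpha>1 \<le> 1" "\<alpha>2 \<le> 1" by simp_all
    show "\<alpha>2 = (1 - \<alpha>1) * Q1" "\<alpha>1 = (1 - \<alpha>2) * Q2"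
      unfolding e by (simp_all add: \<alpha>1_def \<alpha>2_def mult.commute)
    have "0 \<le> (Q1 - 1) * (Q2 - 1)" using Q by simp
    then have "D \<le> Q2 * (Q1 - 1) + Q1 * (Q2 - 1)" by (simp add: D_def algebra_simps)
    then show "1 \<le> \<alpha>1 + \<alpha>2" using D by (simp add: \<alpha>1_def \<alpha>2_def add_divide_distrib[symmetric])
    show "Qbar = \<alpha>1 * Q1 + \<alpha>2 * Q2"
      using D by (simp add: Qb \<alpha>1_def \<alpha>2_def field_simps)
    have "Q1 * D \<le> (Q1 + Q2 - 2) * (Q1 * Q2)"
    proof -
      have "0 \<le> Q1 * (Q2 - 1)\<^sup>2" using Q by simp
      then show ?thesis by (simp add: D_def power2_eq_square algebra_simps)
    qed
    then show "Q1 \<le> Qbar" using D by (simp add: Qb le_divide_eq)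
    have "Q2 * D \<le> (Q1 + Q2 - 2) * (Q1 * Q2)"
    proof -
      have "0 \<le> Q2 * (Q1 - 1)\<^sup>2" using Q by simp
      then show ?thesis by (simp add: D_def power2_eq_square algebra_simps)
    qed
    then show "Q2 \<le> Qbar" using D by (simp add: Qb le_divide_eq)
  qed
qed

text \<open>
  The four integral inequalities are added with the weights \<open>\<alpha>1\<close>, \<open>\<alpha>2\<close>, \<open>1 - \<alpha>1\<close>, \<open>1 - \<alpha>2\<close>. It suffices
  that the weighted sum of the integrands dominates the desired integrand almost everywhere, which is
  checked point by point according to the order of \<open>u1\<close>, \<open>u2\<close> and \<open>v\<close>.
\<close>

lemma quasi_min_compact_support:
  fixes u1 u2 :: "'a::euclidean_space \<Rightarrow> real"
  assumes q1: "quasisuperminimizer p Q1 \<Omega> u1" and q2: "quasisuperminimizer p Q2 \<Omega> u2"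
    and p: "p \<ge> 1" and \<Omega>: "open \<Omega>"
    and Qbar: "Qbar = (if Q1 = 1 \<and> Q2 = 1 then 1 else (Q1 + Q2 - 2) * (Q1 * Q2 / (Q1 * Q2 - 1)))"
    and u1: "has_weak_gradient u1 g1 \<Omega>" "g1 \<in> Lp_loc p \<Omega>"
    and u2: "has_weak_gradient u2 g2 \<Omega>" "g2 \<in> Lp_loc p \<Omega>"
    and \<phi>: "has_weak_gradient \<phi> G \<Omega>" "\<phi> \<in> Lp_loc p \<Omega>" "G \<in> Lp_loc p \<Omega>" "\<And>x. 0 \<le> \<phi> x"
    and K: "compact K" "K \<subseteq> \<Omega>" "\<And>x. x \<notin> K \<Longrightarrow> \<phi> x = 0"
  defines "g \<equiv> (\<lambda>x. if u1 x \<le> u2 x then g1 x else g2 x)"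
  shows "(\<integral>\<^sup>+x\<in>{x\<in>\<Omega>. \<phi> x \<noteq> 0}. ennreal (norm (g x) powr p) \<partial>lebesgue)
     \<le> ennreal Qbar * (\<integral>\<^sup>+x\<in>{x\<in>\<Omega>. \<phi> x \<noteq> 0}. ennreal (norm (g x + G x) powr p) \<partial>lebesgue)"
proof -
  have Q: "Q1 \<ge> 1" "Q2 \<ge> 1" using q1 q2 unfolding quasisuperminimizer_def by blast+
  obtain \<alpha>1 \<alpha>2 where \<alpha>: "0 \<le> \<alpha>1" "\<alpha>1 \<le> 1" "0 \<le> \<alpha>2" "\<alpha>2 \<le> 1" "1 \<le> \<alpha>1 + \<alpha>2"
    and \<alpha>eq: "\<alpha>2 = (1 - \<alpha>1) * Q1" "\<alpha>1 = (1 - \<alpha>2) * Q2" "Qbar = \<alpha>1 * Q1 + \<alpha>2 * Q2"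
    and Qb: "Q1 \<le> Qbar" "Q2 \<le> Qbar"
    using quasi_weights[OF Q Qbar] by metis
  define E where "E = {x \<in> \<Omega>. \<phi> x \<noteq> 0}"
  note T = quasisuperminimizer_pair_tests[OF q1 p \<Omega> u1 u2 \<phi> K]
  note S = quasisuperminimizer_pair_tests[OF q2 p \<Omega> u2 u1 \<phi> K]
  define t1 where "t1 x = indicator {x \<in> \<Omega>. max (u1 x - u2 x) 0 < \<phi> x} x *
      (norm (g1 x) powr p - Q1 * norm ((if u1 x \<le> u2 x then g1 x else g2 x) + G x) powr p)" for x
  define t2 where "t2 x = indicator {x \<in> \<Omega>. 0 < \<phi> x \<and> u1 x < u2 x} x *
      (norm (g1 x) powr p - Q1 * norm (if \<phi> x \<le> u2 x - u1 x then g1 x + G x else g2 x) powr p)" for x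
  define s1 where "s1 x = indicator {x \<in> \<Omega>. max (u2 x - u1 x) 0 < \<phi> x} x *
      (norm (g2 x) powr p - Q2 * norm ((if u2 x \<le> u1 x then g2 x else g1 x) + G x) powr p)" for x
  define s2 where "s2 x = indicator {x \<in> \<Omega>. 0 < \<phi> x \<and> u2 x < u1 x} x *
      (norm (g2 x) powr p - Q2 * norm (if \<phi> x \<le> u1 x - u2 x then g2 x + G x else g1 x) powr p)" for x
  have I: "integrable lebesgue t1" "integrable lebesgue t2" "integrable lebesgue s1" "integrable lebesgue s2"
  proof -
    show "integrable lebesgue t1" unfolding t1_def[abs_def] by (rule T(1))
    show "integrable lebesgue t2" unfolding t2_def[abs_def] by (rule T(3))
    show "integrable lebesgue s1" unfolding s1_def[abs_def] by (rule S(1))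
    show "integrable lebesgue s2" unfolding s2_def[abs_def] by (rule S(3))
  qed
  have le: "(LINT x|lebesgue. t1 x) \<le> 0" "(LINT x|lebesgue. t2 x) \<le> 0" "(LINT x|lebesgue. s1 x) \<le> 0" "(LINT x|lebesgue. s2 x) \<le> 0"
  proof -
    show "(LINT x|lebesgue. t1 x) \<le> 0" unfolding t1_def by (rule T(2))
    show "(LINT x|lebesgue. t2 x) \<le> 0" unfolding t2_def by (rule T(4))
    show "(LINT x|lebesgue. s1 x) \<le> 0" unfolding s1_def by (rule S(2))
    show "(LINT x|lebesgue. s2 x) \<le> 0" unfolding s2_def by (rule S(4))
  qed
  have gL: "g \<in> Lp_loc p \<Omega>"
  proof (rule Lp_loc_bound[OF p _ u1(2) u2(2)])
    show "g \<in> borel_measurable (lebesgue_on \<Omega>)"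
      unfolding g_def
      by (rule Lp_loc_measurable[OF has_weak_gradient_Lp_loc(2)[OF has_weak_gradient_min[OF u1(1) u2(1) \<Omega>]]])
  qed (simp add: g_def)
  have Es: "E \<in> sets lebesgue"
    unfolding E_def by (rule sets_lebesgue_nonzero[OF Lp_loc_measurable[OF \<phi>(2)] \<Omega>])
  have EK: "E \<subseteq> K" unfolding E_def using K(3) by blast
  have I1: "integrable lebesgue (\<lambda>x. indicator E x * norm (g x) powr p)"
    by (rule Lp_loc_integrable_subset[OF gL K(1,2) Es EK])
  have I2: "integrable lebesgue (\<lambda>x. indicator E x * norm (g x + G x) powr p)"
    by (rule Lp_loc_integrable_subset[OF Lp_loc_add[OF p gL \<phi>(3)] K(1,2) Es EK])
  have "AE x in lebesgue_on \<Omega>. u1 x - u2 x = 0 \<longrightarrow> g1 x - g2 x = 0"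
    by (rule weak_gradient_eq_0_on_zero_set[OF has_weak_gradient_diff[OF u1(1) u2(1) \<Omega>] \<Omega>])
  then have tie: "AE x in lebesgue. x \<in> \<Omega> \<longrightarrow> u1 x = u2 x \<longrightarrow> g1 x = g2 x"
    by (simp add: AE_lebesgue_on_iff[OF \<Omega>])
  have "(LINT x|lebesgue. indicator E x * norm (g x) powr p - Qbar * (indicator E x * norm (g x + G x) powr p))
    \<le> (LINT x|lebesgue. \<alpha>1 * t1 x + \<alpha>2 * s1 x + (1 - \<alpha>1) * t2 x + (1 - \<alpha>2) * s2 x)"
  proof (rule integral_mono_AE)
    show "AE x in lebesgue. indicator E x * norm (g x) powr p - Qbar * (indicator E x * norm (g x + G x) powr p)
      \<le> \<alpha>1 * t1 x + \<alpha>2 * s1 x + (1 - \<alpha>1) * t2 x + (1 - \<alpha>2) * s2 x"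
      using tie
    proof eventually_elim
      case (elim x)
      show ?case
      proof (cases "x \<in> E")
        case False
        then have "x \<notin> \<Omega> \<or> \<phi> x = 0" by (simp add: E_def)
        then have "t1 x = 0" "t2 x = 0" "s1 x = 0" "s2 x = 0"
          by (auto simp: t1_def t2_def s1_def s2_def)
        then show ?thesis using False by simp
      next
        case True
        then have x: "x \<in> \<Omega>" and pos: "\<phi> x > 0" using \<phi>(4)[of x] by (simp_all add: E_def less_le)
        define P1 where "P1 = norm (g1 x) powr p"
        define P2 where "P2 = norm (g2 x) powr p"
        define V where "V = norm (g x + G x) powr p"
        have V: "V \<ge> 0" by (simp add: V_def)
        have gE: "indicator E x * norm (g x) powr p - Qbar * (indicator E x * norm (g x + G x) powr p)
          = norm (g x) powr p - Qbar * V"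
          using True by (simp add: V_def)
        \<comment> \<open>The cancellation on the set where both functions lie below \<open>v\<close>: the energy of the larger
            function drops out.\<close>
        have c1: "\<alpha>1 * (P1 - Q1 * V) + \<alpha>2 * (P2 - Q2 * V) + (1 - \<alpha>1) * (P1 - Q1 * P2) = P1 - Qbar * V"
        proof -
          have "(1 - \<alpha>1) * (P1 - Q1 * P2) = (1 - \<alpha>1) * P1 - ((1 - \<alpha>1) * Q1) * P2"
            by (simp add: algebra_simps)
          also have "\<dots> = (1 - \<alpha>1) * P1 - \<alpha>2 * P2" by (simp only: \<alpha>eq(1)[symmetric])
          finally show ?thesis unfolding \<alpha>eq(3) by (simp add: algebra_simps)
        qed
        have c2: "\<alpha>1 * (P1 - Q1 * V) + \<alpha>2 * (P2 - Q2 * V) + (1 - \<alpha>2) * (P2 - Q2 * P1) = P2 - Qbar * V"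
        proof -
          have "(1 - \<alpha>2) * (P2 - Q2 * P1) = (1 - \<alpha>2) * P2 - ((1 - \<alpha>2) * Q2) * P1"
            by (simp add: algebra_simps)
          also have "\<dots> = (1 - \<alpha>2) * P2 - \<alpha>1 * P1" by (simp only: \<alpha>eq(2)[symmetric])
          finally show ?thesis unfolding \<alpha>eq(3) by (simp add: algebra_simps)
        qed
        have c3: "\<alpha> * y + (1 - \<alpha>) * y = y" for \<alpha> y :: real by (simp add: left_diff_distrib)
        have c4: "\<alpha>1 * (P1 - Q1 * V) + \<alpha>2 * (P1 - Q2 * V) = (\<alpha>1 + \<alpha>2) * P1 - Qbar * V"
          unfolding \<alpha>eq(3) by (simp add: algebra_simps)
        have Q1V: "Q1 * V \<le> Qbar * V" and Q2V: "Q2 * V \<le> Qbar * V"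
          using Qb V by (simp_all add: mult_right_mono)
        consider (l1) "u1 x < u2 x" "\<phi> x \<le> u2 x - u1 x" | (l2) "u1 x < u2 x" "\<phi> x > u2 x - u1 x"
          | (g1) "u2 x < u1 x" "\<phi> x \<le> u1 x - u2 x" | (g2) "u2 x < u1 x" "\<phi> x > u1 x - u2 x"
          | (e) "u1 x = u2 x" by linarith
        then show ?thesis
        proof cases
          case l1
          then have "t1 x = P1 - Q1 * V" "t2 x = P1 - Q1 * V" "s1 x = 0" "s2 x = 0" "g x = g1 x"
            using x pos by (simp_all add: t1_def t2_def s1_def s2_def P1_def V_def g_def)
          then show ?thesis unfolding gE using Q1V c3[of \<alpha>1 "P1 - Q1 * V"] by (simp add: P1_def[symmetric])
        next
          case l2
          then have "t1 x = P1 - Q1 * V" "t2 x = P1 - Q1 * P2" "s1 x = P2 - Q2 * V" "s2 x = 0" "g x = g1 x"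
            using x pos by (simp_all add: t1_def t2_def s1_def s2_def P1_def P2_def V_def g_def)
          then show ?thesis unfolding gE using c1 by (simp add: P1_def[symmetric])
        next
          case g1
          then have "t1 x = 0" "t2 x = 0" "s1 x = P2 - Q2 * V" "s2 x = P2 - Q2 * V" "g x = g2 x"
            using x pos by (simp_all add: t1_def t2_def s1_def s2_def P2_def V_def g_def)
          then show ?thesis unfolding gE using Q2V c3[of \<alpha>2 "P2 - Q2 * V"] by (simp add: P2_def[symmetric])
        next
          case g2
          then have "t1 x = P1 - Q1 * V" "t2 x = 0" "s1 x = P2 - Q2 * V" "s2 x = P2 - Q2 * P1" "g x = g2 x"
            using x pos by (simp_all add: t1_def t2_def s1_def s2_def P1_def P2_def V_def g_def)
          then show ?thesis unfolding gE using c2 by (simp add: P2_def[symmetric])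
        next
          case e
          then have eq: "g1 x = g2 x" using elim x by simp
          then have "t1 x = P1 - Q1 * V" "t2 x = 0" "s1 x = P1 - Q2 * V" "s2 x = 0" "g x = g1 x"
            using x pos e by (simp_all add: t1_def t2_def s1_def s2_def P1_def V_def g_def)
          moreover have "P1 \<le> (\<alpha>1 + \<alpha>2) * P1"
            using mult_right_mono[OF \<alpha>(5), of P1] by (simp add: P1_def)
          ultimately show ?thesis unfolding gE using c4
            by (simp add: P1_def[symmetric])
        qed
      qed
    qed
  qed (intro Bochner_Integration.integrable_add Bochner_Integration.integrable_diff integrable_mult_right I I1 I2)+
  also have "\<dots> = \<alpha>1 * (LINT x|lebesgue. t1 x) + \<alpha>2 * (LINT x|lebesgue. s1 x)
      + (1 - \<alpha>1) * (LINT x|lebesgue. t2 x) + (1 - \<alpha>2) * (LINT x|lebesgue. s2 x)"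
    using I by simp
  also have "\<dots> \<le> 0"
    using \<alpha> le by (intro add_nonpos_nonpos mult_nonneg_nonpos) simp_all
  finally have "(LINT x|lebesgue. indicator E x * norm (g x) powr p)
      \<le> Qbar * (LINT x|lebesgue. indicator E x * norm (g x + G x) powr p)"
    using I1 I2 by simp
  then have "ennreal (LINT x|lebesgue. indicator E x * norm (g x) powr p)
      \<le> ennreal Qbar * ennreal (LINT x|lebesgue. indicator E x * norm (g x + G x) powr p)"
    using Q Qb by (simp add: ennreal_mult'[symmetric] ennreal_leI)
  then show ?thesis
    unfolding E_def[symmetric] set_nn_integral_eq_ennreal_integral[OF I1 powr_ge_zero]
      set_nn_integral_eq_ennreal_integral[OF I2 powr_ge_zero] .
qed

text \<open>
  The approximating sequence is passed to a subsequence, so that the functions converge almost everywhere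
  and not only in \<open>L\<^sup>p\<close>.
\<close>

lemma W1p_0_approximation:
  fixes \<phi> :: "'a::euclidean_space \<Rightarrow> real"
  assumes p: "p \<ge> 1" and \<Omega>: "open \<Omega>" and \<phi>: "\<phi> \<in> W1p_0 p \<Omega>"
    and G: "has_weak_gradient \<phi> G \<Omega>" "G \<in> Lp p \<Omega>"
  obtains \<psi> where "\<And>n::nat. \<psi> n \<in> test_fun \<Omega>"
    "AE x in lebesgue_on \<Omega>. (\<lambda>n. \<psi> n x) \<longlonglongrightarrow> \<phi> x"
    "(\<lambda>n. LINT x|lebesgue_on \<Omega>. norm (gradient (\<psi> n) x - G x) powr p) \<longlonglongrightarrow> 0"
    "\<And>n. integrable (lebesgue_on \<Omega>) (\<lambda>x. norm (gradient (\<psi> n) x - G x) powr p)"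
proof -
  note \<Omega>s = open_sets_lebesgue[OF \<Omega>]
  have \<phi>Lp: "\<phi> \<in> Lp p \<Omega>" using \<phi> unfolding W1p_0_def W1p_def by blast
  have "\<exists>\<psi>\<in>test_fun \<Omega>. W1p_norm p \<Omega> (\<lambda>x. \<phi> x - \<psi> x) < (1 / real (Suc n)) powr (1 / p)" for n
    using \<phi> unfolding W1p_0_def by simp
  then obtain \<theta> where \<theta>: "\<And>n. \<theta> n \<in> test_fun \<Omega>"
    and \<theta>n: "\<And>n. W1p_norm p \<Omega> (\<lambda>x. \<phi> x - \<theta> n x) < (1 / real (Suc n)) powr (1 / p)"
    by metis
  define a where "a n = (LINT x|lebesgue_on \<Omega>. \<bar>\<phi> x - \<theta> n x\<bar> powr p)" for n
  define b where "b n = (LINT x|lebesgue_on \<Omega>. norm (gradient (\<theta> n) x - G x) powr p)" for n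
  have Ia: "integrable (lebesgue_on \<Omega>) (\<lambda>x. \<bar>\<phi> x - \<theta> n x\<bar> powr p)" for n
  proof -
    have \<theta>L: "\<theta> n \<in> Lp p \<Omega>" using p by (intro test_fun_Lp(1)[OF _ \<theta> \<Omega>s]) simp
    have "(\<lambda>x. \<phi> x - \<theta> n x) \<in> Lp p \<Omega>"
      by (rule Lp_bound[OF p borel_measurable_diff[OF Lp_measurable[OF \<phi>Lp] Lp_measurable[OF \<theta>L]] \<phi>Lp \<theta>L])
         (rule norm_triangle_ineq4)
    then show ?thesis by (simp add: Lp_def)
  qed
  have Ib: "integrable (lebesgue_on \<Omega>) (\<lambda>x. norm (gradient (\<theta> n) x - G x) powr p)" for n
  proof -
    have \<theta>L: "gradient (\<theta> n) \<in> Lp p \<Omega>" using p by (intro test_fun_Lp(2)[OF _ \<theta> \<Omega>s]) simp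
    have "(\<lambda>x. gradient (\<theta> n) x - G x) \<in> Lp p \<Omega>"
      by (rule Lp_bound[OF p borel_measurable_diff[OF Lp_measurable[OF \<theta>L] Lp_measurable[OF G(2)]] \<theta>L G(2)])
         (rule norm_triangle_ineq4)
    then show ?thesis by (simp add: Lp_def)
  qed
  have ab0: "0 \<le> a n" "0 \<le> b n" for n by (simp_all add: a_def b_def)
  have ab: "a n + b n \<le> 1 / Suc n" for n
  proof (rule ccontr)
    assume "\<not> a n + b n \<le> 1 / Suc n"
    then have "(1 / real (Suc n)) powr (1 / p) \<le> (a n + b n) powr (1 / p)"
      using p by (intro powr_mono2) auto
    moreover have "b n = (LINT x|lebesgue_on \<Omega>. norm (weak_grad \<Omega> (\<lambda>x. \<phi> x - \<theta> n x) x) powr p)"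
    proof -
      have d: "has_weak_gradient (\<lambda>x. \<phi> x - \<theta> n x) (\<lambda>x. G x - gradient (\<theta> n) x) \<Omega>"
        by (intro has_weak_gradient_diff G test_fun_has_weak_gradient \<theta> \<Omega>)
      have m: "weak_grad \<Omega> (\<lambda>x. \<phi> x - \<theta> n x) \<in> borel_measurable (lebesgue_on \<Omega>)"
        by (rule Lp_loc_measurable[OF has_weak_gradient_Lp_loc(2)[OF has_weak_gradient_weak_grad[OF d]]])
      show ?thesis unfolding b_def
      proof (rule integral_cong_AE)
        show "(\<lambda>x. norm (gradient (\<theta> n) x - G x) powr p) \<in> borel_measurable (lebesgue_on \<Omega>)"
          by (rule borel_measurable_integrable[OF Ib])
        show "(\<lambda>x. norm (weak_grad \<Omega> (\<lambda>x. \<phi> x - \<theta> n x) x) powr p) \<in> borel_measurable (lebesgue_on \<Omega>)"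
          using m by measurable
        show "AE x in lebesgue_on \<Omega>. norm (gradient (\<theta> n) x - G x) powr p = norm (weak_grad \<Omega> (\<lambda>x. \<phi> x - \<theta> n x) x) powr p"
          using weak_grad_AE_eq[OF d \<Omega>] by eventually_elim (simp add: norm_minus_commute)
      qed
    qed
    ultimately show False using \<theta>n[of n] unfolding W1p_norm_def a_def by simp
  qed
  have a_lim: "a \<longlonglongrightarrow> 0" and b_lim: "b \<longlonglongrightarrow> 0"
  proof -
    have "norm (a n) \<le> 1 / Suc n" "norm (b n) \<le> 1 / Suc n" for n
      using ab[of n] ab0[of n] by simp_all
    then show "a \<longlonglongrightarrow> 0" "b \<longlonglongrightarrow> 0"
      using Lim_null_comparison[OF always_eventually LIMSEQ_1_over_Suc] by blast+
  qed
  obtain r :: "nat \<Rightarrow> nat" where r: "strict_mono r"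
    and ae: "AE x in lebesgue_on \<Omega>. (\<lambda>n. \<bar>\<phi> x - \<theta> (r n) x\<bar> powr p) \<longlonglongrightarrow> 0"
    using tendsto_L1_AE_subseq[of "lebesgue_on \<Omega>" "\<lambda>n x. \<bar>\<phi> x - \<theta> n x\<bar> powr p"] Ia a_lim
    unfolding a_def by auto
  show thesis
  proof (rule that[of "\<lambda>n. \<theta> (r n)"])
    show "\<theta> (r n) \<in> test_fun \<Omega>" for n by (rule \<theta>)
    show "integrable (lebesgue_on \<Omega>) (\<lambda>x. norm (gradient (\<theta> (r n)) x - G x) powr p)" for n by (rule Ib)
    show "(\<lambda>n. LINT x|lebesgue_on \<Omega>. norm (gradient (\<theta> (r n)) x - G x) powr p) \<longlonglongrightarrow> 0"
      using LIMSEQ_subseq_LIMSEQ[OF b_lim r] by (simp add: b_def comp_def)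
    show "AE x in lebesgue_on \<Omega>. (\<lambda>n. \<theta> (r n) x) \<longlonglongrightarrow> \<phi> x"
      using ae
    proof eventually_elim
      case (elim x)
      have "(\<lambda>n. (\<bar>\<phi> x - \<theta> (r n) x\<bar> powr p) powr (1 / p)) \<longlonglongrightarrow> 0 powr (1 / p)"
        using p elim by (intro tendsto_powr' tendsto_const) auto
      then have "(\<lambda>n. \<bar>\<phi> x - \<theta> (r n) x\<bar>) \<longlonglongrightarrow> 0" using p by (simp add: powr_powr)
      then have "(\<lambda>n. \<phi> x - \<theta> (r n) x) \<longlonglongrightarrow> 0" by (rule tendsto_rabs_zero_cancel)
      from tendsto_diff[OF tendsto_const[of "\<phi> x"] this] show ?case by simp
    qed
  qed
qed

lemma set_nn_integral_lebesgue_on: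
  assumes "open \<Omega>" "E \<subseteq> \<Omega>"
  shows "(\<integral>\<^sup>+x\<in>E. f x \<partial>lebesgue) = (\<integral>\<^sup>+x\<in>E. f x \<partial>lebesgue_on \<Omega>)"
proof -
  have "(\<integral>\<^sup>+x\<in>E. f x \<partial>lebesgue_on \<Omega>) = (\<integral>\<^sup>+x. f x * indicator E x * indicator \<Omega> x \<partial>lebesgue)"
    using open_sets_lebesgue[OF assms(1)] by (subst nn_integral_restrict_space) simp_all
  also have "\<dots> = (\<integral>\<^sup>+x\<in>E. f x \<partial>lebesgue)"
    by (rule nn_integral_cong) (use assms(2) in \<open>auto simp: indicator_def\<close>)
  finally show ?thesis ..
qed

text \<open>
  The compactly supported case is applied to \<open>min \<phi>\<^sup>+ \<psi>\<^sub>n\<^sup>+\<close>, whose support lies in that of the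
  test function \<open>\<psi>\<^sub>n\<close> and which is positive exactly where \<open>\<phi>\<close> and \<open>\<psi>\<^sub>n\<close> are. First \<open>n\<close> tends to infinity
  for fixed \<open>t\<close>, with Fatou's lemma on the left, then \<open>t\<close> tends to \<open>0\<close>.
\<close>

lemma quasi_min_inequality:
  fixes u1 u2 :: "'a::euclidean_space \<Rightarrow> real"
  assumes q1: "quasisuperminimizer p Q1 \<Omega> u1" and q2: "quasisuperminimizer p Q2 \<Omega> u2"
    and p: "p \<ge> 1" and \<Omega>: "open \<Omega>"
    and Qbar: "Qbar = (if Q1 = 1 \<and> Q2 = 1 then 1 else (Q1 + Q2 - 2) * (Q1 * Q2 / (Q1 * Q2 - 1)))"
    and Qpos: "Qbar \<ge> 1"
    and u1: "has_weak_gradient u1 g1 \<Omega>" "g1 \<in> Lp_loc p \<Omega>"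
    and u2: "has_weak_gradient u2 g2 \<Omega>" "g2 \<in> Lp_loc p \<Omega>"
    and \<phi>: "\<phi> \<in> W1p_0 p \<Omega>" "AE x in lebesgue_on \<Omega>. 0 \<le> \<phi> x"
    and G: "has_weak_gradient \<phi> G \<Omega>" "G \<in> Lp p \<Omega>"
    and g: "g = (\<lambda>x. if u1 x \<le> u2 x then g1 x else g2 x)"
  shows "(\<integral>\<^sup>+x\<in>{x\<in>\<Omega>. \<phi> x \<noteq> 0}. ennreal (norm (g x) powr p) \<partial>lebesgue)
     \<le> ennreal Qbar * (\<integral>\<^sup>+x\<in>{x\<in>\<Omega>. \<phi> x \<noteq> 0}. ennreal (norm (g x + G x) powr p) \<partial>lebesgue)"
proof -
  define M where "M = lebesgue_on \<Omega>"
  define E where "E = {x \<in> \<Omega>. \<phi> x \<noteq> 0}"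
  have spM: "space M = \<Omega>" by (simp add: M_def space_restrict_space)
  have \<phi>Lp: "\<phi> \<in> Lp p \<Omega>" using \<phi>(1) unfolding W1p_0_def W1p_def by blast
  have gw: "has_weak_gradient (\<lambda>x. min (u1 x) (u2 x)) g \<Omega>"
    unfolding g by (rule has_weak_gradient_min[OF u1(1) u2(1) \<Omega>])
  have gm [measurable]: "g \<in> borel_measurable M"
    unfolding M_def by (rule Lp_loc_measurable[OF has_weak_gradient_Lp_loc(2)[OF gw]])
  have Gm [measurable]: "G \<in> borel_measurable M" unfolding M_def by (rule Lp_measurable[OF G(2)])
  have \<phi>m [measurable]: "\<phi> \<in> borel_measurable M" unfolding M_def by (rule Lp_measurable[OF \<phi>Lp])
  obtain \<psi> where \<psi>: "\<And>n::nat. \<psi> n \<in> test_fun \<Omega>"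
    and \<psi>_ae: "AE x in M. (\<lambda>n. \<psi> n x) \<longlonglongrightarrow> \<phi> x"
    and \<psi>_lim: "(\<lambda>n. LINT x|M. norm (gradient (\<psi> n) x - G x) powr p) \<longlonglongrightarrow> 0"
    and \<psi>_int: "\<And>n. integrable M (\<lambda>x. norm (gradient (\<psi> n) x - G x) powr p)"
    by (rule W1p_0_approximation[OF p \<Omega> \<phi>(1) G, folded M_def]) (rule that)
  define b where "b n = (LINT x|M. norm (gradient (\<psi> n) x - G x) powr p)" for n
  have b0: "b n \<ge> 0" for n by (simp add: b_def)
  define \<phi>' where "\<phi>' = (\<lambda>x. max (\<phi> x) 0)"
  define G' where "G' = (\<lambda>x. if 0 < \<phi> x then G x else 0)"
  have \<phi>'w: "has_weak_gradient \<phi>' G' \<Omega>"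
    unfolding \<phi>'_def G'_def by (rule has_weak_gradient_pos_part[OF G(1) \<Omega>])
  have \<phi>'L: "\<phi>' \<in> Lp_loc p \<Omega>"
    by (rule Lp_loc_bound[OF p Lp_loc_measurable[OF has_weak_gradient_Lp_loc(1)[OF \<phi>'w]] Lp_imp_Lp_loc[OF \<phi>Lp \<Omega>] Lp_imp_Lp_loc[OF \<phi>Lp \<Omega>]])
       (simp add: \<phi>'_def)
  have G'L: "G' \<in> Lp_loc p \<Omega>"
    by (rule Lp_loc_bound[OF p Lp_loc_measurable[OF has_weak_gradient_Lp_loc(2)[OF \<phi>'w]] Lp_imp_Lp_loc[OF G(2) \<Omega>] Lp_imp_Lp_loc[OF G(2) \<Omega>]])
       (simp add: G'_def)
  have \<phi>'0: "0 \<le> \<phi>' x" for x by (simp add: \<phi>'_def)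
  define En where "En n = {x \<in> \<Omega>. 0 < \<phi> x \<and> 0 < \<psi> n x}" for n
  have \<psi>m [measurable]: "\<psi> n \<in> borel_measurable M" for n
    unfolding M_def
    by (intro measurable_restrict_space1 borel_imp_lebesgue_measurable smooth_borel_measurable test_fun_smooth[OF \<psi>])
  have Es [measurable]: "E \<in> sets M"
  proof -
    have "{x \<in> space M. \<phi> x \<noteq> 0} \<in> sets M" by measurable
    then show ?thesis unfolding spM E_def .
  qed
  have Ens [measurable]: "En n \<in> sets M" for n
  proof -
    have "{x \<in> space M. 0 < \<phi> x \<and> 0 < \<psi> n x} \<in> sets M" by measurable
    then show ?thesis unfolding spM En_def .
  qed
  define B where "B = (\<integral>\<^sup>+x\<in>E. ennreal (norm (g x + G x) powr p) \<partial>M)"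
  have step: "(\<integral>\<^sup>+x\<in>En n. ennreal (norm (g x) powr p) \<partial>M)
     \<le> ennreal Qbar * (ennreal ((1 + t) powr p) * B + ennreal ((1 + 1 / t) powr p) * ennreal (b n))"
    if t: "t > 0" for n t
  proof -
    define \<Phi> where "\<Phi> = (\<lambda>x. min (\<phi>' x) (max (\<psi> n x) 0))"
    define H where "H = (\<lambda>x. if \<phi>' x \<le> max (\<psi> n x) 0 then G' x else if 0 < \<psi> n x then gradient (\<psi> n) x else 0)"
    have gl: "gradient (\<psi> n) \<in> Lp_loc p \<Omega>"
      using p by (intro Lp_imp_Lp_loc[OF test_fun_Lp(2)[OF _ \<psi> open_sets_lebesgue[OF \<Omega>]] \<Omega>]) simp
    note tr = truncation_Lp_loc[OF p \<Omega> \<phi>'w \<phi>'L G'L \<phi>'0 test_fun_has_weak_gradient[OF \<psi>[of n] \<Omega>] gl, folded \<Phi>_def H_def]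
    obtain K where K: "compact K" "K \<subseteq> \<Omega>" "\<And>x. x \<notin> K \<Longrightarrow> \<psi> n x = 0"
      using test_funE[OF \<psi>[of n]] by metis
    have \<Phi>0: "0 \<le> \<Phi> x" for x using \<phi>'0[of x] by (simp add: \<Phi>_def)
    have \<Phi>K: "\<Phi> x = 0" if "x \<notin> K" for x using K(3)[OF that] \<phi>'0[of x] by (simp add: \<Phi>_def)
    have En: "{x \<in> \<Omega>. \<Phi> x \<noteq> 0} = En n"
    proof -
      have "\<Phi> x \<noteq> 0 \<longleftrightarrow> 0 < \<phi> x \<and> 0 < \<psi> n x" for x
        by (simp add: \<Phi>_def \<phi>'_def min_def max_def)
      then show ?thesis by (simp add: En_def)
    qed
    have EnS: "En n \<subseteq> \<Omega>" by (auto simp: En_def)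
    have "(\<integral>\<^sup>+x\<in>En n. ennreal (norm (g x) powr p) \<partial>M) \<le> ennreal Qbar * (\<integral>\<^sup>+x\<in>En n. ennreal (norm (g x + H x) powr p) \<partial>M)"
      using quasi_min_compact_support[OF q1 q2 p \<Omega> Qbar u1 u2 tr \<Phi>0 K(1,2) \<Phi>K]
      unfolding En g[symmetric] set_nn_integral_lebesgue_on[OF \<Omega> EnS] M_def g[THEN fun_cong, symmetric] .
    also have "\<dots> \<le> ennreal Qbar * (\<integral>\<^sup>+x. ennreal ((1 + t) powr p) * (ennreal (norm (g x + G x) powr p) * indicator E x)
         + ennreal ((1 + 1 / t) powr p) * ennreal (norm (gradient (\<psi> n) x - G x) powr p) \<partial>M)"
    proof (intro mult_left_mono nn_integral_mono)
      fix x
      show "ennreal (norm (g x + H x) powr p) * indicator (En n) x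
        \<le> ennreal ((1 + t) powr p) * (ennreal (norm (g x + G x) powr p) * indicator E x)
         + ennreal ((1 + 1 / t) powr p) * ennreal (norm (gradient (\<psi> n) x - G x) powr p)"
      proof (cases "x \<in> En n")
        case True
        then have xE: "x \<in> E" and H: "H x = G x \<or> H x = gradient (\<psi> n) x"
          by (auto simp: En_def E_def H_def G'_def)
        have "norm (g x + H x) \<le> norm (g x + G x) + norm (gradient (\<psi> n) x - G x)"
          using H
        proof
          assume "H x = gradient (\<psi> n) x"
          then have "g x + H x = (g x + G x) + (gradient (\<psi> n) x - G x)" by simp
          then show ?thesis by (simp only: norm_triangle_ineq)
        qed simp
        then have "norm (g x + H x) powr p \<le> (1 + t) powr p * norm (g x + G x) powr p
           + (1 + 1 / t) powr p * norm (gradient (\<psi> n) x - G x) powr p"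
          by (intro powr_abs_add_le t p) simp_all
        then have "ennreal (norm (g x + H x) powr p) \<le> ennreal ((1 + t) powr p * norm (g x + G x) powr p
           + (1 + 1 / t) powr p * norm (gradient (\<psi> n) x - G x) powr p)" by (rule ennreal_leI)
        then show ?thesis using True xE by (simp add: ennreal_mult)
      qed simp
    qed simp
    also have "(\<integral>\<^sup>+x. ennreal ((1 + t) powr p) * (ennreal (norm (g x + G x) powr p) * indicator E x)
         + ennreal ((1 + 1 / t) powr p) * ennreal (norm (gradient (\<psi> n) x - G x) powr p) \<partial>M)
      = ennreal ((1 + t) powr p) * B + ennreal ((1 + 1 / t) powr p) * (\<integral>\<^sup>+x. ennreal (norm (gradient (\<psi> n) x - G x) powr p) \<partial>M)"
    proof -
      have m1: "(\<lambda>x. ennreal (norm (g x + G x) powr p) * indicator E x) \<in> borel_measurable M"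
        by measurable
      have m2: "(\<lambda>x. ennreal (norm (gradient (\<psi> n) x - G x) powr p)) \<in> borel_measurable M"
        by (intro measurable_compose[OF borel_measurable_integrable[OF \<psi>_int] measurable_ennreal])
      show ?thesis
        unfolding B_def nn_integral_cmult[OF m1, symmetric] nn_integral_cmult[OF m2, symmetric]
        by (rule nn_integral_add; intro borel_measurable_times_ennreal borel_measurable_const m1 m2)
    qed
    also have "(\<integral>\<^sup>+x. ennreal (norm (gradient (\<psi> n) x - G x) powr p) \<partial>M) = ennreal (b n)"
      unfolding b_def by (rule nn_integral_eq_integral[OF \<psi>_int]) simp
    finally show ?thesis .
  qed
  have fatou: "(\<integral>\<^sup>+x\<in>E. ennreal (norm (g x) powr p) \<partial>M)
      \<le> liminf (\<lambda>n. \<integral>\<^sup>+x\<in>En n. ennreal (norm (g x) powr p) \<partial>M)"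
  proof -
    have "AE x in M. 0 \<le> \<phi> x" using \<phi>(2) unfolding M_def .
    with \<psi>_ae have "AE x in M. ennreal (norm (g x) powr p) * indicator E x
        \<le> liminf (\<lambda>n. ennreal (norm (g x) powr p) * indicator (En n) x)"
    proof eventually_elim
      case (elim x)
      show ?case
      proof (cases "x \<in> E")
        case True
        then have "x \<in> \<Omega>" "0 < \<phi> x" using elim(2) by (auto simp: E_def less_le)
        then have "\<forall>\<^sub>F n in sequentially. 0 < \<psi> n x" by (intro order_tendstoD(1)[OF elim(1)])
        then have "\<forall>\<^sub>F n in sequentially. ennreal (norm (g x) powr p) * indicator E x \<le> ennreal (norm (g x) powr p) * indicator (En n) x"
          by eventually_elim (use \<open>x \<in> \<Omega>\<close> \<open>0 < \<phi> x\<close> in \<open>simp add: En_def indicator_def\<close>)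
        then show ?thesis by (rule Liminf_bounded)
      qed simp
    qed
    then have "(\<integral>\<^sup>+x\<in>E. ennreal (norm (g x) powr p) \<partial>M)
       \<le> (\<integral>\<^sup>+x. liminf (\<lambda>n. ennreal (norm (g x) powr p) * indicator (En n) x) \<partial>M)"
      by (rule nn_integral_mono_AE)
    also have "\<dots> \<le> liminf (\<lambda>n. \<integral>\<^sup>+x\<in>En n. ennreal (norm (g x) powr p) \<partial>M)"
      by (rule nn_integral_liminf) measurable
    finally show ?thesis .
  qed
  have "(\<integral>\<^sup>+x\<in>E. ennreal (norm (g x) powr p) \<partial>M) \<le> ennreal Qbar * B"
  proof (cases "B = \<infinity>")
    case True
    then show ?thesis using Qpos by (simp add: ennreal_mult_top)
  next
    case False
    then obtain \<beta> where \<beta>: "\<beta> \<ge> 0" "B = ennreal \<beta>" by (cases B) auto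
    have bound: "(\<integral>\<^sup>+x\<in>E. ennreal (norm (g x) powr p) \<partial>M) \<le> ennreal (Qbar * ((1 + t) powr p * \<beta>))" if t: "t > 0" for t
    proof -
      have "liminf (\<lambda>n. \<integral>\<^sup>+x\<in>En n. ennreal (norm (g x) powr p) \<partial>M)
        \<le> liminf (\<lambda>n. ennreal (Qbar * ((1 + t) powr p * \<beta> + (1 + 1 / t) powr p * b n)))"
      proof (intro Liminf_mono always_eventually allI)
        fix n
        have "ennreal Qbar * (ennreal ((1 + t) powr p) * B + ennreal ((1 + 1 / t) powr p) * ennreal (b n))
          = ennreal (Qbar * ((1 + t) powr p * \<beta> + (1 + 1 / t) powr p * b n))"
          using Qpos \<beta> b0[of n] by (simp add: ennreal_mult)
        with step[OF t, of n] show "(\<integral>\<^sup>+x\<in>En n. ennreal (norm (g x) powr p) \<partial>M)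
           \<le> ennreal (Qbar * ((1 + t) powr p * \<beta> + (1 + 1 / t) powr p * b n))" by simp
      qed
      also have "\<dots> = ennreal (Qbar * ((1 + t) powr p * \<beta> + (1 + 1 / t) powr p * 0))"
        by (intro lim_imp_Liminf tendsto_ennrealI tendsto_intros \<psi>_lim[folded b_def]) simp
      finally show ?thesis using fatou by simp
    qed
    have "(\<lambda>k. ennreal (Qbar * ((1 + 1 / real (Suc k)) powr p * \<beta>))) \<longlonglongrightarrow> ennreal (Qbar * ((1 + 0) powr p * \<beta>))"
      by (intro tendsto_ennrealI tendsto_mult tendsto_const tendsto_powr tendsto_add LIMSEQ_1_over_Suc) simp
    then have "(\<integral>\<^sup>+x\<in>E. ennreal (norm (g x) powr p) \<partial>M) \<le> ennreal (Qbar * ((1 + 0) powr p * \<beta>))"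
      by (rule LIMSEQ_le_const) (intro exI allI impI bound, simp)
    also have "\<dots> = ennreal Qbar * B" using Qpos \<beta> by (simp add: ennreal_mult)
    finally show ?thesis .
  qed
  moreover have "E \<subseteq> \<Omega>" by (auto simp: E_def)
  ultimately show ?thesis
    unfolding B_def E_def[symmetric] M_def by (simp only: set_nn_integral_lebesgue_on[OF \<Omega>])
qed

theorem theorem1p2:
  fixes p Q1 Q2 Qbar :: real
    and \<Omega> :: "(real ^ 'n) set"
    and u1 u2 :: "real ^ 'n \<Rightarrow> real"
  assumes "1 < p"
    and "open \<Omega>" and "\<Omega> \<noteq> {}"
    and "Q1 \<ge> 1" and "Q2 \<ge> 1"
    and "quasisuperminimizer p Q1 \<Omega> u1"
    and "quasisuperminimizer p Q2 \<Omega> u2"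
    and Qbar: "Qbar = (if Q1 = 1 \<and> Q2 = 1 then 1
                       else (Q1 + Q2 - 2) * (Q1 * Q2 / (Q1 * Q2 - 1)))"
  shows "quasisuperminimizer p Qbar \<Omega> (\<lambda>x. min (u1 x) (u2 x))
       \<and> (Q1 = Q2 \<longrightarrow> Qbar = 2 * Q1\<^sup>2 / (Q1 + 1))"
proof (intro conjI impI)
  have p: "p \<ge> 1" using \<open>1 < p\<close> by simp
  note \<Omega> = \<open>open \<Omega>\<close>
  have "Q1 \<le> Qbar" using quasi_weights[OF \<open>Q1 \<ge> 1\<close> \<open>Q2 \<ge> 1\<close> Qbar] by metis
  then have Qpos: "Qbar \<ge> 1" using \<open>Q1 \<ge> 1\<close> by simp
  obtain g1 where u1: "u1 \<in> Lp_loc p \<Omega>" "has_weak_gradient u1 g1 \<Omega>" "g1 \<in> Lp_loc p \<Omega>"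
    using assms(6) unfolding quasisuperminimizer_def W1p_loc_def by blast
  obtain g2 where u2: "u2 \<in> Lp_loc p \<Omega>" "has_weak_gradient u2 g2 \<Omega>" "g2 \<in> Lp_loc p \<Omega>"
    using assms(7) unfolding quasisuperminimizer_def W1p_loc_def by blast
  define u where "u = (\<lambda>x. min (u1 x) (u2 x))"
  define g where "g = (\<lambda>x. if u1 x \<le> u2 x then g1 x else g2 x)"
  have ug: "has_weak_gradient u g \<Omega>"
    unfolding u_def g_def by (rule has_weak_gradient_min[OF u1(2) u2(2) \<Omega>])
  note m = has_weak_gradient_Lp_loc[OF ug, THEN Lp_loc_measurable]
  have "u \<in> Lp_loc p \<Omega>"
    by (rule Lp_loc_bound[OF p m(1) u1(1) u2(1)]) (simp add: u_def min_def)
  moreover have "g \<in> Lp_loc p \<Omega>"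
    by (rule Lp_loc_bound[OF p m(2) u1(3) u2(3)]) (simp add: g_def)
  ultimately have W: "u \<in> W1p_loc p \<Omega>" unfolding W1p_loc_def using ug by blast
  have "(\<integral>\<^sup>+x\<in>{x\<in>\<Omega>. \<phi> x \<noteq> 0}. ennreal (norm (weak_grad \<Omega> u x) powr p) \<partial>lebesgue)
        \<le> ennreal Qbar * (\<integral>\<^sup>+x\<in>{x\<in>\<Omega>. \<phi> x \<noteq> 0}. ennreal (norm (weak_grad \<Omega> (\<lambda>y. u y + \<phi> y) x) powr p) \<partial>lebesgue)"
    if \<phi>: "\<phi> \<in> W1p_0 p \<Omega>" "AE x in lebesgue_on \<Omega>. 0 \<le> \<phi> x" for \<phi>
  proof -
    obtain G where G: "has_weak_gradient \<phi> G \<Omega>" "G \<in> Lp p \<Omega>"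
      using \<phi>(1) unfolding W1p_0_def W1p_def by blast
    note sum = has_weak_gradient_add[OF ug G(1) \<Omega>]
    show ?thesis
      unfolding set_nn_integral_weak_grad[OF ug \<Omega>] set_nn_integral_weak_grad[OF sum \<Omega>]
      by (rule quasi_min_inequality[OF assms(6,7) p \<Omega> Qbar Qpos u1(2,3) u2(2,3) \<phi> G g_def])
  qed
  with Qpos W show "quasisuperminimizer p Qbar \<Omega> (\<lambda>x. min (u1 x) (u2 x))"
    unfolding quasisuperminimizer_def u_def by blast
next
  assume eq: "Q1 = Q2"
  show "Qbar = 2 * Q1\<^sup>2 / (Q1 + 1)"
  proof (cases "Q1 = 1")
    case True
    then show ?thesis using eq by (simp add: Qbar)
  next
    case False
    have "Q1 * Q1 - 1 = (Q1 - 1) * (Q1 + 1)" by (simp add: algebra_simps)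
    then have "Qbar = (2 * (Q1 - 1)) * (Q1 * Q1 / ((Q1 - 1) * (Q1 + 1)))"
      using False eq by (simp add: Qbar)
    also have "\<dots> = 2 * Q1\<^sup>2 / (Q1 + 1)"
    proof -
      have "2 * c * (q / (c * d)) = 2 * q / d" if "c \<noteq> 0" for c d q :: real using that by simp
      from this[of "Q1 - 1" "Q1 * Q1" "Q1 + 1"] show ?thesis using False by (simp add: power2_eq_square)
    qed
    finally show ?thesis .
  qed
qed

end
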